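(* Let $I,J$ be disjoint index sets and let $z_n=((z_{n,i})_{i\in I},(z_{n,j})_{j\in J})$, $n\in\mathbb{N}$, be a free-Boolean independent sequence of two-faced families of random variables in a noncommutative probability space $(\mathcal{A},\phi)$ such that: 1. $\phi(z_{n,k})=0$ for all $k\in I\cup J$ and $n\in\mathbb{N}$; 2. $\sup_{n\in\mathbb{N}}|\phi(z_{n,k_1}\cdots z_{n,k_m})|=D_{k_1,\dots,k_m}<\infty$ for all $m\ge1$ and all $k_1,\dots,k_m\in I\cup J$; 3. $\lim_{N\to\infty}\frac1N\sum_{n=1}^N\phi(z_{n,k}z_{n,l})=C_{k,l}$ for all $k,l\in I\cup J$. Let $S_N=((S_{N,i})_{i\in I},(S_{N,j})_{j\in J})$, where $S_{N,k}=\frac{1}{\sqrt N}\sum_{n=1}^N z_{n,k}$ for $k\in I\cup J$. Let $\Gamma_C$ be the free-Boolean central limit distribution associated with the matrix $C=(C_{k,l})_{k,l\in I\cup J}$. Then $$\lim_{N\to\infty}\mu_{S_N}(P)=\Gamma_C(P)$$ for all $P\in\mathbb{C}\langle Z_k\mid k\in I\cup J\rangle$.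
   Context: All vector spaces and algebras are over $\mathbb{C}$. A noncommutative probability space is a pair $(\mathcal{A},\phi)$ with $\mathcal{A}$ a unital algebra and $\phi:\mathcal{A}\to\mathbb{C}$ linear with $\phi(1)=1$. Homomorphisms are not required to be unital. **Distribution.** For a family $S=(S_k)_{k\in I\cup J}$ in $\mathcal{A}$, $\mu_S:\mathbb{C}\langle Z_k\mid k\in I\cup J\rangle\to\mathbb{C}$ is $\mu_S(P)=\phi(P((S_k)_k))$ (noncommutative polynomials). **Reduced free products.** A vector space with a specified vector is a triple $(\mathcal{X},\mathcal{X}^\circ,\xi)$, where $\mathcal{X}^\circ\subset\mathcal{X}$ has codimension 1 and $\xi\in\mathcal{X}\setminus\mathcal{X}^\circ$. On the algebra $\mathcal{L}(\mathcal{X})$ of linear operators, $\phi_\xi(T)$ is the coefficient of $\xi$ in $T\xi$ relative to $\mathcal{X}=\mathbb{C}\xi\oplus\mathcal{X}^\circ$. The reduced free product of a family $(\mathcal{X}_i,\mathcal{X}_i^\circ,\xi_i)_i$ is $\mathcal{X}=\mathbb{C}\xi\oplus\mathcal{X}^\circ$, $\mathcal{X}^\circ=\bigoplus_{n\ge1}\bigoplus_{i_1\ne\cdots\ne i_n}\mathcal{X}_{i_1}^\circ\otimes\cdots\otimes\mathcal{X}_{i_n}^\circ$ (consecutive indices distinct). $\mathcal{X}(\ell,i)$ is the sum of $\mathbb{C}\xi$ and the summands with $i_1\ne i$; $V_i:\mathcal{X}_i\otimes\mathcal{X}(\ell,i)\to\mathcal{X}$ is the natural isomorphism ($\xi_i\otimes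 w\mapsto w$, $x\otimes\xi\mapsto x$, $x\otimes w\mapsto x\otimes w$ for $x\in\mathcal{X}_i^\circ$ and $w$ in a summand of $\mathcal X(\ell,i)$ other than $\mathbb{C}\xi$; $\xi_i\otimes\xi\mapsto\xi$); $\lambda_i(T)=V_i(T\otimes I)V_i^{-1}$ for $T\in\mathcal{L}(\mathcal{X}_i)$. $P_{\uplus,i}$ is the projection of $\mathcal{X}$ onto $\mathbb{C}\xi\oplus\mathcal{X}_i^\circ$ vanishing on all other summands. **Free-Boolean independence.** A family of pairs $(B_n,C_n)_n$ of subalgebras of $\mathcal{A}$ is free-Boolean independent if there are vector spaces with specified vectors $(\mathcal{X}_n,\mathcal{X}_n^\circ,\xi_n)$ and homomorphisms $\ell_n:B_n\to\mathcal{L}(\mathcal{X}_n)$, $r_n:C_n\to\mathcal{L}(\mathcal{X}_n)$ such that all mixed moments of elements of the $B_n$'s and $C_n$'s with respect to $\phi$ coincide with the moments with respect to $\phi_\xi$ of their images under $\lambda_n(\ell_n(\cdot))$ on $B_n$ and $P_{\uplus,n}\lambda_n(r_n(\cdot))P_{\uplus,n}$ on $C_n$, acting on the reduced free product of all the $\mathcal{X}_n$. The sequence $z_n=((z_{n,i})_{i\in I},(z_{n,j})_{j\in J})$ is free-Boolean independent if the pairs $(B_n,C_n)$ are, where $B_n$ is the unital algebra generated by $(z_{n,i})_{i\in I}$ and $C_n$ is the non-unital algebra generated by $(z_{n,j})_{j\in J}$. **Cumulants.** Let $\chi:[n]\to\{\bullet,\circ\}$. A block $V$ of a partition $\pi$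 of $[n]$ is inner if there are a block $W$ of $\pi$ and $s,t\in W$ with $s<v<t$ for all $v\in V$. $INC(\chi)$ is the lattice (under refinement: $\sigma\le\pi$ iff each block of $\sigma$ lies in a block of $\pi$) of noncrossing partitions $\pi$ of $[n]$ such that no element of $\chi^{-1}(\circ)$ lies in an inner block of $\pi$; $\mu_{INC}$ is its Möbius function. Put $\phi_\sigma(x_1,\dots,x_n)=\prod_{V\in\sigma}\phi(\prod_{k\in V}x_k)$ (increasing order in each product), and $\kappa_{\chi,1_{[n]}}(x_1,\dots,x_n)=\sum_{\sigma\in INC(\chi)}\mu_{INC}(\sigma,1_{[n]})\phi_\sigma(x_1,\dots,x_n)$, where $1_{[n]}$ is the one-block partition. **Central limit distribution.** For $\beta:[n]\to I\cup J$ let $\chi_\beta(k)=\circ$ iff $\beta(k)\in J$. A two-faced family $(z_k)_{k\in I\cup J}$ has a free-Boolean central limit distribution if $\kappa_{\chi_\beta,1_{[n]}}(z_{\beta(1)},\dots,z_{\beta(n)})=0$ for all $n\ne2$ and all $\beta:[n]\to I\cup J$. For a complex matrix $C=(C_{k,l})_{k,l\in I\cup J}$, $\Gamma_C:\mathbb{C}\langle Z_k\mid k\in I\cup J\rangle\to\mathbb{C}$ denotes the unique free-Boolean central limit distribution (i.e. the unique linear functional with $\Gamma_C(1)=1$ for which $(Z_k)_{k}$ has a free-Boolean central limit distribution in $(\mathbb{C}\langle Z_k\rangle,\Gamma_C)$) satisfying $\Gamma_C(Z_kZ_l)=C_{k,l}$ for all $k,l$. *)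

theory Defs
  imports
    Complex_Main
    "HOL-Library.FuncSet"
    "HOL-Library.Disjoint_Sets"
    "HOL-Library.Function_Algebras"
    "HOL-Library.Poly_Mapping"
begin

section \<open>Noncommutative probability spaces\<close>

locale complex_algebra = vector_space scale
  for scale :: "complex \<Rightarrow> 'a::ring_1 \<Rightarrow> 'a" +
  assumes scale_mult_left: "scale c x * y = scale c (x * y)"
    and scale_mult_right: "x * scale c y = scale c (x * y)"

locale nc_probability_space = complex_algebra scale
  for scale :: "complex \<Rightarrow> 'a::ring_1 \<Rightarrow> 'a" +
  fixes \<phi> :: "'a \<Rightarrow> complex"
  assumes linear_\<phi>: "Vector_Spaces.linear scale (*) \<phi>"
    and \<phi>_one: "\<phi> 1 = 1"

definition subalgebra :: "(complex \<Rightarrow> 'a::ring_1 \<Rightarrow> 'a) \<Rightarrow> 'a set \<Rightarrow> bool" where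
  "subalgebra scale B \<longleftrightarrow> module.subspace scale B \<and> (\<forall>x\<in>B. \<forall>y\<in>B. x * y \<in> B)"

definition generated_algebra :: "(complex \<Rightarrow> 'a::ring_1 \<Rightarrow> 'a) \<Rightarrow> 'a set \<Rightarrow> 'a set" where
  "generated_algebra scale G = subalgebra scale hull G"

definition generated_unital_algebra :: "(complex \<Rightarrow> 'a::ring_1 \<Rightarrow> 'a) \<Rightarrow> 'a set \<Rightarrow> 'a set" where
  "generated_unital_algebra scale G = (\<lambda>B. subalgebra scale B \<and> 1 \<in> B) hull G"


section \<open>Linear maps on subspaces and algebraic tensor products\<close>

text \<open>
  All vector spaces below are subspaces of an ambient type; a linear map on a subspace is a
  function on the ambient type whose values outside the subspace are irrelevant.
\<close>

definition linear_on ::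
    "(complex \<Rightarrow> 'v::ab_group_add \<Rightarrow> 'v) \<Rightarrow> (complex \<Rightarrow> 'w::ab_group_add \<Rightarrow> 'w) \<Rightarrow> 'v set \<Rightarrow> ('v \<Rightarrow> 'w) \<Rightarrow> bool" where
  "linear_on s1 s2 V f \<longleftrightarrow>
     (\<forall>x\<in>V. \<forall>y\<in>V. f (x + y) = f x + f y) \<and> (\<forall>c. \<forall>x\<in>V. f (s1 c x) = s2 c (f x))"

definition linear_operator_on ::
    "(complex \<Rightarrow> 'v::ab_group_add \<Rightarrow> 'v) \<Rightarrow> 'v set \<Rightarrow> ('v \<Rightarrow> 'v) \<Rightarrow> bool" where
  "linear_operator_on s V f \<longleftrightarrow> linear_on s s V f \<and> f ` V \<subseteq> V"

text \<open>Pointwise scalar multiplication of functions (addition is that of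
  \<^theory>\<open>HOL-Library.Function_Algebras\<close>).\<close>

definition fun_scale :: "(complex \<Rightarrow> 'v \<Rightarrow> 'v) \<Rightarrow> complex \<Rightarrow> ('b \<Rightarrow> 'v) \<Rightarrow> 'b \<Rightarrow> 'v" where
  "fun_scale s c f = (\<lambda>x. s c (f x))"

text \<open>
  The tensor product of vector spaces is realised as the space of functionals on multilinear forms
  spanned by the evaluations: an elementary tensor \<open>x\<^sub>1 \<otimes> \<dots> \<otimes> x\<^sub>n\<close> is the functional
  \<open>F \<mapsto> F(x\<^sub>1,\<dots>,x\<^sub>n)\<close>. Over a field this is the algebraic tensor product, because multilinear forms
  separate its points. The tensor product of the empty list of spaces is one-dimensional.
\<close>

definition bilinear_form_on ::
    "(complex \<Rightarrow> 'v::ab_group_add \<Rightarrow> 'v) \<Rightarrow> (complex \<Rightarrow> 'w::ab_group_add \<Rightarrow> 'w) \<Rightarrow>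
     'v set \<Rightarrow> 'w set \<Rightarrow> ('v \<Rightarrow> 'w \<Rightarrow> complex) \<Rightarrow> bool" where
  "bilinear_form_on s1 s2 V W F \<longleftrightarrow>
     (\<forall>y\<in>W. linear_on s1 (*) V (\<lambda>x. F x y)) \<and> (\<forall>x\<in>V. linear_on s2 (*) W (F x))"

definition tensor ::
    "(complex \<Rightarrow> 'v::ab_group_add \<Rightarrow> 'v) \<Rightarrow> (complex \<Rightarrow> 'w::ab_group_add \<Rightarrow> 'w) \<Rightarrow>
     'v set \<Rightarrow> 'w set \<Rightarrow> 'v \<Rightarrow> 'w \<Rightarrow> (('v \<Rightarrow> 'w \<Rightarrow> complex) \<Rightarrow> complex)" where
  "tensor s1 s2 V W x y = (\<lambda>F. if bilinear_form_on s1 s2 V W F then F x y else 0)"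

definition tensor_space ::
    "(complex \<Rightarrow> 'v::ab_group_add \<Rightarrow> 'v) \<Rightarrow> (complex \<Rightarrow> 'w::ab_group_add \<Rightarrow> 'w) \<Rightarrow>
     'v set \<Rightarrow> 'w set \<Rightarrow> (('v \<Rightarrow> 'w \<Rightarrow> complex) \<Rightarrow> complex) set" where
  "tensor_space s1 s2 V W =
     module.span (fun_scale (*)) {tensor s1 s2 V W x y | x y. x \<in> V \<and> y \<in> W}"

text \<open>The operator \<open>T \<otimes> S\<close>; the choice is unique on the tensor product.\<close>

definition tensor_operator ::
    "(complex \<Rightarrow> 'v::ab_group_add \<Rightarrow> 'v) \<Rightarrow> (complex \<Rightarrow> 'w::ab_group_add \<Rightarrow> 'w) \<Rightarrow>
     'v set \<Rightarrow> 'w set \<Rightarrow> ('v \<Rightarrow> 'v) \<Rightarrow> ('w \<Rightarrow> 'w) \<Rightarrow>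
     (('v \<Rightarrow> 'w \<Rightarrow> complex) \<Rightarrow> complex) \<Rightarrow> (('v \<Rightarrow> 'w \<Rightarrow> complex) \<Rightarrow> complex)" where
  "tensor_operator s1 s2 V W T S =
     (SOME R. linear_operator_on (fun_scale (*)) (tensor_space s1 s2 V W) R \<and>
        (\<forall>x\<in>V. \<forall>y\<in>W. R (tensor s1 s2 V W x y) = tensor s1 s2 V W (T x) (S y)))"

definition multilinear_form_on ::
    "(complex \<Rightarrow> 'v::ab_group_add \<Rightarrow> 'v) \<Rightarrow> 'v set list \<Rightarrow> ('v list \<Rightarrow> complex) \<Rightarrow> bool" where
  "multilinear_form_on s Vs F \<longleftrightarrow>
     (\<forall>xs\<in>listset Vs. \<forall>k<length Vs. linear_on s (*) (Vs ! k) (\<lambda>x. F (xs[k := x])))"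

definition list_tensor ::
    "(complex \<Rightarrow> 'v::ab_group_add \<Rightarrow> 'v) \<Rightarrow> 'v set list \<Rightarrow> 'v list \<Rightarrow> (('v list \<Rightarrow> complex) \<Rightarrow> complex)" where
  "list_tensor s Vs xs = (\<lambda>F. if multilinear_form_on s Vs F then F xs else 0)"

definition list_tensor_space ::
    "(complex \<Rightarrow> 'v::ab_group_add \<Rightarrow> 'v) \<Rightarrow> 'v set list \<Rightarrow> (('v list \<Rightarrow> complex) \<Rightarrow> complex) set" where
  "list_tensor_space s Vs = module.span (fun_scale (*)) (list_tensor s Vs ` listset Vs)"


section \<open>Vector spaces with specified vectors and reduced free products\<close>

definition vector_space_with_vector ::
    "(complex \<Rightarrow> 'v::ab_group_add \<Rightarrow> 'v) \<Rightarrow> 'v set \<Rightarrow> 'v set \<Rightarrow> 'v \<Rightarrow> bool" where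
  "vector_space_with_vector s X X0 \<xi> \<longleftrightarrow>
     module.subspace s X \<and> module.subspace s X0 \<and> X0 \<subset> X \<and>
     (\<exists>v. X = module.span s (insert v X0)) \<and> \<xi> \<in> X - X0"

definition vector_state ::
    "(complex \<Rightarrow> 'v::ab_group_add \<Rightarrow> 'v) \<Rightarrow> 'v set \<Rightarrow> 'v \<Rightarrow> ('v \<Rightarrow> 'v) \<Rightarrow> complex" where
  "vector_state s X0 \<xi> T = (THE c. T \<xi> - s c \<xi> \<in> X0)"

type_synonym ('l, 'v) free_vector = "'l list \<Rightarrow> ('v list \<Rightarrow> complex) \<Rightarrow> complex"

locale vector_space_family = vector_space s
  for s :: "complex \<Rightarrow> 'v::ab_group_add \<Rightarrow> 'v" +
  fixes L :: "'l set" and X X0 :: "'l \<Rightarrow> 'v set" and \<xi> :: "'l \<Rightarrow> 'v"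
  assumes family: "i \<in> L \<Longrightarrow> vector_space_with_vector s (X i) (X0 i) (\<xi> i)"
begin

definition alternating :: "'l list set" where
  "alternating = {is \<in> lists L. distinct_adj is}"

text \<open>
  The reduced free product is the direct sum, indexed by the alternating sequences \<open>is\<close>, of the
  tensor products of the spaces \<open>X0 i\<close> for \<open>i\<close> in \<open>is\<close>; a vector is the family of its components.
  The empty sequence indexes the summand spanned by the distinguished vector.
\<close>

definition free_space :: "('l, 'v) free_vector set" where
  "free_space = {w. finite {is. w is \<noteq> 0} \<and> {is. w is \<noteq> 0} \<subseteq> alternating \<and>
                    (\<forall>is\<in>alternating. w is \<in> list_tensor_space s (map X0 is))}"

abbreviation free_scale :: "complex \<Rightarrow> ('l, 'v) free_vector \<Rightarrow> ('l, 'v) free_vector" where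
  "free_scale \<equiv> fun_scale (fun_scale (*))"

definition elementary :: "'l list \<Rightarrow> 'v list \<Rightarrow> ('l, 'v) free_vector" where
  "elementary is xs = (\<lambda>js. if js = is then list_tensor s (map X0 is) xs else 0)"

definition free_xi :: "('l, 'v) free_vector" where
  "free_xi = elementary [] []"

definition free_space0 :: "('l, 'v) free_vector set" where
  "free_space0 = {w \<in> free_space. w [] = 0}"

definition left_space :: "'l \<Rightarrow> ('l, 'v) free_vector set" where
  "left_space i = {w \<in> free_space. \<forall>is. w is \<noteq> 0 \<longrightarrow> is = [] \<or> hd is \<noteq> i}"

abbreviation left_tensor_space ::
    "'l \<Rightarrow> (('v \<Rightarrow> ('l, 'v) free_vector \<Rightarrow> complex) \<Rightarrow> complex) set" where
  "left_tensor_space i \<equiv> tensor_space s free_scale (X i) (left_space i)"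

abbreviation left_tensor ::
    "'l \<Rightarrow> 'v \<Rightarrow> ('l, 'v) free_vector \<Rightarrow> (('v \<Rightarrow> ('l, 'v) free_vector \<Rightarrow> complex) \<Rightarrow> complex)" where
  "left_tensor i \<equiv> tensor s free_scale (X i) (left_space i)"

text \<open>The natural isomorphism from \<open>X i \<otimes> left_space i\<close> onto the free product; the choice is unique
  on that tensor product. The case \<open>is = []\<close> of the last clause is \<open>x \<otimes> \<xi> \<mapsto> x\<close>.\<close>

definition V_iso ::
    "'l \<Rightarrow> (('v \<Rightarrow> ('l, 'v) free_vector \<Rightarrow> complex) \<Rightarrow> complex) \<Rightarrow> ('l, 'v) free_vector" where
  "V_iso i =
     (SOME V. linear_on (fun_scale (*)) free_scale (left_tensor_space i) V \<and>
        (\<forall>w\<in>left_space i. V (left_tensor i (\<xi> i) w) = w) \<and>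
        (\<forall>x\<in>X0 i. \<forall>is\<in>alternating. \<forall>xs\<in>listset (map X0 is). (is = [] \<or> hd is \<noteq> i) \<longrightarrow>
           V (left_tensor i x (elementary is xs)) = elementary (i # is) (x # xs)))"

definition left_rep :: "'l \<Rightarrow> ('v \<Rightarrow> 'v) \<Rightarrow> ('l, 'v) free_vector \<Rightarrow> ('l, 'v) free_vector" where
  "left_rep i T =
     V_iso i \<circ> tensor_operator s free_scale (X i) (left_space i) T id
             \<circ> inv_into (left_tensor_space i) (V_iso i)"

definition boolean_proj :: "'l \<Rightarrow> ('l, 'v) free_vector \<Rightarrow> ('l, 'v) free_vector" where
  "boolean_proj i w = (\<lambda>is. if is = [] \<or> is = [i] then w is else 0)"

end


section \<open>Free-Boolean independence\<close>

datatype colour = Bullet | Circle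

definition operator_homomorphism ::
    "(complex \<Rightarrow> 'a::ring_1 \<Rightarrow> 'a) \<Rightarrow> 'a set \<Rightarrow> (complex \<Rightarrow> 'v::ab_group_add \<Rightarrow> 'v) \<Rightarrow> 'v set \<Rightarrow>
     ('a \<Rightarrow> 'v \<Rightarrow> 'v) \<Rightarrow> bool" where
  "operator_homomorphism scale B s X h \<longleftrightarrow>
     (\<forall>a\<in>B. linear_operator_on s X (h a)) \<and>
     (\<forall>a\<in>B. \<forall>b\<in>B. \<forall>x\<in>X. h (a + b) x = h a x + h b x \<and> h (a * b) x = h a (h b x)) \<and>
     (\<forall>c. \<forall>a\<in>B. \<forall>x\<in>X. h (scale c a) x = s c (h a x))"

context vector_space_family
begin

fun face_operator ::
    "('l \<Rightarrow> 'a \<Rightarrow> 'v \<Rightarrow> 'v) \<Rightarrow> ('l \<Rightarrow> 'a \<Rightarrow> 'v \<Rightarrow> 'v) \<Rightarrow> colour \<times> 'l \<times> 'a \<Rightarrow>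
     ('l, 'v) free_vector \<Rightarrow> ('l, 'v) free_vector" where
  "face_operator lh rh (Bullet, n, a) = left_rep n (lh n a)"
| "face_operator lh rh (Circle, n, a) = boolean_proj n \<circ> left_rep n (rh n a) \<circ> boolean_proj n"

end

text \<open>
  The spaces \<open>X n\<close> are subspaces of one common complex vector space \<open>'v\<close>, which is no restriction,
  since every family of vector spaces embeds into its direct sum. As HOL cannot quantify over types
  inside a formula, \<open>'v\<close> is a parameter; a hypothesis of this form with a free type variable
  \<open>'v\<close> amounts to the existence of spaces of arbitrary type.
\<close>

definition free_boolean_independent ::
    "'v::ab_group_add itself \<Rightarrow> (complex \<Rightarrow> 'a::ring_1 \<Rightarrow> 'a) \<Rightarrow> ('a \<Rightarrow> complex) \<Rightarrow> 'l set \<Rightarrow>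
     ('l \<Rightarrow> 'a set) \<Rightarrow> ('l \<Rightarrow> 'a set) \<Rightarrow> bool" where
  "free_boolean_independent _ scale \<phi> L B C \<longleftrightarrow>
     (\<exists>(s :: complex \<Rightarrow> 'v \<Rightarrow> 'v) X X0 \<xi> lh rh.
        vector_space_family s L X X0 \<xi> \<and>
        (\<forall>n\<in>L. operator_homomorphism scale (B n) s (X n) (lh n) \<and>
               operator_homomorphism scale (C n) s (X n) (rh n)) \<and>
        (\<forall>as. (\<forall>(c, n, a)\<in>set as. n \<in> L \<and> a \<in> (case c of Bullet \<Rightarrow> B n | Circle \<Rightarrow> C n)) \<longrightarrow>
           \<phi> (prod_list (map (\<lambda>(c, n, a). a) as)) =
           vector_state (fun_scale (fun_scale (*)))
             (vector_space_family.free_space0 s L X0) (vector_space_family.free_xi s X0)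
             (foldr (\<circ>) (map (vector_space_family.face_operator s L X X0 \<xi> lh rh) as) id)))"

definition free_boolean_independent_families ::
    "'v::ab_group_add itself \<Rightarrow> (complex \<Rightarrow> 'a::ring_1 \<Rightarrow> 'a) \<Rightarrow> ('a \<Rightarrow> complex) \<Rightarrow> 'l set \<Rightarrow>
     'k set \<Rightarrow> 'k set \<Rightarrow> ('l \<Rightarrow> 'k \<Rightarrow> 'a) \<Rightarrow> bool" where
  "free_boolean_independent_families V scale \<phi> L I J z \<longleftrightarrow>
     free_boolean_independent V scale \<phi> L
       (\<lambda>n. generated_unital_algebra scale (z n ` I)) (\<lambda>n. generated_algebra scale (z n ` J))"


section \<open>Cumulants\<close>

text \<open>The Moebius function of a finite poset \<open>P\<close>; the guard only serves termination.\<close>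

function moebius :: "'p set \<Rightarrow> ('p \<Rightarrow> 'p \<Rightarrow> bool) \<Rightarrow> 'p \<Rightarrow> 'p \<Rightarrow> int" where
  "moebius P le x y =
     (if finite P \<and> partial_order_on P {(u, v). u \<in> P \<and> v \<in> P \<and> le u v} \<and> x \<in> P \<and> y \<in> P \<and> le x y
      then if x = y then 1 else - (\<Sum>u\<in>{u \<in> P. le x u \<and> le u y \<and> u \<noteq> y}. moebius P le x u)
      else 0)"
  by pat_completeness auto
termination
proof (relation "measure (\<lambda>(P, le, x, y). card {u \<in> P. le u y})", goal_cases)
  case 1
  show ?case by simp
next
  case (2 P le x y u)
  let ?r = "{(u, v). u \<in> P \<and> v \<in> P \<and> le u v}"
  from 2 have P: "finite P" "y \<in> P" "u \<in> P" "le u y" "u \<noteq> y"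
    and r: "refl_on P ?r" "trans ?r" "antisym ?r"
    by (auto simp: partial_order_on_def preorder_on_def)
  have "{w \<in> P. le w u} \<subseteq> {w \<in> P. le w y}"
    using P transD[OF r(2)] by blast
  moreover have "y \<notin> {w \<in> P. le w u}"
    using P antisymD[OF r(3)] by blast
  moreover have "y \<in> {w \<in> P. le w y}"
    using P refl_onD[OF r(1)] by blast
  ultimately have "{w \<in> P. le w u} \<subset> {w \<in> P. le w y}" by blast
  then have "card {w \<in> P. le w u} < card {w \<in> P. le w y}"
    using P(1) by (intro psubset_card_mono) auto
  then show ?case by simp
qed

declare moebius.simps [simp del]

definition noncrossing :: "nat set set \<Rightarrow> bool" where
  "noncrossing \<pi> \<longleftrightarrow>
     \<not> (\<exists>V\<in>\<pi>. \<exists>W\<in>\<pi>. V \<noteq> W \<and>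
          (\<exists>a b c d. a < b \<and> b < c \<and> c < d \<and> a \<in> V \<and> c \<in> V \<and> b \<in> W \<and> d \<in> W))"

definition inner_block :: "nat set set \<Rightarrow> nat set \<Rightarrow> bool" where
  "inner_block \<pi> V \<longleftrightarrow> (\<exists>W\<in>\<pi>. \<exists>s\<in>W. \<exists>t\<in>W. \<forall>v\<in>V. s < v \<and> v < t)"

definition INC :: "nat \<Rightarrow> (nat \<Rightarrow> colour) \<Rightarrow> nat set set set" where
  "INC n \<chi> = {\<pi>. partition_on {1..n} \<pi> \<and> noncrossing \<pi> \<and>
                 (\<forall>V\<in>\<pi>. inner_block \<pi> V \<longrightarrow> (\<forall>k\<in>V. \<chi> k \<noteq> Circle))}"

definition partition_moment :: "('a::ring_1 \<Rightarrow> complex) \<Rightarrow> nat set set \<Rightarrow> (nat \<Rightarrow> 'a) \<Rightarrow> complex" where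
  "partition_moment \<phi> \<sigma> x = (\<Prod>V\<in>\<sigma>. \<phi> (prod_list (map x (sorted_list_of_set V))))"

definition cumulant ::
    "('a::ring_1 \<Rightarrow> complex) \<Rightarrow> nat \<Rightarrow> (nat \<Rightarrow> colour) \<Rightarrow> (nat \<Rightarrow> 'a) \<Rightarrow> complex" where
  "cumulant \<phi> n \<chi> x =
     (\<Sum>\<sigma>\<in>INC n \<chi>. of_int (moebius (INC n \<chi>) (refines {1..n}) \<sigma> {{1..n}}) * partition_moment \<phi> \<sigma> x)"


section \<open>Noncommutative polynomials and distributions\<close>

text \<open>
  Words form the free monoid under concatenation; with this instance,
  \<^typ>\<open>'k list \<Rightarrow>\<^sub>0 complex\<close> with its convolution product is the algebra of noncommutative
  polynomials in indeterminates indexed by \<^typ>\<open>'k\<close>.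
\<close>

instantiation list :: (type) monoid_add
begin
definition zero_list :: "'a list" where "zero_list = []"
definition plus_list :: "'a list \<Rightarrow> 'a list \<Rightarrow> 'a list" where "plus_list = (@)"
instance by standard (simp_all add: zero_list_def plus_list_def)
end

type_synonym 'k nc_poly = "'k list \<Rightarrow>\<^sub>0 complex"

definition nc_var :: "'k \<Rightarrow> 'k nc_poly" where
  "nc_var k = Poly_Mapping.single [k] 1"

definition nc_scale :: "complex \<Rightarrow> 'k nc_poly \<Rightarrow> 'k nc_poly" where
  "nc_scale c P = Poly_Mapping.map ((*) c) P"

definition nc_polys :: "'k set \<Rightarrow> 'k nc_poly set" where
  "nc_polys K = {P. Poly_Mapping.keys P \<subseteq> lists K}"

definition nc_eval :: "(complex \<Rightarrow> 'a::ring_1 \<Rightarrow> 'a) \<Rightarrow> ('k \<Rightarrow> 'a) \<Rightarrow> 'k nc_poly \<Rightarrow> 'a" where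
  "nc_eval scale S P =
     (\<Sum>w\<in>Poly_Mapping.keys P. scale (Poly_Mapping.lookup P w) (prod_list (map S w)))"

definition distribution ::
    "(complex \<Rightarrow> 'a::ring_1 \<Rightarrow> 'a) \<Rightarrow> ('a \<Rightarrow> complex) \<Rightarrow> ('k \<Rightarrow> 'a) \<Rightarrow> 'k nc_poly \<Rightarrow> complex" where
  "distribution scale \<phi> S P = \<phi> (nc_eval scale S P)"


section \<open>Free-Boolean central limit distributions\<close>

definition face_colour :: "'k set \<Rightarrow> 'k \<Rightarrow> colour" where
  "face_colour J k = (if k \<in> J then Circle else Bullet)"

text \<open>Cumulants are defined for \<open>n \<ge> 1\<close> only.\<close>

definition has_free_boolean_clt_distribution ::
    "('a::ring_1 \<Rightarrow> complex) \<Rightarrow> 'k set \<Rightarrow> 'k set \<Rightarrow> ('k \<Rightarrow> 'a) \<Rightarrow> bool" where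
  "has_free_boolean_clt_distribution \<phi> I J z \<longleftrightarrow>
     (\<forall>n\<ge>1. n \<noteq> 2 \<longrightarrow> (\<forall>\<beta>. \<beta> ` {1..n} \<subseteq> I \<union> J \<longrightarrow>
        cumulant \<phi> n (face_colour J \<circ> \<beta>) (z \<circ> \<beta>) = 0))"

text \<open>A functional on \<open>nc_polys (I \<union> J)\<close> is extended by \<^const>\<open>undefined\<close> to the ambient type, so that
  it is unique as a function.\<close>

definition free_boolean_clt :: "'k set \<Rightarrow> 'k set \<Rightarrow> ('k \<Rightarrow> 'k \<Rightarrow> complex) \<Rightarrow> 'k nc_poly \<Rightarrow> complex" where
  "free_boolean_clt I J C =
     (THE \<Gamma>. \<Gamma> \<in> extensional (nc_polys (I \<union> J)) \<and>
        linear_on nc_scale (*) (nc_polys (I \<union> J)) \<Gamma> \<and> \<Gamma> 1 = 1 \<and>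
        has_free_boolean_clt_distribution \<Gamma> I J nc_var \<and>
        (\<forall>k\<in>I \<union> J. \<forall>l\<in>I \<union> J. \<Gamma> (nc_var k * nc_var l) = C k l))"

end

theory Submission
  imports Defs
begin

text \<open>
  The proof realises the words in the variables \<open>z n k\<close> on the reduced free product and counts.

  An operator of colour \<open>n\<close> changes only the first tensor factor of an elementary tensor. If
  \<open>T\<^sub>k\<close> is the operator representing \<open>z n k\<close> on \<open>X n\<close>, then the vectors that can appear as factors
  are the components in \<open>X0 n\<close> of \<open>T\<^sub>k\<^sub>1 \<dots> T\<^sub>k\<^sub>r \<xi>\<^sub>n\<close>; such a factor is recorded by its colour and the
  word \<open>k\<^sub>1 \<dots> k\<^sub>r\<close>, and an elementary tensor is a stack of such records. Reading a word from right to
  left, every letter puts a new record on the stack, lengthens, replaces or removes the top record,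
  or leaves the stack alone, with coefficients that are polynomials in the moments of the single
  pairs of faces.
  The compression by the Boolean projection lets a Circle letter act only on the empty stack or on a
  single record of its own colour. The vacuum expectation is the resulting number
  \<open>stack_moment\<close> (lemmas \<open>V_iso_intertwines\<close>, \<open>left_rep_stack_other\<close>, \<open>left_rep_stack_same\<close>,
  \<open>vector_state_word\<close>).

  The moment of a word of length \<open>p\<close> in the normalised sums is \<open>N\<close> to the power \<open>-p/2\<close> times the sum
  of the stack moments over all colourings of the \<open>p\<close> positions by \<open>1, \<dots>, N\<close>. Colourings in which
  some colour occurs exactly once contribute zero, because the variables are centred. If no colour
  occurs more than twice, a record on the stack can only be removed by its partner, and the stack
  moment becomes a \<open>pairing_moment\<close>, which uses nothing but the covariances. All other colourings use
  fewer than \<open>p/2\<close> colours; there are too few of them to matter, as stack moments are bounded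
  uniformly in the colouring. Summed over all colourings, the pairing moments become exactly one
  pairing moment for the summed covariances, which converges after normalisation
  (\<open>stack_moment_clt\<close>).

  It remains to see that the pairing moments of \<open>C\<close> are the moments of \<open>\<Gamma>\<^sub>C\<close>. The moves
  "push" and "pop" build exactly the noncrossing pair partitions without a Circle in an inner block.
  Calling all noncrossing partitions with the latter property admissible, the pairing moment of a
  word is thus the sum over its admissible partitions of products of weights that vanish on blocks
  of size other than two (\<open>pairing_moment_eq_sum_inc_partitions\<close>). The same holds for every subword,
  and the admissible partitions below a given admissible \<open>\<sigma>\<close> are the families of admissible
  partitions of its blocks. Moebius inversion then shows that the top cumulant is the weight of the
  one-block partition (\<open>cumulant_of_partition_sums\<close>), hence vanishes unless the word has length two.
  Finally a cumulant determines the moment of the full word in terms of shorter words, so that only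
  one functional has these cumulants (\<open>free_boolean_clt_eq_pairing_functional\<close>).
\<close>

section \<open>Linear maps on spans and tensor products\<close>

lemma vector_space_fun_scale: "vector_space s \<Longrightarrow> vector_space (fun_scale s)"
  unfolding vector_space_def fun_scale_def by (auto simp: fun_eq_iff)

lemma vector_space_complex: "vector_space ((*) :: complex \<Rightarrow> complex \<Rightarrow> complex)"
  by unfold_locales (auto simp: algebra_simps)

lemma linear_onD:
  assumes "linear_on s1 s2 V f"
  shows "\<And>x y. x \<in> V \<Longrightarrow> y \<in> V \<Longrightarrow> f (x + y) = f x + f y"
    and "\<And>c x. x \<in> V \<Longrightarrow> f (s1 c x) = s2 c (f x)"
  using assms by (auto simp: linear_on_def)

lemma linear_on_compose:
  "linear_on s1 s2 V f \<Longrightarrow> f ` V \<subseteq> W \<Longrightarrow> linear_on s2 s3 W g \<Longrightarrow> linear_on s1 s3 V (\<lambda>x. g (f x))"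
  unfolding linear_on_def by (auto simp: image_subset_iff)

lemma linear_on_zero:
  fixes f :: "'v::ab_group_add \<Rightarrow> 'w::ab_group_add"
  assumes "linear_on s1 s2 V f" "0 \<in> V"
  shows "f 0 = 0"
proof -
  have "f (0 + 0) = f 0 + f 0" using assms unfolding linear_on_def by blast
  then show ?thesis by simp
qed

lemma linear_on_eq_on_span:
  assumes s1: "vector_space s1" and U: "U = module.span s1 B"
    and f: "linear_on s1 s2 U f" and g: "linear_on s1 s2 U g"
    and eq: "\<And>b. b \<in> B \<Longrightarrow> f b = g b" and x: "x \<in> U"
  shows "f x = g x"
proof -
  interpret V: vector_space s1 by fact
  have "x \<in> U \<and> f x = g x" using x unfolding U
  proof (induction rule: V.span_induct_alt)
    case base
    show ?case using linear_on_zero[OF f] linear_on_zero[OF g] V.span_zero U by simp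
  next
    case (step c b y)
    then have "b \<in> U" "s1 c b \<in> U" "y \<in> U"
      unfolding U by (auto intro: V.span_base V.span_scale)
    then show ?case using step eq U
      by (simp add: linear_onD[OF f] linear_onD[OF g] V.span_add)
  qed
  then show ?thesis ..
qed

lemma linear_on_span_in_subspace:
  assumes s1: "vector_space s1" and s2: "vector_space s2"
    and f: "linear_on s1 s2 (module.span s1 B) f"
    and U: "module.subspace s2 U" and B: "\<And>b. b \<in> B \<Longrightarrow> f b \<in> U" and x: "x \<in> module.span s1 B"
  shows "f x \<in> U"
proof -
  interpret V: vector_space s1 by fact
  interpret W: vector_space s2 by fact
  have "x \<in> V.span B \<and> f x \<in> U" using x
  proof (induction rule: V.span_induct_alt)
    case base
    show ?case using linear_on_zero[OF f] V.span_zero W.subspace_0[OF U] by simp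
  next
    case (step c b y)
    then have "b \<in> V.span B" "s1 c b \<in> V.span B"
      by (auto intro: V.span_base V.span_scale)
    then show ?case using step B
      by (simp add: linear_onD[OF f] W.subspace_add[OF U] W.subspace_scale[OF U] V.span_add)
  qed
  then show ?thesis ..
qed

lemma set_Cons_iff: "z \<in> set_Cons A B \<longleftrightarrow> (\<exists>x xs. z = x # xs \<and> x \<in> A \<and> xs \<in> B)"
  by (auto simp: set_Cons_def)

lemma multilinear_form_on_Nil [simp]: "multilinear_form_on s [] F"
  by (simp add: multilinear_form_on_def)

lemma multilinear_form_on_Cons:
  "multilinear_form_on s (V # Vs) F \<longleftrightarrow>
     (\<forall>xs\<in>listset Vs. linear_on s (*) V (\<lambda>x. F (x # xs))) \<and>
     (\<forall>x\<in>V. multilinear_form_on s Vs (\<lambda>xs. F (x # xs)))"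
proof
  assume L: "multilinear_form_on s (V # Vs) F"
  have D: "linear_on s (*) ((V # Vs) ! k) (\<lambda>u. F ((x # xs)[k := u]))"
    if "x \<in> V" "xs \<in> listset Vs" "k < Suc (length Vs)" for x xs k
  proof -
    have "x # xs \<in> listset (V # Vs)" using that by (simp add: set_Cons_iff)
    moreover have "k < length (V # Vs)" using that by simp
    ultimately show ?thesis using L unfolding multilinear_form_on_def by blast
  qed
  show "(\<forall>xs\<in>listset Vs. linear_on s (*) V (\<lambda>x. F (x # xs))) \<and>
     (\<forall>x\<in>V. multilinear_form_on s Vs (\<lambda>xs. F (x # xs)))"
  proof (intro conjI ballI)
    fix xs assume xs: "xs \<in> listset Vs"
    show "linear_on s (*) V (\<lambda>x. F (x # xs))"
    proof (cases "V = {}")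
      case False
      then obtain x where "x \<in> V" by blast
      from D[OF this xs, of 0] show ?thesis by simp
    qed (simp add: linear_on_def)
  next
    fix x assume "x \<in> V"
    then show "multilinear_form_on s Vs (\<lambda>xs. F (x # xs))"
      unfolding multilinear_form_on_def using D[of x _ "Suc _"] by auto
  qed
next
  assume R: "(\<forall>xs\<in>listset Vs. linear_on s (*) V (\<lambda>x. F (x # xs))) \<and>
     (\<forall>x\<in>V. multilinear_form_on s Vs (\<lambda>xs. F (x # xs)))"
  show "multilinear_form_on s (V # Vs) F"
    unfolding multilinear_form_on_def
  proof (intro ballI allI impI)
    fix ys k assume "ys \<in> listset (V # Vs)" "k < length (V # Vs)"
    then show "linear_on s (*) ((V # Vs) ! k) (\<lambda>x. F (ys[k := x]))"
      using R by (cases k) (fastforce simp: set_Cons_iff multilinear_form_on_def)+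
  qed
qed

text \<open>
  Tensors are functionals on forms defined on all lists, but on a multilinear form they only see its
  values on \<open>listset Vs\<close>. So they respect every linear relation that holds there.
\<close>

lemma list_tensor_space_combination:
  assumes s: "vector_space s" and \<theta>: "\<theta> \<in> list_tensor_space s Vs"
    and F: "multilinear_form_on s Vs F" "multilinear_form_on s Vs G" "multilinear_form_on s Vs H"
    and eq: "\<And>xs. xs \<in> listset Vs \<Longrightarrow> H xs = a * F xs + b * G xs"
  shows "\<theta> H = a * \<theta> F + b * \<theta> G"
proof -
  interpret T: vector_space "fun_scale ((*) :: complex \<Rightarrow> _) :: complex \<Rightarrow> (('v list \<Rightarrow> complex) \<Rightarrow> complex) \<Rightarrow> _"
    by (intro vector_space_fun_scale vector_space_complex)
  show ?thesis using \<theta> unfolding list_tensor_space_def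
  proof (induction rule: T.span_induct_alt)
    case base show ?case by simp
  next
    case (step c b' y)
    then show ?case using F eq
      by (auto simp: fun_scale_def list_tensor_def algebra_simps)
  qed
qed

lemma list_tensor_space_not_multilinear:
  assumes \<theta>: "\<theta> \<in> list_tensor_space s Vs" and F: "\<not> multilinear_form_on s Vs F"
  shows "\<theta> F = 0"
proof -
  interpret T: vector_space "fun_scale ((*) :: complex \<Rightarrow> _) :: complex \<Rightarrow> (('v list \<Rightarrow> complex) \<Rightarrow> complex) \<Rightarrow> _"
    by (intro vector_space_fun_scale vector_space_complex)
  show ?thesis using \<theta> unfolding list_tensor_space_def
  proof (induction rule: T.span_induct_alt)
    case base show ?case by simp
  next
    case (step c b' y)
    then show ?case using F
      by (auto simp: fun_scale_def list_tensor_def algebra_simps)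
  qed
qed

text \<open>
  Precomposing the first argument of a bilinear form with \<open>T\<close> is a map on functionals with the two
  required properties; this justifies the choice in the definition of \<open>tensor_operator\<close>.
\<close>

lemma tensor_operator_exists:
  assumes s1: "vector_space s1" and s2: "vector_space s2" and T: "linear_operator_on s1 V T"
  shows "linear_operator_on (fun_scale (*)) (tensor_space s1 s2 V W) (tensor_operator s1 s2 V W T id)
    \<and> (\<forall>x\<in>V. \<forall>y\<in>W. tensor_operator s1 s2 V W T id (tensor s1 s2 V W x y) = tensor s1 s2 V W (T x) y)"
proof -
  interpret A: vector_space "fun_scale ((*) :: complex \<Rightarrow> _) :: complex \<Rightarrow> (('a \<Rightarrow> 'b \<Rightarrow> complex) \<Rightarrow> complex) \<Rightarrow> _"
    by (intro vector_space_fun_scale vector_space_complex)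
  define R :: "(('a \<Rightarrow> 'b \<Rightarrow> complex) \<Rightarrow> complex) \<Rightarrow> ('a \<Rightarrow> 'b \<Rightarrow> complex) \<Rightarrow> complex"
    where "R t = (\<lambda>B. if bilinear_form_on s1 s2 V W B then t (\<lambda>x y. B (T x) y) else 0)" for t
  have bil: "bilinear_form_on s1 s2 V W (\<lambda>x y. B (T x) y)" if "bilinear_form_on s1 s2 V W B" for B
    using that T unfolding bilinear_form_on_def linear_operator_on_def linear_on_def
    by (auto simp: image_subset_iff)
  have R_tensor: "R (tensor s1 s2 V W x y) = tensor s1 s2 V W (T x) y" for x y
    using bil by (auto simp: R_def tensor_def fun_eq_iff)
  have lin: "linear_on (fun_scale (*)) (fun_scale (*)) U R" for U
    by (auto simp: linear_on_def R_def fun_scale_def fun_eq_iff)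
  have "R ` tensor_space s1 s2 V W \<subseteq> tensor_space s1 s2 V W"
  proof
    fix r assume "r \<in> R ` tensor_space s1 s2 V W"
    then obtain t where t: "t \<in> tensor_space s1 s2 V W" "r = R t" by blast
    show "r \<in> tensor_space s1 s2 V W" unfolding t(2) tensor_space_def
    proof (rule linear_on_span_in_subspace[OF A.vector_space_axioms A.vector_space_axioms lin
          A.subspace_span _ t(1)[unfolded tensor_space_def]])
      fix b assume "b \<in> {tensor s1 s2 V W x y |x y. x \<in> V \<and> y \<in> W}"
      then show "R b \<in> A.span {tensor s1 s2 V W x y |x y. x \<in> V \<and> y \<in> W}"
        using T by (force simp: R_tensor linear_operator_on_def intro!: A.span_base)
    qed
  qed
  with lin have "linear_operator_on (fun_scale (*)) (tensor_space s1 s2 V W) R \<and>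
        (\<forall>x\<in>V. \<forall>y\<in>W. R (tensor s1 s2 V W x y) = tensor s1 s2 V W (T x) (id y))"
    by (simp add: linear_operator_on_def R_tensor)
  from someI[of "\<lambda>R. linear_operator_on (fun_scale (*)) (tensor_space s1 s2 V W) R \<and>
        (\<forall>x\<in>V. \<forall>y\<in>W. R (tensor s1 s2 V W x y) = tensor s1 s2 V W (T x) (id y))", OF this]
  show ?thesis unfolding tensor_operator_def by simp
qed

lemma tensor_add_left:
  assumes "x \<in> V" "x' \<in> V" "y \<in> W"
  shows "tensor s1 s2 V W (x + x') y = tensor s1 s2 V W x y + tensor s1 s2 V W x' y"
  using assms by (auto simp: tensor_def fun_eq_iff bilinear_form_on_def linear_on_def)

lemma tensor_scale_left:
  assumes "x \<in> V" "y \<in> W"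
  shows "tensor s1 s2 V W (s1 c x) y = fun_scale (*) c (tensor s1 s2 V W x y)"
  using assms by (auto simp: tensor_def fun_eq_iff bilinear_form_on_def linear_on_def fun_scale_def)

lemma tensor_linear_right:
  assumes "x \<in> V"
  shows "linear_on s2 (fun_scale (*)) W (tensor s1 s2 V W x)"
  using assms by (auto simp: tensor_def fun_eq_iff bilinear_form_on_def linear_on_def fun_scale_def)

section \<open>Operators on a reduced free product\<close>

context vector_space_family
begin

interpretation FV: vector_space "free_scale :: complex \<Rightarrow> ('l, 'v) free_vector \<Rightarrow> _"
  by (intro vector_space_fun_scale vector_space_complex)

interpretation TS: vector_space
    "fun_scale (*) :: complex \<Rightarrow> (('v \<Rightarrow> ('l, 'v) free_vector \<Rightarrow> complex) \<Rightarrow> complex) \<Rightarrow> _"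
  by (intro vector_space_fun_scale vector_space_complex)

definition xi_coeff :: "'l \<Rightarrow> 'v \<Rightarrow> complex" where
  "xi_coeff i x = (THE a. x - s a (\<xi> i) \<in> X0 i)"

definition centred :: "'l \<Rightarrow> 'v \<Rightarrow> 'v" where
  "centred i x = x - s (xi_coeff i x) (\<xi> i)"

lemma family_subspaces:
  assumes "i \<in> L"
  shows "subspace (X i)" "subspace (X0 i)" "X0 i \<subseteq> X i" "\<xi> i \<in> X i" "\<xi> i \<notin> X0 i"
  using family[OF assms] by (auto simp: vector_space_with_vector_def)

text \<open>
  Two different coordinates would put a nonzero multiple of \<open>\<xi> i\<close> into \<open>X0 i\<close>.
\<close>

lemma xi_coordinate_unique:
  assumes i: "i \<in> L" and "x - s a (\<xi> i) \<in> X0 i" "x - s b (\<xi> i) \<in> X0 i"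
  shows "a = b"
proof (rule ccontr)
  note sub = family_subspaces[OF i]
  assume ne: "a \<noteq> b"
  have "(x - s a (\<xi> i)) - (x - s b (\<xi> i)) \<in> X0 i"
    using subspace_diff[OF sub(2) assms(2,3)] .
  then have "s (b - a) (\<xi> i) \<in> X0 i" by (simp add: algebra_simps)
  then have "s (inverse (b - a)) (s (b - a) (\<xi> i)) \<in> X0 i"
    by (rule subspace_scale[OF sub(2)])
  then show False using ne[symmetric] sub by simp
qed

lemma xi_coeff_unique:
  assumes "i \<in> L" "x - s a (\<xi> i) \<in> X0 i"
  shows "xi_coeff i x = a"
  unfolding xi_coeff_def using assms xi_coordinate_unique by blast

lemma centred_in:
  assumes i: "i \<in> L" and x: "x \<in> X i"
  shows "centred i x \<in> X0 i"
proof -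
  note sub = family_subspaces[OF i]
  \<comment> \<open>Both \<open>\<xi> i\<close> and \<open>x\<close> are multiples of \<open>v\<close> modulo \<open>X0 i\<close>, the former a nonzero one.\<close>
  obtain v where v: "X i = span (insert v (X0 i))"
    using family[OF i] by (auto simp: vector_space_with_vector_def)
  obtain b where b: "\<xi> i - s b v \<in> X0 i"
    using span_breakdown[of v "insert v (X0 i)" "\<xi> i"] sub v
    by (metis insertI1 insert_Diff_single span_base span_breakdown_eq span_eq_iff)
  obtain c where c: "x - s c v \<in> X0 i"
    using x v sub by (metis span_breakdown_eq span_eq_iff)
  have "b \<noteq> 0" using b sub by auto
  have "(x - s c v) - s (c / b) (\<xi> i - s b v) \<in> X0 i"
    using subspace_diff[OF sub(2) c subspace_scale[OF sub(2) b]] .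
  then have "x - s (c / b) (\<xi> i) \<in> X0 i"
    using \<open>b \<noteq> 0\<close> by (simp add: algebra_simps)
  with xi_coeff_unique[OF i this] show ?thesis by (simp add: centred_def)
qed

lemma xi_coeff_add:
  assumes i: "i \<in> L" and x: "x \<in> X i" "y \<in> X i"
  shows "xi_coeff i (x + y) = xi_coeff i x + xi_coeff i y"
proof (rule xi_coeff_unique[OF i])
  have "centred i x + centred i y \<in> X0 i"
    using assms family_subspaces[OF i] by (intro subspace_add centred_in)
  then show "x + y - s (xi_coeff i x + xi_coeff i y) (\<xi> i) \<in> X0 i"
    by (simp add: centred_def algebra_simps)
qed

lemma xi_coeff_scale:
  assumes i: "i \<in> L" and x: "x \<in> X i"
  shows "xi_coeff i (s c x) = c * xi_coeff i x"
proof (rule xi_coeff_unique[OF i])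
  have "s c (centred i x) \<in> X0 i"
    using assms family_subspaces[OF i] by (intro subspace_scale centred_in)
  then show "s c x - s (c * xi_coeff i x) (\<xi> i) \<in> X0 i"
    by (simp add: centred_def algebra_simps)
qed

lemma centred_add:
  "i \<in> L \<Longrightarrow> x \<in> X i \<Longrightarrow> y \<in> X i \<Longrightarrow> centred i (x + y) = centred i x + centred i y"
  by (simp add: centred_def xi_coeff_add algebra_simps)

lemma centred_scale: "i \<in> L \<Longrightarrow> x \<in> X i \<Longrightarrow> centred i (s c x) = s c (centred i x)"
  by (simp add: centred_def xi_coeff_scale algebra_simps)

lemma xi_coeff_X0: "i \<in> L \<Longrightarrow> x \<in> X0 i \<Longrightarrow> xi_coeff i x = 0"
  by (rule xi_coeff_unique) auto

lemma centred_X0: "i \<in> L \<Longrightarrow> x \<in> X0 i \<Longrightarrow> centred i x = x"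
  by (simp add: centred_def xi_coeff_X0)

lemma xi_coeff_xi: "i \<in> L \<Longrightarrow> xi_coeff i (\<xi> i) = 1"
  using family_subspaces[of i] by (intro xi_coeff_unique) (auto simp: subspace_0)

lemma centred_xi: "i \<in> L \<Longrightarrow> centred i (\<xi> i) = 0"
  by (simp add: centred_def xi_coeff_xi)

lemma xi_decomposition: "x = s (xi_coeff i x) (\<xi> i) + centred i x"
  by (simp add: centred_def)

lemma alternating_Nil [simp]: "[] \<in> alternating"
  by (simp add: alternating_def)

lemma alternating_Cons:
  "i # is \<in> alternating \<longleftrightarrow> i \<in> L \<and> is \<in> alternating \<and> (is = [] \<or> hd is \<noteq> i)"
  by (cases "is") (auto simp: alternating_def)

lemma elementary_apply:
  "elementary is xs js F = (if js = is \<and> multilinear_form_on s (map X0 is) F then F xs else 0)"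
  by (simp add: elementary_def list_tensor_def)

lemma elementary_add:
  assumes "x \<in> X0 i" "y \<in> X0 i" "xs \<in> listset (map X0 is)"
  shows "elementary (i # is) ((x + y) # xs) = elementary (i # is) (x # xs) + elementary (i # is) (y # xs)"
  using assms by (auto simp: elementary_apply fun_eq_iff multilinear_form_on_Cons linear_on_def)

lemma elementary_scale:
  assumes "x \<in> X0 i" "xs \<in> listset (map X0 is)"
  shows "elementary (i # is) (s c x # xs) = free_scale c (elementary (i # is) (x # xs))"
  using assms
  by (auto simp: elementary_apply fun_eq_iff multilinear_form_on_Cons linear_on_def fun_scale_def)

definition elementary_tensors :: "('l, 'v) free_vector set" where
  "elementary_tensors = {elementary is xs | is xs. is \<in> alternating \<and> xs \<in> listset (map X0 is)}"

definition left_elementary_tensors :: "'l \<Rightarrow> ('l, 'v) free_vector set" where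
  "left_elementary_tensors i =
     {elementary is xs | is xs. is \<in> alternating \<and> (is = [] \<or> hd is \<noteq> i) \<and> xs \<in> listset (map X0 is)}"

lemma list_tensor_space_subspace:
  "module.subspace (fun_scale (*)) (list_tensor_space s Vs)"
proof -
  interpret T: vector_space "fun_scale ((*) :: complex \<Rightarrow> _) :: complex \<Rightarrow> (('v list \<Rightarrow> complex) \<Rightarrow> complex) \<Rightarrow> _"
    by (intro vector_space_fun_scale vector_space_complex)
  show ?thesis unfolding list_tensor_space_def by (rule T.subspace_span)
qed

lemma subspace_free_space: "FV.subspace free_space"
proof -
  interpret T: vector_space "fun_scale ((*) :: complex \<Rightarrow> _) :: complex \<Rightarrow> (('v list \<Rightarrow> complex) \<Rightarrow> complex) \<Rightarrow> _"
    by (intro vector_space_fun_scale vector_space_complex)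
  note sub = list_tensor_space_subspace
  show ?thesis
  proof (rule FV.subspaceI)
    show "0 \<in> free_space"
      by (auto simp: free_space_def T.subspace_0[OF sub])
  next
    fix x y assume xy: "x \<in> free_space" "y \<in> free_space"
    have sub2: "{is. (x + y) is \<noteq> 0} \<subseteq> {is. x is \<noteq> 0} \<union> {is. y is \<noteq> 0}" by auto
    show "x + y \<in> free_space"
      using xy finite_subset[OF sub2] sub2 T.subspace_add[OF sub]
      unfolding free_space_def by auto
  next
    fix c x assume x: "x \<in> free_space"
    have sub2: "{is. free_scale c x is \<noteq> 0} \<subseteq> {is. x is \<noteq> 0}" by (auto simp: fun_scale_def fun_eq_iff)
    have "\<forall>is\<in>alternating. free_scale c x is \<in> list_tensor_space s (map X0 is)"
      using x T.subspace_scale[OF sub] unfolding free_space_def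
      by (simp add: fun_scale_def)
    then show "free_scale c x \<in> free_space"
      using x finite_subset[OF sub2] sub2 unfolding free_space_def by auto
  qed
qed

lemma subspace_left_space: "FV.subspace (left_space i)"
proof (rule FV.subspaceI)
  show "0 \<in> left_space i"
    using FV.subspace_0[OF subspace_free_space] by (simp add: left_space_def)
next
  fix x y assume "x \<in> left_space i" "y \<in> left_space i"
  then show "x + y \<in> left_space i"
    using FV.subspace_add[OF subspace_free_space] unfolding left_space_def
    by (auto, metis add_0)
next
  fix c x assume "x \<in> left_space i"
  then show "free_scale c x \<in> left_space i"
    using FV.subspace_scale[OF subspace_free_space] unfolding left_space_def
    by (auto simp: fun_scale_def fun_eq_iff)
qed

lemma elementary_in_free_space:
  assumes "is \<in> alternating" "xs \<in> listset (map X0 is)"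
  shows "elementary is xs \<in> free_space"
proof -
  interpret T: vector_space "fun_scale ((*) :: complex \<Rightarrow> _) :: complex \<Rightarrow> (('v list \<Rightarrow> complex) \<Rightarrow> complex) \<Rightarrow> _"
    by (intro vector_space_fun_scale vector_space_complex)
  have sub: "{js. elementary is xs js \<noteq> 0} \<subseteq> {is}" by (auto simp: elementary_def)
  have "list_tensor s (map X0 is) xs \<in> list_tensor_space s (map X0 is)"
    unfolding list_tensor_space_def using assms by (intro T.span_base) auto
  then have "elementary is xs js \<in> list_tensor_space s (map X0 js)" for js
    by (auto simp: elementary_def T.subspace_0[OF list_tensor_space_subspace])
  then show ?thesis using sub finite_subset[OF sub] assms by (auto simp: free_space_def)
qed

lemma left_elementary_in_left_space:
  assumes "is \<in> alternating" "xs \<in> listset (map X0 is)" "is = [] \<or> hd is \<noteq> i"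
  shows "elementary is xs \<in> left_space i"
  using elementary_in_free_space[OF assms(1,2)] assms(3)
  by (auto simp: left_space_def elementary_def)

text \<open>
  Extending a tensor by zero to the other summands of the free product is linear, and it turns the
  spanning tensors of one summand into elementary vectors.
\<close>

lemma component_in_span:
  assumes "\<theta> \<in> list_tensor_space s (map X0 is)"
  shows "(\<lambda>js. if js = is then \<theta> else 0) \<in> FV.span {elementary is xs | xs. xs \<in> listset (map X0 is)}"
proof -
  interpret T: vector_space "fun_scale ((*) :: complex \<Rightarrow> _) :: complex \<Rightarrow> (('v list \<Rightarrow> complex) \<Rightarrow> complex) \<Rightarrow> _"
    by (intro vector_space_fun_scale vector_space_complex)
  show ?thesis
    using T.vector_space_axioms FV.vector_space_axioms _ FV.subspace_span _ assms[unfolded list_tensor_space_def]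
  proof (rule linear_on_span_in_subspace)
    show "linear_on (fun_scale (*)) free_scale (T.span (list_tensor s (map X0 is) ` listset (map X0 is)))
       (\<lambda>\<theta> js. if js = is then \<theta> else 0)"
      by (auto simp: linear_on_def fun_scale_def fun_eq_iff)
  next
    fix b assume "b \<in> list_tensor s (map X0 is) ` listset (map X0 is)"
    then obtain xs where "xs \<in> listset (map X0 is)" "b = list_tensor s (map X0 is) xs" by blast
    then show "(\<lambda>js. if js = is then b else 0) \<in> FV.span {elementary is xs | xs. xs \<in> listset (map X0 is)}"
      by (auto simp: elementary_def intro!: FV.span_base)
  qed
qed

text \<open>
  A vector of the free product is the finite sum of its components, each of which is a combination
  of elementary vectors. Linear maps on \<open>left_space i\<close> need therefore only be compared on those.
\<close>

lemma left_space_eq_span: "left_space i = FV.span (left_elementary_tensors i)"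
proof
  show "FV.span (left_elementary_tensors i) \<subseteq> left_space i"
    by (rule FV.span_minimal[OF _ subspace_left_space])
      (auto simp: left_elementary_tensors_def intro!: left_elementary_in_left_space)
next
  show "left_space i \<subseteq> FV.span (left_elementary_tensors i)"
  proof
    fix w assume w: "w \<in> left_space i"
    let ?S = "{is. w is \<noteq> 0}"
    have fin: "finite ?S" using w by (simp add: left_space_def free_space_def)
    have "w = (\<Sum>is\<in>?S. (\<lambda>js. if js = is then w is else 0))" (is "_ = ?r")
    proof
      fix js
      have "?r js = (\<Sum>is\<in>?S. if js = is then w is else 0)"
        using fin by (induction rule: finite_induct) auto
      also have "\<dots> = w js" using fin by (simp add: sum.delta)
      finally show "w js = ?r js" by simp
    qed
    moreover have "?r \<in> FV.span (left_elementary_tensors i)"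
    proof (rule FV.span_sum)
      fix "is" assume "is \<in> ?S"
      then have i: "is \<in> alternating" "is = [] \<or> hd is \<noteq> i" "w is \<in> list_tensor_space s (map X0 is)"
        using w by (auto simp: left_space_def free_space_def)
      then have "{elementary is xs | xs. xs \<in> listset (map X0 is)} \<subseteq> left_elementary_tensors i"
        by (auto simp: left_elementary_tensors_def)
      then show "(\<lambda>js. if js = is then w is else 0) \<in> FV.span (left_elementary_tensors i)"
        using component_in_span[OF i(3)] FV.span_mono by blast
    qed
    ultimately show "w \<in> FV.span (left_elementary_tensors i)" by simp
  qed
qed

text \<open>
  The choice in the definition of \<open>V_iso\<close> is justified by an explicit map. The component \<open>js\<close> of the
  image of \<open>t\<close>, evaluated at a multilinear form \<open>F\<close>, is \<open>t\<close> evaluated at a bilinear form \<open>B js F\<close>,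
  read off from \<open>x \<otimes> w \<mapsto> \<langle>x\<rangle> w + x\<degree> \<otimes> w\<close>, where \<open>\<langle>x\<rangle>\<close> and \<open>x\<degree>\<close> are the coordinate and the
  centred part of \<open>x\<close>.
\<close>

lemma V_iso_properties:
  assumes i: "i \<in> L"
  shows "linear_on (fun_scale (*)) free_scale (left_tensor_space i) (V_iso i)"
    and "\<And>w. w \<in> left_space i \<Longrightarrow> V_iso i (left_tensor i (\<xi> i) w) = w"
    and "\<And>x is xs. x \<in> X0 i \<Longrightarrow> is \<in> alternating \<Longrightarrow> xs \<in> listset (map X0 is) \<Longrightarrow>
       is = [] \<or> hd is \<noteq> i \<Longrightarrow>
       V_iso i (left_tensor i x (elementary is xs)) = elementary (i # is) (x # xs)"
proof -
  define B where "B js F x w = xi_coeff i x * w js F +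
      (if js \<noteq> [] \<and> hd js = i then w (tl js) (\<lambda>xs. F (centred i x # xs)) else 0)"
    for js F x and w :: "('l, 'v) free_vector"
  define V :: "(('v \<Rightarrow> ('l, 'v) free_vector \<Rightarrow> complex) \<Rightarrow> complex) \<Rightarrow> ('l, 'v) free_vector"
    where "V t = (\<lambda>js F. if multilinear_form_on s (map X0 js) F then t (B js F) else 0)" for t
  note sub = family_subspaces[OF i]
  have slice_combination: "w (tl js) (\<lambda>xs. F (z # xs)) =
      a * w (tl js) (\<lambda>xs. F (x # xs)) + b * w (tl js) (\<lambda>xs. F (y # xs))"
    if w: "w \<in> left_space i" and F: "multilinear_form_on s (map X0 js) F"
      and z: "z = s a x + s b y" and xy: "x \<in> X0 i" "y \<in> X0 i" and js: "js \<noteq> []" "hd js = i"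
    for a b x y z w js F
  proof (cases "w (tl js) = 0")
    case False
    then have t: "w (tl js) \<in> list_tensor_space s (map X0 (tl js))"
      using w by (auto simp: left_space_def free_space_def)
    obtain js' where js': "js = i # js'" using js by (cases js) auto
    have mem: "z \<in> X0 i" "s a x \<in> X0 i" "s b y \<in> X0 i"
      using z xy sub by (auto simp: subspace_add subspace_scale)
    have F': "multilinear_form_on s (X0 i # map X0 js') F" using F js' by simp
    have slice: "multilinear_form_on s (map X0 (tl js)) (\<lambda>xs. F (u # xs))" if "u \<in> X0 i" for u
      using F' that js' by (simp add: multilinear_form_on_Cons)
    have "F (z # xs) = a * F (x # xs) + b * F (y # xs)" if "xs \<in> listset (map X0 (tl js))" for xs
    proof -
      have l: "linear_on s (*) (X0 i) (\<lambda>x. F (x # xs))"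
        using F' that js' by (simp add: multilinear_form_on_Cons)
      show ?thesis
        using linear_onD(1)[OF l mem(2,3)] linear_onD(2)[OF l xy(1)] linear_onD(2)[OF l xy(2)] z by simp
    qed
    then show ?thesis
      by (rule list_tensor_space_combination[OF vector_space_axioms t slice[OF xy(1)] slice[OF xy(2)]
            slice[OF mem(1)]])
  qed simp
  have bil: "bilinear_form_on s free_scale (X i) (left_space i) (B js F)"
    if F: "multilinear_form_on s (map X0 js) F" for js F
    unfolding bilinear_form_on_def
  proof (intro conjI ballI)
    fix x
    show "linear_on free_scale (*) (left_space i) (B js F x)"
      by (auto simp: linear_on_def B_def fun_scale_def algebra_simps)
  next
    fix w assume w: "w \<in> left_space i"
    note comb = slice_combination[OF w F]
    show "linear_on s (*) (X i) (\<lambda>x. B js F x w)"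
      unfolding linear_on_def
    proof (intro conjI ballI allI)
      fix x y assume xy: "x \<in> X i" "y \<in> X i"
      have "centred i (x + y) = s 1 (centred i x) + s 1 (centred i y)"
        using xy i by (simp add: centred_add)
      from comb[OF this] show "B js F (x + y) w = B js F x w + B js F y w"
        using centred_in[OF i] xy i by (simp add: B_def xi_coeff_add algebra_simps)
    next
      fix c x assume x: "x \<in> X i"
      have "centred i (s c x) = s c (centred i x) + s 0 (centred i x)"
        using x i by (simp add: centred_scale)
      from comb[OF this] show "B js F (s c x) w = c * B js F x w"
        using centred_in[OF i] x i by (simp add: B_def xi_coeff_scale algebra_simps)
    qed
  qed
  have lin: "linear_on (fun_scale (*)) free_scale (left_tensor_space i) V"
    by (auto simp: linear_on_def V_def fun_scale_def fun_eq_iff)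
  have V_tensor: "V (left_tensor i x w) = (\<lambda>js F. if multilinear_form_on s (map X0 js) F then B js F x w else 0)"
    for x w
    using bil by (auto simp: V_def tensor_def fun_eq_iff)
  have w0: "w js F = 0" if "w \<in> left_space i" "\<not> multilinear_form_on s (map X0 js) F" for w js F
    using that list_tensor_space_not_multilinear[of "w js" s "map X0 js" F]
    by (cases "w js = 0") (auto simp: left_space_def free_space_def)
  have zero: "w (tl js) (\<lambda>xs. F (0 # xs)) = 0"
    if "w \<in> left_space i" "multilinear_form_on s (map X0 js) F" "js \<noteq> []" "hd js = i" for w js F
    using slice_combination[OF that(1,2), of 0 0 0 0 0] that(3,4) sub by (simp add: subspace_0)
  have V1: "V (left_tensor i (\<xi> i) w) = w" if "w \<in> left_space i" for w
    using that w0[OF that] zero[OF that]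
    by (auto simp: V_tensor B_def fun_eq_iff xi_coeff_xi[OF i] centred_xi[OF i])
  have V2: "V (left_tensor i x (elementary is xs)) = elementary (i # is) (x # xs)"
    if x: "x \<in> X0 i" and "is": "is \<in> alternating" and xs: "xs \<in> listset (map X0 is)"
      and hd: "is = [] \<or> hd is \<noteq> i" for x "is" xs
  proof (intro ext)
    fix js F
    show "V (left_tensor i x (elementary is xs)) js F = elementary (i # is) (x # xs) js F"
      using x by (cases js)
        (auto simp: V_tensor B_def elementary_apply xi_coeff_X0[OF i] centred_X0[OF i] multilinear_form_on_Cons)
  qed
  define Q where "Q V \<longleftrightarrow> linear_on (fun_scale (*)) free_scale (left_tensor_space i) V \<and>
        (\<forall>w\<in>left_space i. V (left_tensor i (\<xi> i) w) = w) \<and>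
        (\<forall>x\<in>X0 i. \<forall>is\<in>alternating. \<forall>xs\<in>listset (map X0 is). (is = [] \<or> hd is \<noteq> i) \<longrightarrow>
           V (left_tensor i x (elementary is xs)) = elementary (i # is) (x # xs))" for V
  have "Q V" unfolding Q_def using lin V1 V2 by auto
  then have "Q (SOME V. Q V)" by (rule someI[of Q V])
  moreover have "V_iso i = (SOME V. Q V)" unfolding V_iso_def Q_def ..
  ultimately have "Q (V_iso i)" by simp
  then show "linear_on (fun_scale (*)) free_scale (left_tensor_space i) (V_iso i)"
    and "\<And>w. w \<in> left_space i \<Longrightarrow> V_iso i (left_tensor i (\<xi> i) w) = w"
    and "\<And>x is xs. x \<in> X0 i \<Longrightarrow> is \<in> alternating \<Longrightarrow> xs \<in> listset (map X0 is) \<Longrightarrow>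
       is = [] \<or> hd is \<noteq> i \<Longrightarrow>
       V_iso i (left_tensor i x (elementary is xs)) = elementary (i # is) (x # xs)"
    unfolding Q_def by auto
qed

text \<open>
  In the decomposition \<open>X i = \<complex>\<xi> \<oplus> X0 i\<close> let \<open>T\<xi> = a\<xi> + v\<close> and \<open>Tx = f(x)\<xi> + Dx\<close>. On a tensor
  that does not start with the colour \<open>i\<close> the operator \<open>V (T \<otimes> I) V\<^sup>-\<^sup>1\<close> is \<open>w \<mapsto> a w + v \<otimes> w\<close>, and on
  \<open>x \<otimes> w\<close> it is \<open>f(x) w + Dx \<otimes> w\<close>. Sorted by the component \<open>js\<close> of the result, these four terms give
  the formula below. The condition on \<open>js\<close> is essential: without it the term \<open>v \<otimes> w\<close> would also
  be produced for tensors \<open>w\<close> that start with \<open>i\<close>.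
\<close>

definition left_action :: "'l \<Rightarrow> ('v \<Rightarrow> 'v) \<Rightarrow> ('l, 'v) free_vector \<Rightarrow> ('l, 'v) free_vector" where
  "left_action i T w = (\<lambda>js F.
     if js \<in> alternating \<and> multilinear_form_on s (map X0 js) F then
       (if js \<noteq> [] \<and> hd js = i
        then w (tl js) (\<lambda>xs. F (centred i (T (\<xi> i)) # xs)) +
             w js (\<lambda>ys. F (centred i (T (hd ys)) # tl ys))
        else xi_coeff i (T (\<xi> i)) * w js F + w (i # js) (\<lambda>ys. xi_coeff i (T (hd ys)) * F (tl ys)))
     else 0)"

lemma linear_on_left_action: "linear_on free_scale free_scale U (left_action i T)"
  by (auto simp: linear_on_def left_action_def fun_scale_def fun_eq_iff algebra_simps)

lemma linear_operatorD:
  assumes "linear_operator_on s V T"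
  shows "\<And>x. x \<in> V \<Longrightarrow> T x \<in> V" "\<And>x y. x \<in> V \<Longrightarrow> y \<in> V \<Longrightarrow> T (x + y) = T x + T y"
    "\<And>c x. x \<in> V \<Longrightarrow> T (s c x) = s c (T x)"
  using assms by (auto simp: linear_operator_on_def linear_on_def)

lemma left_action_elementary_other:
  assumes i: "i \<in> L" and T: "linear_operator_on s (X i) T"
    and "is": "is \<in> alternating" "is = [] \<or> hd is \<noteq> i" and xs: "xs \<in> listset (map X0 is)"
  shows "left_action i T (elementary is xs) =
    free_scale (xi_coeff i (T (\<xi> i))) (elementary is xs) + elementary (i # is) (centred i (T (\<xi> i)) # xs)"
proof (intro ext)
  fix js F
  have v: "centred i (T (\<xi> i)) \<in> X0 i"
    using i T family_subspaces[OF i] by (intro centred_in linear_operatorD(1)[OF T]) auto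
  show "left_action i T (elementary is xs) js F =
    (free_scale (xi_coeff i (T (\<xi> i))) (elementary is xs) + elementary (i # is) (centred i (T (\<xi> i)) # xs)) js F"
  proof (cases "js \<in> alternating \<and> multilinear_form_on s (map X0 js) F")
    case False
    have alt: "i # is \<in> alternating" using i "is" by (simp add: alternating_Cons)
    have "elementary is xs js F = 0" "elementary (i # is) ys js F = 0" for ys
      using False "is" alt by (auto simp: elementary_apply)
    moreover have "left_action i T (elementary is xs) js F = 0"
      using False unfolding left_action_def by (rule if_not_P)
    ultimately show ?thesis by (simp add: fun_scale_def)
  next
    case True
    show ?thesis
    proof (cases "js \<noteq> [] \<and> hd js = i")
      case c: True
      define js' where "js' = tl js"
      have js: "js = i # js'" using c by (cases js) (auto simp: js'_def)
      have n: "is \<noteq> js" using "is" js by auto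
      have "left_action i T (elementary is xs) js F =
          elementary is xs js' (\<lambda>xs. F (centred i (T (\<xi> i)) # xs))"
        using True c n by (simp add: left_action_def js'_def elementary_apply)
      moreover have "multilinear_form_on s (map X0 js') (\<lambda>xs. F (centred i (T (\<xi> i)) # xs))"
        using True v by (simp add: js multilinear_form_on_Cons)
      ultimately show ?thesis using True n
        by (cases "js' = is") (simp_all add: js elementary_apply fun_scale_def)
    next
      case c: False
      have n: "i # js \<noteq> is" "js \<noteq> i # is" using c "is" by auto
      have "left_action i T (elementary is xs) js F = xi_coeff i (T (\<xi> i)) * elementary is xs js F"
        using True c n by (auto simp: left_action_def elementary_apply)
      then show ?thesis using n by (simp add: elementary_apply fun_scale_def)
    qed
  qed
qed

lemma left_action_elementary_same:
  assumes T: "linear_operator_on s (X i) T"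
    and "is": "i # is \<in> alternating" and xs: "xs \<in> listset (map X0 is)" and x: "x \<in> X0 i"
  shows "left_action i T (elementary (i # is) (x # xs)) =
    free_scale (xi_coeff i (T x)) (elementary is xs) + elementary (i # is) (centred i (T x) # xs)"
proof (intro ext)
  fix js F
  have i: "i \<in> L" using "is" by (simp add: alternating_Cons)
  note sub = family_subspaces[OF i]
  have TX: "T y \<in> X i" if "y \<in> X0 i" for y
    using that sub by (intro linear_operatorD(1)[OF T]) auto
  have cl: "linear_on s (*) (X0 i) (\<lambda>y. xi_coeff i (T y))"
    unfolding linear_on_def
  proof (intro conjI ballI allI)
    fix x y assume "x \<in> X0 i" "y \<in> X0 i"
    then show "xi_coeff i (T (x + y)) = xi_coeff i (T x) + xi_coeff i (T y)"
      using sub TX i by (simp add: linear_operatorD(2)[OF T] subsetD xi_coeff_add)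
  next
    fix c x assume "x \<in> X0 i"
    then show "xi_coeff i (T (s c x)) = c * xi_coeff i (T x)"
      using sub TX i by (simp add: linear_operatorD(3)[OF T] subsetD xi_coeff_scale)
  qed
  have dl: "linear_on s s (X0 i) (\<lambda>y. centred i (T y))"
    unfolding linear_on_def
  proof (intro conjI ballI allI)
    fix x y assume "x \<in> X0 i" "y \<in> X0 i"
    then show "centred i (T (x + y)) = centred i (T x) + centred i (T y)"
      using sub TX i by (simp add: linear_operatorD(2)[OF T] subsetD centred_add)
  next
    fix c x assume "x \<in> X0 i"
    then show "centred i (T (s c x)) = s c (centred i (T x))"
      using sub TX i by (simp add: linear_operatorD(3)[OF T] subsetD centred_scale)
  qed
  have D0: "centred i (T y) \<in> X0 i" if "y \<in> X0 i" for y using TX[OF that] i by (intro centred_in)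
  show "left_action i T (elementary (i # is) (x # xs)) js F =
    (free_scale (xi_coeff i (T x)) (elementary is xs) + elementary (i # is) (centred i (T x) # xs)) js F"
  proof (cases "js \<in> alternating \<and> multilinear_form_on s (map X0 js) F")
    case False
    have alt: "is \<in> alternating" using "is" by (simp add: alternating_Cons)
    have "elementary is xs js F = 0" "elementary (i # is) ys js F = 0" for ys
      using False "is" alt by (auto simp: elementary_apply)
    moreover have "left_action i T (elementary (i # is) (x # xs)) js F = 0"
      using False unfolding left_action_def by (rule if_not_P)
    ultimately show ?thesis by (simp add: fun_scale_def)
  next
    case True
    show ?thesis
    proof (cases "js \<noteq> [] \<and> hd js = i")
      case c: True
      define js' where "js' = tl js"
      have js: "js = i # js'" using c by (cases js) (auto simp: js'_def)
      have F: "multilinear_form_on s (X0 i # map X0 js') F" using True js by simp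
      have "multilinear_form_on s (X0 i # map X0 js') (\<lambda>ys. F (centred i (T (hd ys)) # tl ys))"
        unfolding multilinear_form_on_Cons
      proof (intro conjI ballI)
        fix ys assume ys: "ys \<in> listset (map X0 js')"
        have "linear_on s (*) (X0 i) (\<lambda>y. F (centred i (T y) # ys))"
          using linear_on_compose[OF dl, of "X0 i" "(*)" "\<lambda>y. F (y # ys)"] F ys D0
          by (auto simp: multilinear_form_on_Cons)
        then show "linear_on s (*) (X0 i) (\<lambda>y. F (centred i (T (hd (y # ys))) # tl (y # ys)))"
          by simp
      next
        fix y assume "y \<in> X0 i"
        then show "multilinear_form_on s (map X0 js') (\<lambda>ys. F (centred i (T (hd (y # ys))) # tl (y # ys)))"
          using F D0 by (simp add: multilinear_form_on_Cons)
      qed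
      moreover have "js' \<noteq> i # is" using True js "is" by (auto simp: alternating_Cons)
      moreover have "js \<noteq> is" using "is" js by (auto simp: alternating_Cons)
      moreover have "left_action i T (elementary (i # is) (x # xs)) js F =
          elementary (i # is) (x # xs) js' (\<lambda>xs. F (centred i (T (\<xi> i)) # xs)) +
          elementary (i # is) (x # xs) js (\<lambda>ys. F (centred i (T (hd ys)) # tl ys))"
        using True c by (simp add: left_action_def js'_def)
      ultimately show ?thesis using True
        by (cases "js' = is") (simp_all add: js elementary_apply fun_scale_def)
    next
      case c: False
      have *: "multilinear_form_on s (X0 i # map X0 js) (\<lambda>ys. xi_coeff i (T (hd ys)) * F (tl ys))"
        unfolding multilinear_form_on_Cons
      proof (intro conjI ballI)
        fix ys assume ys: "ys \<in> listset (map X0 js)"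
        show "linear_on s (*) (X0 i) (\<lambda>y. xi_coeff i (T (hd (y # ys))) * F (tl (y # ys)))"
          using cl by (auto simp: linear_on_def algebra_simps)
      next
        fix y assume "y \<in> X0 i"
        show "multilinear_form_on s (map X0 js) (\<lambda>ys. xi_coeff i (T (hd (y # ys))) * F (tl (y # ys)))"
          using True by (auto simp: multilinear_form_on_def linear_on_def algebra_simps)
      qed
      have "js \<noteq> i # is" using c by auto
      moreover have "left_action i T (elementary (i # is) (x # xs)) js F =
          elementary (i # is) (x # xs) (i # js) (\<lambda>ys. xi_coeff i (T (hd ys)) * F (tl ys))"
        using True c \<open>js \<noteq> i # is\<close> by (auto simp: left_action_def elementary_apply)
      ultimately show ?thesis using True *
        by (cases "js = is") (simp_all add: elementary_apply fun_scale_def)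
    qed
  qed
qed

lemma left_tensor_in: "x \<in> X i \<Longrightarrow> w \<in> left_space i \<Longrightarrow> left_tensor i x w \<in> left_tensor_space i"
  unfolding tensor_space_def by (rule TS.span_base) blast

lemma V_iso_elementary:
  assumes i: "i \<in> L" and x: "x \<in> X i"
    and "is": "is \<in> alternating" "is = [] \<or> hd is \<noteq> i" and xs: "xs \<in> listset (map X0 is)"
  shows "V_iso i (left_tensor i x (elementary is xs)) =
    free_scale (xi_coeff i x) (elementary is xs) + elementary (i # is) (centred i x # xs)"
proof -
  note sub = family_subspaces[OF i]
  let ?e = "elementary is xs"
  have e: "?e \<in> left_space i" using "is" xs by (intro left_elementary_in_left_space)
  have c0: "centred i x \<in> X0 i" using i x by (rule centred_in)
  then have c: "centred i x \<in> X i" using sub by auto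
  have sx: "s (xi_coeff i x) (\<xi> i) \<in> X i" using sub by (simp add: subspace_scale)
  have "left_tensor i x ?e =
      left_tensor i (s (xi_coeff i x) (\<xi> i) + centred i x) ?e"
    using xi_decomposition[of x i] by simp
  also have "\<dots> = fun_scale (*) (xi_coeff i x) (left_tensor i (\<xi> i) ?e) + left_tensor i (centred i x) ?e"
    using sub e sx c by (simp add: tensor_add_left tensor_scale_left)
  finally have "left_tensor i x ?e =
    fun_scale (*) (xi_coeff i x) (left_tensor i (\<xi> i) ?e) + left_tensor i (centred i x) ?e" .
  moreover have "left_tensor i (\<xi> i) ?e \<in> left_tensor_space i" "left_tensor i (centred i x) ?e \<in> left_tensor_space i"
    using sub e c by (auto intro: left_tensor_in)
  moreover have "fun_scale (*) (xi_coeff i x) (left_tensor i (\<xi> i) ?e) \<in> left_tensor_space i"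
    using calculation(2) unfolding tensor_space_def by (rule TS.span_scale)
  ultimately show ?thesis
    using V_iso_properties[OF i] e c0 "is" xs
    by (simp add: linear_onD[OF V_iso_properties(1)[OF i]])
qed

text \<open>
  Both sides are linear in \<open>t\<close>, and for \<open>t = x \<otimes> w\<close> also in \<open>w\<close>; on elementary \<open>w\<close> the explicit
  formulas agree. In particular \<open>V ((T \<otimes> I) t)\<close> depends on \<open>V t\<close> only.
\<close>

lemma V_iso_intertwines:
  assumes i: "i \<in> L" and T: "linear_operator_on s (X i) T" and t: "t \<in> left_tensor_space i"
  shows "V_iso i (tensor_operator s free_scale (X i) (left_space i) T id t) = left_action i T (V_iso i t)"
proof -
  let ?R = "tensor_operator s free_scale (X i) (left_space i) T id"
  note sub = family_subspaces[OF i]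
  note TO = tensor_operator_exists[OF vector_space_axioms FV.vector_space_axioms T, of "left_space i"]
  have R: "linear_on (fun_scale (*)) (fun_scale (*)) (left_tensor_space i) ?R"
    "?R ` left_tensor_space i \<subseteq> left_tensor_space i"
    and R_tensor: "\<And>x w. x \<in> X i \<Longrightarrow> w \<in> left_space i \<Longrightarrow> ?R (left_tensor i x w) = left_tensor i (T x) w"
    using TO by (auto simp: linear_operator_on_def)
  note V = V_iso_properties(1)[OF i]
  have l1: "linear_on (fun_scale (*)) free_scale (left_tensor_space i) (\<lambda>t. V_iso i (?R t))"
    by (rule linear_on_compose[OF R V])
  have l2: "linear_on (fun_scale (*)) free_scale (left_tensor_space i) (\<lambda>t. left_action i T (V_iso i t))"
    by (rule linear_on_compose[OF V subset_UNIV linear_on_left_action])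
  show ?thesis
  proof (rule linear_on_eq_on_span[OF TS.vector_space_axioms tensor_space_def l1 l2 _ t])
    fix b assume "b \<in> {left_tensor i x w |x w. x \<in> X i \<and> w \<in> left_space i}"
    then obtain x w where b: "b = left_tensor i x w" and x: "x \<in> X i" and w: "w \<in> left_space i" by blast
    have Tx: "T x \<in> X i" using x by (rule linear_operatorD(1)[OF T])
    have m: "linear_on free_scale free_scale (left_space i) (\<lambda>w. V_iso i (left_tensor i y w))"
      if "y \<in> X i" for y
      using that left_tensor_in by (intro linear_on_compose[OF tensor_linear_right _ V]) auto
    have m1: "linear_on free_scale free_scale (left_space i) (\<lambda>w. V_iso i (left_tensor i (T x) w))"
      using Tx by (rule m)
    have m2: "linear_on free_scale free_scale (left_space i) (\<lambda>w. left_action i T (V_iso i (left_tensor i x w)))"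
      by (rule linear_on_compose[OF m[OF x] subset_UNIV linear_on_left_action])
    have "V_iso i (left_tensor i (T x) w) = left_action i T (V_iso i (left_tensor i x w))"
    proof (rule linear_on_eq_on_span[OF FV.vector_space_axioms left_space_eq_span m1 m2 _ w])
      fix e assume "e \<in> left_elementary_tensors i"
      then obtain "is" xs where e: "e = elementary is xs" and "is": "is \<in> alternating" "is = [] \<or> hd is \<noteq> i"
        and xs: "xs \<in> listset (map X0 is)" by (auto simp: left_elementary_tensors_def)
      have c0: "centred i x \<in> X0 i" using i x by (rule centred_in)
      then have c: "centred i x \<in> X i" using sub by auto
      have iis: "i # is \<in> alternating" using i "is" by (simp add: alternating_Cons)
      have Txi: "T (\<xi> i) \<in> X i" and Tc: "T (centred i x) \<in> X i"
        using sub c by (auto intro: linear_operatorD(1)[OF T])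
      have sxi: "s (xi_coeff i x) (\<xi> i) \<in> X i" using sub by (simp add: subspace_scale)
      have "T x = T (s (xi_coeff i x) (\<xi> i) + centred i x)" using xi_decomposition[of x i] by simp
      also have "\<dots> = s (xi_coeff i x) (T (\<xi> i)) + T (centred i x)"
        using sub sxi c by (simp add: linear_operatorD[OF T])
      finally have Tx_eq: "T x = s (xi_coeff i x) (T (\<xi> i)) + T (centred i x)" .
      have sT: "s (xi_coeff i x) (T (\<xi> i)) \<in> X i" using sub Txi by (simp add: subspace_scale)
      have co: "xi_coeff i (T x) = xi_coeff i x * xi_coeff i (T (\<xi> i)) + xi_coeff i (T (centred i x))"
        unfolding Tx_eq using i Tc sT Txi by (simp add: xi_coeff_add xi_coeff_scale)
      have ce: "centred i (T x) = s (xi_coeff i x) (centred i (T (\<xi> i))) + centred i (T (centred i x))"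
        unfolding Tx_eq using i Tc sT Txi by (simp add: centred_add centred_scale)
      have mem: "centred i (T (\<xi> i)) \<in> X0 i" "centred i (T (centred i x)) \<in> X0 i"
        "s (xi_coeff i x) (centred i (T (\<xi> i))) \<in> X0 i"
        using i Tc Txi sub by (auto intro!: centred_in subspace_scale)
      have "left_action i T (V_iso i (left_tensor i x e)) =
        free_scale (xi_coeff i x) (left_action i T e) + left_action i T (elementary (i # is) (centred i x # xs))"
        unfolding e V_iso_elementary[OF i x "is" xs]
        by (simp add: linear_onD[OF linear_on_left_action[of UNIV]])
      also have "\<dots> = free_scale (xi_coeff i (T x)) e + elementary (i # is) (centred i (T x) # xs)"
        unfolding e left_action_elementary_other[OF i T "is" xs] left_action_elementary_same[OF T iis xs c0]
          co ce elementary_add[OF mem(3,2) xs] elementary_scale[OF mem(1) xs]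
        by (simp add: fun_scale_def fun_eq_iff algebra_simps)
      also have "\<dots> = V_iso i (left_tensor i (T x) e)"
        unfolding e V_iso_elementary[OF i Tx "is" xs] ..
      finally show "V_iso i (left_tensor i (T x) e) = left_action i T (V_iso i (left_tensor i x e))" ..
    qed
    then show "V_iso i (?R b) = left_action i T (V_iso i b)" using b R_tensor x w by simp
  qed
qed

lemma elementary_tensors_subset_image:
  assumes i: "i \<in> L"
  shows "elementary_tensors \<subseteq> V_iso i ` left_tensor_space i"
proof
  fix e assume "e \<in> elementary_tensors"
  then obtain "is" xs where e: "e = elementary is xs" "is \<in> alternating" "xs \<in> listset (map X0 is)"
    by (auto simp: elementary_tensors_def)
  note sub = family_subspaces[OF i]
  show "e \<in> V_iso i ` left_tensor_space i"
  proof (cases "is \<noteq> [] \<and> hd is = i")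
    case False
    then have w: "e \<in> left_space i" using e by (auto intro: left_elementary_in_left_space)
    then have "V_iso i (left_tensor i (\<xi> i) e) = e" by (rule V_iso_properties(2)[OF i])
    then show ?thesis using left_tensor_in[of "\<xi> i" i e] sub w by (metis image_eqI)
  next
    case True
    define js where "js = tl is"
    have js: "is = i # js" using True by (cases "is") (auto simp: js_def)
    obtain x ys where x: "xs = x # ys" "x \<in> X0 i" "ys \<in> listset (map X0 js)"
      using e js by (auto simp: set_Cons_iff)
    have alt: "js \<in> alternating" "js = [] \<or> hd js \<noteq> i" using e js by (auto simp: alternating_Cons)
    have "V_iso i (left_tensor i x (elementary js ys)) = e"
      using V_iso_properties(3)[OF i x(2) alt(1) x(3) alt(2)] e x js by simp
    moreover have "left_tensor i x (elementary js ys) \<in> left_tensor_space i"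
      using x alt sub by (intro left_tensor_in left_elementary_in_left_space) auto
    ultimately show ?thesis by (metis image_eqI)
  qed
qed

definition tensor_vectors :: "('l, 'v) free_vector set" where
  "tensor_vectors = module.span free_scale elementary_tensors"

text \<open>
  Whatever preimage of \<open>w\<close> under \<open>V\<close> is chosen by \<open>inv_into\<close>, the intertwining relation gives the
  same result.
\<close>

lemma left_rep_eq_left_action:
  assumes i: "i \<in> L" and T: "linear_operator_on s (X i) T" and w: "w \<in> tensor_vectors"
  shows "left_rep i T w = left_action i T w"
proof -
  have "FV.subspace (V_iso i ` left_tensor_space i)"
  proof -
    note l = linear_onD[OF V_iso_properties(1)[OF i]]
    have st: "TS.subspace (left_tensor_space i)" unfolding tensor_space_def by (rule TS.subspace_span)
    show ?thesis
    proof (rule FV.subspaceI)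
      show "0 \<in> V_iso i ` left_tensor_space i"
        using linear_on_zero[OF V_iso_properties(1)[OF i]] TS.subspace_0[OF st] by (metis image_eqI)
    next
      fix x y assume "x \<in> V_iso i ` left_tensor_space i" "y \<in> V_iso i ` left_tensor_space i"
      then show "x + y \<in> V_iso i ` left_tensor_space i"
        using l(1) TS.subspace_add[OF st] by (smt (verit) image_iff)
    next
      fix c x assume "x \<in> V_iso i ` left_tensor_space i"
      then show "free_scale c x \<in> V_iso i ` left_tensor_space i"
        using l(2) TS.subspace_scale[OF st] by (smt (verit) image_iff)
    qed
  qed
  with elementary_tensors_subset_image[OF i] have "tensor_vectors \<subseteq> V_iso i ` left_tensor_space i"
    unfolding tensor_vectors_def by (rule FV.span_minimal)
  then have "w \<in> V_iso i ` left_tensor_space i" using w by blast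
  then have t: "inv_into (left_tensor_space i) (V_iso i) w \<in> left_tensor_space i"
    and V: "V_iso i (inv_into (left_tensor_space i) (V_iso i) w) = w"
    by (rule inv_into_into, rule f_inv_into_f)
  show ?thesis
    using V_iso_intertwines[OF i T t] V by (simp add: left_rep_def)
qed

end

section \<open>Vacuum expectations as moves on a stack\<close>

text \<open>
  \<open>stack_moment J m r st\<close> is the vacuum coefficient obtained when the letters of the list \<open>r\<close> act, in
  this order, on the elementary tensor described by the stack \<open>st\<close>; so \<open>r\<close> is the reverse of the
  word. A record \<open>(n, ks)\<close> stands for the centred part \<open>y\<^sub>k\<^sub>s\<close> of the vector obtained from \<open>\<xi>\<^sub>n\<close> by
  the word \<open>ks\<close>, and \<open>m n ks\<close> for its coordinate along \<open>\<xi>\<^sub>n\<close>. From \<open>T\<^sub>k (m(ks) \<xi> + y\<^sub>k\<^sub>s) = m(k ks) \<xi> +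
  y\<^sub>k\<^sub>k\<^sub>s\<close> one gets \<open>T\<^sub>k y\<^sub>k\<^sub>s = (m(k ks) - m(k) m(ks)) \<xi> + y\<^sub>k\<^sub>k\<^sub>s - m(ks) y\<^sub>k\<close>, the rule for a letter that
  meets a record of its own colour. A letter in \<open>J\<close> is compressed by the Boolean projection, which
  kills all stacks except the empty one and the single records of the same colour.
\<close>

fun stack_moment :: "'k set \<Rightarrow> ('n \<Rightarrow> 'k list \<Rightarrow> complex) \<Rightarrow> ('n \<times> 'k) list \<Rightarrow> ('n \<times> 'k list) list \<Rightarrow> complex"
where
  "stack_moment J m [] st = (if st = [] then 1 else 0)"
| "stack_moment J m ((n, k) # r) [] =
     m n [k] * stack_moment J m r [] + stack_moment J m r [(n, [k])]"
| "stack_moment J m ((n, k) # r) ((n', ks) # st) =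
     (if k \<in> J \<and> (n \<noteq> n' \<or> st \<noteq> []) then 0
      else if n = n' then
        (m n (k # ks) - m n [k] * m n ks) * stack_moment J m r st
        + stack_moment J m r ((n, k # ks) # st) - m n ks * stack_moment J m r ((n, [k]) # st)
      else m n [k] * stack_moment J m r ((n', ks) # st) + stack_moment J m r ((n, [k]) # (n', ks) # st))"

context vector_space_family
begin

interpretation FV: vector_space "free_scale :: complex \<Rightarrow> ('l, 'v) free_vector \<Rightarrow> _"
  by (intro vector_space_fun_scale vector_space_complex)

lemma subspace_tensor_vectors: "module.subspace free_scale tensor_vectors"
  unfolding tensor_vectors_def by (rule FV.subspace_span)

lemma elementary_in_tensor_vectors:
  "is \<in> alternating \<Longrightarrow> xs \<in> listset (map X0 is) \<Longrightarrow> elementary is xs \<in> tensor_vectors"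
  unfolding tensor_vectors_def elementary_tensors_def by (rule FV.span_base) blast

lemma left_action_in_tensor_vectors:
  assumes i: "i \<in> L" and T: "linear_operator_on s (X i) T" and w: "w \<in> tensor_vectors"
  shows "left_action i T w \<in> tensor_vectors"
  unfolding tensor_vectors_def
proof (rule linear_on_span_in_subspace[OF FV.vector_space_axioms FV.vector_space_axioms
      linear_on_left_action FV.subspace_span _ w[unfolded tensor_vectors_def]], fold tensor_vectors_def)
  fix e assume "e \<in> elementary_tensors"
  then obtain "is" xs where e: "e = elementary is xs" "is \<in> alternating" "xs \<in> listset (map X0 is)"
    by (auto simp: elementary_tensors_def)
  note sub = family_subspaces[OF i]
  note sv = subspace_tensor_vectors
  have c: "centred i (T x) \<in> X0 i" if "x \<in> X i" for x
    using i that by (intro centred_in linear_operatorD(1)[OF T])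
  show "left_action i T e \<in> tensor_vectors"
  proof (cases "is \<noteq> [] \<and> hd is = i")
    case False
    then have alt: "is = [] \<or> hd is \<noteq> i" by blast
    have "elementary (i # is) (centred i (T (\<xi> i)) # xs) \<in> tensor_vectors"
      using e alt i c sub by (intro elementary_in_tensor_vectors) (auto simp: alternating_Cons set_Cons_iff)
    then show ?thesis
      unfolding e(1) left_action_elementary_other[OF i T e(2) alt e(3)]
      by (rule FV.subspace_add[OF sv FV.subspace_scale[OF sv elementary_in_tensor_vectors[OF e(2,3)]]])
  next
    case True
    define js where "js = tl is"
    have js: "is = i # js" using True by (cases "is") (auto simp: js_def)
    obtain x ys where x: "xs = x # ys" "x \<in> X0 i" "ys \<in> listset (map X0 js)"
      using e js by (auto simp: set_Cons_iff)
    have alt: "i # js \<in> alternating" "js \<in> alternating" using e js by (auto simp: alternating_Cons)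
    have "elementary (i # js) (centred i (T x) # ys) \<in> tensor_vectors"
      using alt c x sub by (intro elementary_in_tensor_vectors) (auto simp: set_Cons_iff)
    then show ?thesis
      unfolding e(1) js x(1) left_action_elementary_same[OF T alt(1) x(3,2)]
      by (rule FV.subspace_add[OF sv FV.subspace_scale[OF sv elementary_in_tensor_vectors[OF alt(2) x(3)]]])
  qed
qed

lemma linear_on_boolean_proj: "linear_on free_scale free_scale U (boolean_proj i)"
  by (auto simp: linear_on_def boolean_proj_def fun_scale_def fun_eq_iff)

lemma boolean_proj_elementary:
  "boolean_proj i (elementary is xs) = (if is = [] \<or> is = [i] then elementary is xs else 0)"
  by (auto simp: boolean_proj_def elementary_def fun_eq_iff)

lemma boolean_proj_in_tensor_vectors:
  assumes w: "w \<in> tensor_vectors"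
  shows "boolean_proj i w \<in> tensor_vectors"
  unfolding tensor_vectors_def
proof (rule linear_on_span_in_subspace[OF FV.vector_space_axioms FV.vector_space_axioms
      linear_on_boolean_proj FV.subspace_span _ w[unfolded tensor_vectors_def]], fold tensor_vectors_def)
  fix e assume "e \<in> elementary_tensors"
  then show "boolean_proj i e \<in> tensor_vectors"
    using FV.subspace_0[OF subspace_tensor_vectors]
    by (auto simp: elementary_tensors_def boolean_proj_elementary intro: elementary_in_tensor_vectors)
qed

text \<open>
  The operator by which \<open>z n k\<close> acts on the free product, with \<open>T n k\<close> for its representation on
  \<open>X n\<close>.
\<close>

definition letter_operator ::
    "'k set \<Rightarrow> ('l \<Rightarrow> 'k \<Rightarrow> 'v \<Rightarrow> 'v) \<Rightarrow> 'l \<times> 'k \<Rightarrow> ('l, 'v) free_vector \<Rightarrow> ('l, 'v) free_vector" where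
  "letter_operator J T = (\<lambda>(n, k).
     if k \<in> J then boolean_proj n \<circ> left_rep n (T n k) \<circ> boolean_proj n else left_rep n (T n k))"

definition word_vector :: "('l \<Rightarrow> 'k \<Rightarrow> 'v \<Rightarrow> 'v) \<Rightarrow> 'l \<Rightarrow> 'k list \<Rightarrow> 'v" where
  "word_vector T n ks = foldr (T n) ks (\<xi> n)"

definition word_moment :: "('l \<Rightarrow> 'k \<Rightarrow> 'v \<Rightarrow> 'v) \<Rightarrow> 'l \<Rightarrow> 'k list \<Rightarrow> complex" where
  "word_moment T n ks = xi_coeff n (word_vector T n ks)"

definition stack_vector :: "('l \<Rightarrow> 'k \<Rightarrow> 'v \<Rightarrow> 'v) \<Rightarrow> ('l \<times> 'k list) list \<Rightarrow> ('l, 'v) free_vector" where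
  "stack_vector T st = elementary (map fst st) (map (\<lambda>(n, ks). centred n (word_vector T n ks)) st)"

definition vacuum_coeff :: "('l, 'v) free_vector \<Rightarrow> complex" where
  "vacuum_coeff w = w [] (\<lambda>_. 1)"

lemma vacuum_coeff_linear:
  "vacuum_coeff (x + y) = vacuum_coeff x + vacuum_coeff y"
  "vacuum_coeff (x - y) = vacuum_coeff x - vacuum_coeff y"
  "vacuum_coeff (free_scale c x) = c * vacuum_coeff x"
  by (simp_all add: vacuum_coeff_def fun_scale_def)

lemma linear_letter_operator:
  assumes n: "n \<in> L" and T: "linear_operator_on s (X n) (T n k)"
  shows "linear_operator_on free_scale tensor_vectors (letter_operator J T (n, k))"
proof -
  have l: "linear_on free_scale free_scale tensor_vectors (left_rep n (T n k))"
    using linear_on_left_action[of tensor_vectors n "T n k"] left_rep_eq_left_action[OF n T]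
      FV.subspace_add[OF subspace_tensor_vectors] FV.subspace_scale[OF subspace_tensor_vectors]
    by (simp add: linear_on_def)
  have m: "left_rep n (T n k) ` tensor_vectors \<subseteq> tensor_vectors"
    using left_rep_eq_left_action[OF n T] left_action_in_tensor_vectors[OF n T] by auto
  have b: "boolean_proj n ` tensor_vectors \<subseteq> tensor_vectors"
    using boolean_proj_in_tensor_vectors by blast
  have "linear_on free_scale free_scale tensor_vectors
      (\<lambda>w. boolean_proj n (left_rep n (T n k) (boolean_proj n w)))"
    by (rule linear_on_compose[OF linear_on_compose[OF linear_on_boolean_proj b l] subset_UNIV
          linear_on_boolean_proj])
  moreover have "boolean_proj n (left_rep n (T n k) (boolean_proj n w)) \<in> tensor_vectors"
    if "w \<in> tensor_vectors" for w
    using that m boolean_proj_in_tensor_vectors by (simp add: image_subset_iff)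
  ultimately have "linear_operator_on free_scale tensor_vectors
      (\<lambda>w. boolean_proj n (left_rep n (T n k) (boolean_proj n w)))"
    by (simp add: linear_operator_on_def image_subset_iff)
  moreover have "linear_operator_on free_scale tensor_vectors (left_rep n (T n k))"
    using l m by (simp add: linear_operator_on_def)
  ultimately show ?thesis
    by (cases "k \<in> J") (simp_all add: letter_operator_def comp_def)
qed

lemma linear_operator_on_foldr:
  assumes "\<And>f. f \<in> set fs \<Longrightarrow> linear_operator_on t V f"
  shows "linear_operator_on t V (foldr (\<circ>) fs id)"
  using assms
proof (induction fs)
  case Nil
  show ?case by (simp add: linear_operator_on_def linear_on_def)
next
  case (Cons f fs)
  then have f: "linear_operator_on t V f" and fs: "linear_operator_on t V (foldr (\<circ>) fs id)"
    by (simp, intro Cons.IH, simp)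
  from f fs have "linear_on t t V (\<lambda>x. f (foldr (\<circ>) fs id x))"
    unfolding linear_operator_on_def by (blast intro: linear_on_compose)
  moreover have "(\<lambda>x. f (foldr (\<circ>) fs id x)) ` V \<subseteq> V"
    using f fs by (simp add: linear_operator_on_def image_subset_iff)
  moreover have "foldr (\<circ>) (f # fs) id = (\<lambda>x. f (foldr (\<circ>) fs id x))"
    by (simp add: fun_eq_iff)
  ultimately show ?case by (simp only: linear_operator_on_def)
qed

context
  fixes J K :: "'k set" and T :: "'l \<Rightarrow> 'k \<Rightarrow> 'v \<Rightarrow> 'v"
  assumes T: "\<And>n k. n \<in> L \<Longrightarrow> k \<in> K \<Longrightarrow> linear_operator_on s (X n) (T n k)"
begin

definition valid_stack :: "('l \<times> 'k list) list \<Rightarrow> bool" where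
  "valid_stack st \<longleftrightarrow> map fst st \<in> alternating \<and> (\<forall>(n, ks)\<in>set st. set ks \<subseteq> K)"

lemma word_vector_in:
  assumes "n \<in> L" "set ks \<subseteq> K"
  shows "word_vector T n ks \<in> X n"
  using assms(2)
  by (induction ks) (use assms(1) T family_subspaces in \<open>auto simp: word_vector_def intro: linear_operatorD(1)\<close>)

lemma stack_entries_in:
  assumes "valid_stack st"
  shows "map (\<lambda>(n, ks). centred n (word_vector T n ks)) st \<in> listset (map X0 (map fst st))"
  using assms
proof (induction st)
  case (Cons e st)
  obtain n ks where e: "e = (n, ks)" by force
  with Cons show ?case
    by (auto simp: valid_stack_def alternating_Cons set_Cons_iff intro: centred_in word_vector_in)
qed simp

lemma stack_vector_in: "valid_stack st \<Longrightarrow> stack_vector T st \<in> tensor_vectors"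
  unfolding stack_vector_def
  by (intro elementary_in_tensor_vectors stack_entries_in) (auto simp: valid_stack_def)

lemma valid_stack_Cons:
  "valid_stack ((n, ks) # st) \<longleftrightarrow>
     n \<in> L \<and> set ks \<subseteq> K \<and> valid_stack st \<and> (st = [] \<or> fst (hd st) \<noteq> n)"
  by (cases st) (auto simp: valid_stack_def alternating_Cons)

lemma left_rep_stack_other:
  assumes n: "n \<in> L" and k: "k \<in> K" and st: "valid_stack st" "st = [] \<or> fst (hd st) \<noteq> n"
  shows "left_rep n (T n k) (stack_vector T st) =
    free_scale (word_moment T n [k]) (stack_vector T st) + stack_vector T ((n, [k]) # st)"
proof -
  have "map fst st \<in> alternating" "map fst st = [] \<or> hd (map fst st) \<noteq> n"
    using st by (cases st; auto simp: valid_stack_def)+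
  from left_action_elementary_other[OF n T[OF n k] this stack_entries_in[OF st(1)]]
  show ?thesis
    unfolding left_rep_eq_left_action[OF n T[OF n k] stack_vector_in[OF st(1)]]
    by (simp add: stack_vector_def word_moment_def word_vector_def)
qed

text \<open>
  The top factor is the centred part of a vector \<open>v\<close>, that is \<open>v\<close> minus a multiple of \<open>\<xi> n\<close>; applying
  \<open>T n k\<close> to both terms expresses the result by the records \<open>k # ks\<close> and \<open>[k]\<close>.
\<close>

lemma left_rep_stack_same:
  assumes k: "k \<in> K" and st: "valid_stack ((n, ks) # st)"
  shows "left_rep n (T n k) (stack_vector T ((n, ks) # st)) =
    free_scale (word_moment T n (k # ks) - word_moment T n [k] * word_moment T n ks) (stack_vector T st)
    + stack_vector T ((n, k # ks) # st) - free_scale (word_moment T n ks) (stack_vector T ((n, [k]) # st))"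
proof -
  have n: "n \<in> L" and ks: "set ks \<subseteq> K" and st': "valid_stack st" "st = [] \<or> fst (hd st) \<noteq> n"
    using st by (auto simp: valid_stack_Cons)
  note sub = family_subspaces[OF n]
  note Tl = T[OF n k]
  define v where "v = word_vector T n ks"
  have v: "v \<in> X n" "T n k v \<in> X n" "T n k (\<xi> n) \<in> X n"
    using n ks sub Tl by (auto simp: v_def intro: word_vector_in linear_operatorD(1)[OF Tl])
  have c: "centred n v \<in> X0 n" using n v by (intro centred_in)
  have alt: "n # map fst st \<in> alternating" using st by (simp add: valid_stack_def)
  note xs = stack_entries_in[OF st'(1)]
  let ?c = "xi_coeff n v"
  have "T n k (centred n v + s ?c (\<xi> n)) = T n k (centred n v) + s ?c (T n k (\<xi> n))"
    using c sub by (auto simp: linear_operatorD[OF Tl] subspace_scale)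
  then have Tc: "T n k (centred n v) = T n k v + s (- ?c) (T n k (\<xi> n))"
    by (simp add: centred_def)
  have sT: "s (- ?c) (T n k (\<xi> n)) \<in> X n" using sub v by (simp only: subspace_scale)
  have co: "xi_coeff n (T n k (centred n v)) =
      word_moment T n (k # ks) - word_moment T n [k] * word_moment T n ks"
    unfolding Tc xi_coeff_add[OF n v(2) sT] xi_coeff_scale[OF n v(3)]
    by (simp add: word_moment_def v_def word_vector_def)
  have ce: "centred n (T n k (centred n v)) =
      centred n (T n k v) + s (- ?c) (centred n (T n k (\<xi> n)))"
    unfolding Tc centred_add[OF n v(2) sT] centred_scale[OF n v(3)] ..
  have mem: "centred n (T n k v) \<in> X0 n" "centred n (T n k (\<xi> n)) \<in> X0 n"
    using n v by (auto intro: centred_in)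
  then have mem3: "s (- ?c) (centred n (T n k (\<xi> n))) \<in> X0 n" using sub by (simp only: subspace_scale)
  have "left_rep n (T n k) (stack_vector T ((n, ks) # st)) =
      free_scale (word_moment T n (k # ks) - word_moment T n [k] * word_moment T n ks) (stack_vector T st) +
      (elementary (n # map fst st)
         (centred n (T n k v) # map (\<lambda>(n, ks). centred n (word_vector T n ks)) st) +
       free_scale (- ?c) (elementary (n # map fst st)
         (centred n (T n k (\<xi> n)) # map (\<lambda>(n, ks). centred n (word_vector T n ks)) st)))"
    unfolding left_rep_eq_left_action[OF n Tl stack_vector_in[OF st]]
    using left_action_elementary_same[OF Tl alt xs c]
    unfolding co ce elementary_add[OF mem(1) mem3 xs] elementary_scale[OF mem(2) xs]
    by (simp add: stack_vector_def v_def)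
  then show ?thesis
    by (simp add: stack_vector_def v_def word_vector_def word_moment_def fun_scale_def fun_eq_iff)
qed

lemma boolean_proj_stack:
  "boolean_proj n (stack_vector T st) =
     (if st = [] \<or> (\<exists>ks. st = [(n, ks)]) then stack_vector T st else 0)"
proof -
  have "map fst st = [n] \<longleftrightarrow> (\<exists>ks. st = [(n, ks)])" by auto
  then show ?thesis by (simp add: stack_vector_def boolean_proj_elementary)
qed

lemma boolean_proj_linear:
  "boolean_proj n (x + y) = boolean_proj n x + boolean_proj n y"
  "boolean_proj n (x - y) = boolean_proj n x - boolean_proj n y"
  "boolean_proj n (free_scale c x) = free_scale c (boolean_proj n x)"
  by (auto simp: boolean_proj_def fun_scale_def fun_eq_iff)

lemma zero_left_rep:
  assumes "n \<in> L" "k \<in> K"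
  shows "left_rep n (T n k) 0 = 0"
  using left_rep_eq_left_action[OF assms(1) T[OF assms] FV.subspace_0[OF subspace_tensor_vectors]]
    linear_on_zero[OF linear_on_left_action[of UNIV]] by simp

lemma letter_operator_Nil:
  assumes "n \<in> L" "k \<in> K"
  shows "letter_operator J T (n, k) (stack_vector T []) =
    free_scale (word_moment T n [k]) (stack_vector T []) + stack_vector T [(n, [k])]"
proof -
  have "valid_stack []" by (simp add: valid_stack_def)
  with left_rep_stack_other[OF assms] show ?thesis
    by (simp add: letter_operator_def boolean_proj_stack boolean_proj_linear)
qed

lemma letter_operator_Cons:
  assumes n: "n \<in> L" and k: "k \<in> K" and st: "valid_stack ((n', ks) # st)"
  shows "letter_operator J T (n, k) (stack_vector T ((n', ks) # st)) =
   (if k \<in> J \<and> (n \<noteq> n' \<or> st \<noteq> []) then 0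
    else if n = n' then
      free_scale (word_moment T n (k # ks) - word_moment T n [k] * word_moment T n ks) (stack_vector T st)
      + stack_vector T ((n, k # ks) # st) - free_scale (word_moment T n ks) (stack_vector T ((n, [k]) # st))
    else free_scale (word_moment T n [k]) (stack_vector T ((n', ks) # st))
      + stack_vector T ((n, [k]) # (n', ks) # st))"
  using left_rep_stack_other[OF n k st] left_rep_stack_same[OF k, of n ks st] st zero_left_rep[OF n k]
  by (auto simp: letter_operator_def boolean_proj_stack boolean_proj_linear
      linear_on_zero[OF linear_on_boolean_proj[of UNIV]])

text \<open>
  Induction on the word from its right end: the last letter is applied to the stack vector, and the
  remaining operators are linear on the resulting combination of stack vectors.
\<close>

lemma vacuum_coeff_word:
  assumes "set r \<subseteq> L \<times> K" "valid_stack st"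
  shows "vacuum_coeff (foldr (\<circ>) (map (letter_operator J T) (rev r)) id (stack_vector T st)) =
    stack_moment J (word_moment T) r st"
  using assms
proof (induction r arbitrary: st)
  case Nil
  then show ?case
    by (cases st) (auto simp: stack_vector_def vacuum_coeff_def elementary_apply)
next
  case (Cons x r)
  obtain n k where x: "x = (n, k)" by force
  have n: "n \<in> L" and k: "k \<in> K" and r: "set r \<subseteq> L \<times> K" using Cons.prems x by auto
  define W where "W = foldr (\<circ>) (map (letter_operator J T) (rev r)) id"
  have "linear_operator_on free_scale tensor_vectors W" unfolding W_def
    using r by (intro linear_operator_on_foldr) (force intro: linear_letter_operator T)
  then have W: "W (x + y) = W x + W y" "W (free_scale c x) = free_scale c (W x)"
    if "x \<in> tensor_vectors" "y \<in> tensor_vectors" for x y c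
    using that by (auto simp: linear_operatorD linear_operator_on_def linear_on_def)
  have W0: "W 0 = 0"
    using W(2)[of 0 0 0] FV.subspace_0[OF subspace_tensor_vectors] by simp
  have step: "foldr (\<circ>) (map (letter_operator J T) (rev ((n, k) # r))) id v = W (letter_operator J T (n, k) v)" for v
  proof -
    have "foldr (\<circ>) (fs @ [f]) id v = foldr (\<circ>) fs id (f v)" for fs :: "('c \<Rightarrow> 'c) list" and f v
      by (induction fs) auto
    from this[of "map (letter_operator J T) (rev r)" "letter_operator J T (n, k)" v] show ?thesis
      by (simp only: W_def rev.simps map_append list.map)
  qed
  note IH = Cons.IH[OF r, folded W_def]
  note sv = FV.subspace_add[OF subspace_tensor_vectors] FV.subspace_scale[OF subspace_tensor_vectors]
  have vac: "vacuum_coeff (W (free_scale a u + v)) = a * vacuum_coeff (W u) + vacuum_coeff (W v)"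
    if "u \<in> tensor_vectors" "v \<in> tensor_vectors" for a u v
    using that sv by (simp add: W vacuum_coeff_linear)
  show ?case
  proof (cases st)
    case Nil
    have v: "valid_stack []" "valid_stack [(n, [k])]"
      using n k by (auto simp: valid_stack_def alternating_Cons)
    show ?thesis
      unfolding x Nil step letter_operator_Nil[OF n k]
      using vac[OF stack_vector_in[OF v(1)] stack_vector_in[OF v(2)]] IH[OF v(1)] IH[OF v(2)] by simp
  next
    case (Cons e st')
    obtain n' ks where e: "e = (n', ks)" by force
    have vst: "valid_stack ((n', ks) # st')" using Cons.prems Cons e by simp
    note lo = letter_operator_Cons[OF n k vst]
    consider (zero) "k \<in> J \<and> (n \<noteq> n' \<or> st' \<noteq> [])" | (same) "\<not> (k \<in> J \<and> (n \<noteq> n' \<or> st' \<noteq> []))" "n = n'"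
      | (other) "\<not> (k \<in> J \<and> (n \<noteq> n' \<or> st' \<noteq> []))" "n \<noteq> n'" by blast
    then show ?thesis
    proof cases
      case zero
      then show ?thesis unfolding x Cons e step using lo W0 by (simp add: vacuum_coeff_def)
    next
      case other
      have v: "valid_stack ((n, [k]) # (n', ks) # st')" using vst other n k by (auto simp: valid_stack_Cons)
      show ?thesis
        unfolding x Cons e step lo
        using other vac[OF stack_vector_in[OF vst] stack_vector_in[OF v]] IH[OF vst] IH[OF v] by simp
    next
      case same
      have v: "valid_stack st'" "valid_stack ((n, k # ks) # st')" "valid_stack ((n, [k]) # st')"
        using vst same k by (auto simp: valid_stack_Cons)
      let ?a = "word_moment T n (k # ks) - word_moment T n [k] * word_moment T n ks"
      have "letter_operator J T (n, k) (stack_vector T ((n', ks) # st')) =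
        free_scale ?a (stack_vector T st') + (free_scale (- word_moment T n ks) (stack_vector T ((n, [k]) # st'))
          + stack_vector T ((n, k # ks) # st'))"
        unfolding lo if_not_P[OF same(1)] if_P[OF same(2)] by (simp add: fun_scale_def fun_eq_iff)
      then have "vacuum_coeff (W (letter_operator J T (n, k) (stack_vector T ((n', ks) # st')))) =
          ?a * vacuum_coeff (W (stack_vector T st')) +
          (- word_moment T n ks * vacuum_coeff (W (stack_vector T ((n, [k]) # st'))) +
           vacuum_coeff (W (stack_vector T ((n, k # ks) # st'))))"
        by (simp only: vac stack_vector_in[OF v(1)] stack_vector_in[OF v(2)] stack_vector_in[OF v(3)] sv)
      moreover have "stack_moment J (word_moment T) ((n, k) # r) ((n', ks) # st') =
          ?a * stack_moment J (word_moment T) r st' + stack_moment J (word_moment T) r ((n, k # ks) # st')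
          - word_moment T n ks * stack_moment J (word_moment T) r ((n, [k]) # st')"
        by (simp only: stack_moment.simps if_not_P[OF same(1)] if_P[OF same(2)])
      ultimately show ?thesis
        unfolding x Cons e step IH[OF v(1)] IH[OF v(2)] IH[OF v(3)]
        by (simp only:) (simp add: algebra_simps)
    qed
  qed
qed

text \<open>
  The component at the empty sequence is one-dimensional, so that subtracting \<open>c\<close> times the vacuum
  from \<open>w\<close> lands in \<open>free_space0\<close> exactly when \<open>c\<close> is the vacuum coefficient of \<open>w\<close>.
\<close>

lemma vector_state_word:
  assumes "set r \<subseteq> L \<times> K"
  shows "vector_state free_scale free_space0 free_xi (foldr (\<circ>) (map (letter_operator J T) (rev r)) id) =
    stack_moment J (word_moment T) r []"
proof -
  let ?W = "foldr (\<circ>) (map (letter_operator J T) (rev r)) id"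
  have v: "valid_stack []" by (simp add: valid_stack_def)
  have xi: "free_xi = stack_vector T []" by (simp add: free_xi_def stack_vector_def)
  have W: "linear_operator_on free_scale tensor_vectors ?W"
    using assms by (intro linear_operator_on_foldr) (force intro: linear_letter_operator T)
  have sub: "tensor_vectors \<subseteq> free_space"
    unfolding tensor_vectors_def
    by (rule FV.span_minimal[OF _ subspace_free_space])
      (auto simp: elementary_tensors_def intro: elementary_in_free_space)
  have xt: "free_xi \<in> tensor_vectors" using stack_vector_in[OF v] xi by simp
  have Wt: "?W free_xi \<in> tensor_vectors" using linear_operatorD(1) W xt
    by (auto simp: linear_operator_on_def)
  have xi_nil: "free_xi [] F = F []" for F by (simp add: free_xi_def elementary_apply)
  have iff: "w - free_scale c free_xi \<in> free_space0 \<longleftrightarrow> c = vacuum_coeff w" if w: "w \<in> tensor_vectors" for w c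
  proof -
    interpret T: vector_space "fun_scale ((*) :: complex \<Rightarrow> _) :: complex \<Rightarrow> (('v list \<Rightarrow> complex) \<Rightarrow> complex) \<Rightarrow> _"
      by (intro vector_space_fun_scale vector_space_complex)
    have "w - free_scale c free_xi \<in> free_space"
      using w xt sub by (intro FV.subspace_diff[OF subspace_free_space] FV.subspace_scale[OF subspace_free_space]) auto
    then have "w - free_scale c free_xi \<in> free_space0 \<longleftrightarrow> (w - free_scale c free_xi) [] = 0"
      by (simp add: free_space0_def)
    also have "\<dots> \<longleftrightarrow> c = vacuum_coeff w"
    proof
      assume "(w - free_scale c free_xi) [] = 0"
      then have "(w - free_scale c free_xi) [] (\<lambda>_. 1) = 0" by simp
      then show "c = vacuum_coeff w" by (simp add: fun_scale_def xi_nil vacuum_coeff_def)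
    next
      assume c: "c = vacuum_coeff w"
      have "\<forall>is\<in>alternating. w is \<in> list_tensor_space s (map X0 is)"
        using w sub by (auto simp: free_space_def)
      from bspec[OF this alternating_Nil] have wN: "w [] \<in> list_tensor_space s []" by simp
      have key: "w [] F = F [] * w [] (\<lambda>_. 1)" for F
        using list_tensor_space_combination[OF vector_space_axioms wN, of "\<lambda>_. 1" "\<lambda>_. 1" F "F []" 0]
        by simp
      have "w [] F - w [] (\<lambda>_. 1) * F [] = 0" for F
        using key[of F] by (metis eq_iff_diff_eq_0 mult.commute)
      moreover have "(w - free_scale c free_xi) [] F = w [] F - w [] (\<lambda>_. 1) * F []" for F
        by (simp add: c fun_scale_def xi_nil vacuum_coeff_def)
      ultimately have "(w - free_scale c free_xi) [] F = 0 F" for F by (simp only: zero_fun_apply)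
      then show "(w - free_scale c free_xi) [] = 0" by (rule ext)
    qed
    finally show ?thesis .
  qed
  have "vector_state free_scale free_space0 free_xi ?W = vacuum_coeff (?W free_xi)"
    unfolding vector_state_def using iff[OF Wt] by simp
  also have "\<dots> = stack_moment J (word_moment T) r []"
    unfolding xi by (rule vacuum_coeff_word[OF assms v])
  finally show ?thesis .
qed

end

end

section \<open>Stack moments and pairing moments\<close>

text \<open>
  The analogue of \<open>stack_moment\<close> for centred variables and records of a single letter: a letter \<open>k\<close> is pushed
  onto the stack, or removes the top letter \<open>l\<close> with weight \<open>W k l\<close>. As before, the first argument
  lists the word in reverse, and a letter with \<open>circ\<close> may be pushed only onto the empty stack and may
  remove only the last remaining letter.
\<close>

fun pairing_moment :: "('x \<Rightarrow> bool) \<Rightarrow> ('x \<Rightarrow> 'x \<Rightarrow> complex) \<Rightarrow> 'x list \<Rightarrow> 'x list \<Rightarrow> complex" where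
  "pairing_moment circ W [] st = (if st = [] then 1 else 0)"
| "pairing_moment circ W (k # r) [] = pairing_moment circ W r [k]"
| "pairing_moment circ W (k # r) (l # st) =
     (if circ k then 0 else pairing_moment circ W r (k # l # st)) +
     (if circ k \<and> st \<noteq> [] then 0 else W k l * pairing_moment circ W r st)"

text \<open>
  For a single colour the vacuum and one record span an invariant subspace, on which the vector
  \<open>m n ks\<close> times the vacuum plus the record \<open>ks\<close> represents the word \<open>ks\<close>.
\<close>

lemma stack_moment_same_colour:
  "m n ks * stack_moment J m (map (Pair n) r) [] + stack_moment J m (map (Pair n) r) [(n, ks)] =
   m n (rev r @ ks)"
proof (induction r arbitrary: ks)
  case (Cons k r)
  show ?case using Cons.IH[of "k # ks"] by (simp add: algebra_simps)
qed simp

text \<open>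
  This identifies the coordinates \<open>m n ks\<close> of the representing vectors with moments of the original
  variables: both compute the vacuum expectation of a one-coloured word.
\<close>

lemma stack_moment_single_colour:
  assumes "m n [] = 1"
  shows "stack_moment J m (map (Pair n) r) [] = m n (rev r)"
proof (cases r)
  case Nil
  then show ?thesis using assms by simp
next
  case (Cons k r')
  then show ?thesis using stack_moment_same_colour[of m n "[k]" J r'] by simp
qed

text \<open>
  Only a letter of its own colour can remove a record from the stack, and the stack has to be empty
  at the end.
\<close>

lemma stack_moment_unclosed:
  assumes "n \<in> fst ` set st" "n \<notin> fst ` set r"
  shows "stack_moment J m r st = 0"
  using assms
proof (induction J m r st rule: stack_moment.induct)
  case (3 J m n1 k r n' ks st)
  then show ?case by auto
qed auto

text \<open>
  A letter whose colour is unique acts either by its mean, which is zero, or by leaving a record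
  that cannot be removed later.
\<close>

lemma stack_moment_singleton:
  assumes "\<And>x. x \<in> set r \<Longrightarrow> m (fst x) [snd x] = 0"
    and "count_list (map fst r) n = 1" "n \<notin> fst ` set st"
  shows "stack_moment J m r st = 0"
  using assms
proof (induction J m r st rule: stack_moment.induct)
  case (2 J m n1 k r)
  have m0: "m n1 [k] = 0" using "2.prems"(1)[of "(n1, k)"] by simp
  show ?case
  proof (cases "n1 = n")
    case True
    then have "count_list (map fst r) n = 0" using 2 by simp
    then have "stack_moment J m r [(n1, [k])] = 0"
      using True by (intro stack_moment_unclosed[of n]) (auto simp: count_list_0_iff)
    then show ?thesis using m0 by simp
  next
    case False
    then show ?thesis using 2 m0 by simp
  qed
next
  case (3 J m n1 k r n' ks st)
  have m0: "m n1 [k] = 0" using "3.prems"(1)[of "(n1, k)"] by simp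
  show ?case
  proof (cases "n1 = n")
    case True
    then have "count_list (map fst r) n = 0" using 3 by simp
    then have "stack_moment J m r ((n1, [k]) # (n', ks) # st) = 0"
      using True by (intro stack_moment_unclosed[of n]) (auto simp: count_list_0_iff)
    then show ?thesis using m0 True 3 by auto
  next
    case False
    then show ?thesis using 3 m0 by auto
  qed
qed simp

text \<open>
  Weights under which only letters of equal colour can be paired.
\<close>

definition coloured :: "('n \<Rightarrow> 'k \<Rightarrow> 'k \<Rightarrow> complex) \<Rightarrow> 'n \<times> 'k \<Rightarrow> 'n \<times> 'k \<Rightarrow> complex" where
  "coloured c = (\<lambda>(n, k) (n', l). if n = n' then c n k l else 0)"

lemma pairing_moment_unclosed:
  assumes "n \<in> fst ` set st" "n \<notin> fst ` set r"
  shows "pairing_moment circ (coloured c) r st = 0"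
  using assms
proof (induction circ "coloured c" r st rule: pairing_moment.induct)
  case (3 circ x r y st)
  then show ?case by (cases "n \<in> fst ` set st") (auto simp: coloured_def split: prod.splits)
qed auto

lemma pairing_moment_singleton:
  assumes "count_list (map fst r) n = 1" "n \<notin> fst ` set st"
  shows "pairing_moment circ (coloured c) r st = 0"
  using assms
proof (induction circ "coloured c" r st rule: pairing_moment.induct)
  case (2 circ x r)
  show ?case
  proof (cases "fst x = n")
    case True
    then have "count_list (map fst r) n = 0" using 2 by simp
    then show ?thesis
      using True by (simp, intro pairing_moment_unclosed[of n]) (auto simp: count_list_0_iff)
  qed (use 2 in auto)
next
  case (3 circ x r y st)
  show ?case
  proof (cases "fst x = n")
    case True
    then have "count_list (map fst r) n = 0" using 3 by simp
    then have "pairing_moment circ (coloured c) r (x # y # st) = 0"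
      using True by (intro pairing_moment_unclosed[of n]) (auto simp: count_list_0_iff)
    moreover have "coloured c x y = 0" using True 3 by (auto simp: coloured_def split: prod.splits)
    ultimately show ?thesis by simp
  qed (use 3 in auto)
qed simp

text \<open>
  When a letter meets a record of its own colour, both occurrences of that colour are used up. So
  prolonging the record, or pushing a second one, leaves something that is never removed, and only
  the removal contributes.
\<close>

lemma stack_moment_eq_pairing_moment:
  assumes "\<And>x. x \<in> set r \<union> set st \<Longrightarrow> m (fst x) [snd x] = 0"
    and "\<And>n. count_list (map fst r) n + count_list (map fst st) n \<le> 2"
  shows "stack_moment J m r (map (\<lambda>(n, k). (n, [k])) st) =
    pairing_moment (\<lambda>x. snd x \<in> J) (coloured (\<lambda>n k l. m n [k, l])) r st"
  using assms
proof (induction r arbitrary: st)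
  case Nil
  show ?case by simp
next
  case (Cons x r)
  obtain n k where x: "x = (n, k)" by force
  have m0: "m n [k] = 0" using Cons.prems(1)[of x] x by simp
  let ?S = "\<lambda>st. map (\<lambda>(n, k). (n, [k])) st"
  let ?P = "pairing_moment (\<lambda>x. snd x \<in> J) (coloured (\<lambda>n k l. m n [k, l]))"
  have push: "stack_moment J m r (?S (x # st)) = ?P r (x # st)"
  proof (rule Cons.IH)
    show "m (fst z) [snd z] = 0" if "z \<in> set r \<union> set (x # st)" for z
      using Cons.prems(1)[of z] that by auto
    show "count_list (map fst r) n + count_list (map fst (x # st)) n \<le> 2" for n
      using Cons.prems(2)[of n] by (auto split: if_splits)
  qed
  show ?case
  proof (cases st)
    case Nil
    then show ?thesis using push x m0 by simp
  next
    case (Cons y st')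
    obtain n' l where y: "y = (n', l)" by force
    have ml: "m n' [l] = 0" using Cons.prems(1)[of y] Cons y by simp
    have pop: "stack_moment J m r (?S st') = ?P r st'"
    proof (rule Cons.IH)
      show "m (fst z) [snd z] = 0" if "z \<in> set r \<union> set st'" for z
        using Cons.prems(1)[of z] that Cons by auto
      show "count_list (map fst r) n + count_list (map fst st') n \<le> 2" for n
        using Cons.prems(2)[of n] Cons by (auto split: if_splits)
    qed
    show ?thesis
    proof (cases "n = n'")
      case True
      have "count_list (map fst r) n = 0"
        using Cons.prems(2)[of n] x y Cons True by simp
      then have notin: "n \<notin> fst ` set r" by (auto simp: count_list_0_iff)
      have "stack_moment J m r ((n, [k, l]) # ?S st') = 0"
        by (rule stack_moment_unclosed[OF _ notin]) simp
      moreover have "?P r (x # st) = 0"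
        using x by (intro pairing_moment_unclosed[OF _ notin]) simp
      ultimately show ?thesis
        using pop True m0 ml x y Cons by (auto simp: coloured_def)
    next
      case False
      then show ?thesis using push m0 x y Cons by (auto simp: coloured_def)
    qed
  qed
qed

text \<open>
  With the labels of the letters fixed, the recursion involves only finitely many moments per
  colouring, each of which is bounded uniformly in the colour.
\<close>

lemma stack_moment_bounded:
  fixes m :: "'n \<Rightarrow> 'k list \<Rightarrow> complex"
  assumes bd: "\<And>ks. ks \<noteq> [] \<Longrightarrow> set ks \<subseteq> K \<Longrightarrow> \<exists>D. \<forall>n\<in>L. cmod (m n ks) \<le> D"
    and "set ks \<subseteq> K" "\<forall>js\<in>set kss. js \<noteq> [] \<and> set js \<subseteq> K"
  shows "\<exists>B. \<forall>r st. map snd r = ks \<longrightarrow> map snd st = kss \<longrightarrow> fst ` set r \<union> fst ` set st \<subseteq> L \<longrightarrow>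
    cmod (stack_moment J m r st) \<le> B"
  using assms(2,3)
proof (induction ks arbitrary: kss)
  case Nil
  show ?case by (rule exI[of _ 1]) simp
next
  case (Cons k ks)
  have IH: "\<exists>B. \<forall>r st. map snd r = ks \<longrightarrow> map snd st = kss' \<longrightarrow> fst ` set r \<union> fst ` set st \<subseteq> L \<longrightarrow>
    cmod (stack_moment J m r st) \<le> B" if "\<forall>js\<in>set kss'. js \<noteq> [] \<and> set js \<subseteq> K" for kss'
    using Cons that by simp
  have k: "k \<in> K" using Cons by simp
  obtain Dk where Dk: "\<And>n. n \<in> L \<Longrightarrow> cmod (m n [k]) \<le> Dk" using bd[of "[k]"] k by auto
  obtain B1 where B1: "\<And>r st. map snd r = ks \<Longrightarrow> map snd st = kss \<Longrightarrow> fst ` set r \<union> fst ` set st \<subseteq> L \<Longrightarrow>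
    cmod (stack_moment J m r st) \<le> B1" using IH[OF Cons.prems(2)] by blast
  have c2: "\<forall>js\<in>set ([k] # kss). js \<noteq> [] \<and> set js \<subseteq> K" using Cons.prems k by auto
  obtain B2 where B2: "\<And>r st. map snd r = ks \<Longrightarrow> map snd st = [k] # kss \<Longrightarrow> fst ` set r \<union> fst ` set st \<subseteq> L \<Longrightarrow>
    cmod (stack_moment J m r st) \<le> B2" using IH[OF c2] by blast
  show ?case
  proof (cases kss)
    case Nil
    show ?thesis
    proof (intro exI[of _ "Dk * B1 + B2"] allI impI)
      fix r st
      assume r: "map snd r = k # ks" "map snd st = kss" "fst ` set r \<union> fst ` set st \<subseteq> (L :: 'n set)"
      obtain n r' where r': "r = (n, k) # r'" "map snd r' = ks" using r(1) by (cases r) auto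
      have st: "st = []" using r Nil by simp
      have n: "n \<in> L" and L: "fst ` set r' \<subseteq> L" using r r' by auto
      have "cmod (stack_moment J m r st) \<le> cmod (m n [k]) * cmod (stack_moment J m r' []) +
          cmod (stack_moment J m r' [(n, [k])])"
        unfolding r' st by (simp add: norm_triangle_le norm_mult)
      also have "\<dots> \<le> Dk * B1 + B2"
        using n L r' Dk[OF n] B1[of r' "[]"] B2[of r' "[(n, [k])]"] Nil
        by (intro add_mono mult_mono) (auto intro: order_trans[OF norm_ge_zero])
      finally show "cmod (stack_moment J m r st) \<le> Dk * B1 + B2" .
    qed
  next
    case kss: (Cons js kss')
    have js: "js \<noteq> []" "set js \<subseteq> K" and kss': "\<forall>js\<in>set kss'. js \<noteq> [] \<and> set js \<subseteq> K"
      using Cons.prems kss by auto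
    obtain Dj where Dj: "\<And>n. n \<in> L \<Longrightarrow> cmod (m n js) \<le> Dj" using bd[of js] js by auto
    obtain Dkj where Dkj: "\<And>n. n \<in> L \<Longrightarrow> cmod (m n (k # js)) \<le> Dkj" using bd[of "k # js"] js k by auto
    obtain B3 where B3: "\<And>r st. map snd r = ks \<Longrightarrow> map snd st = kss' \<Longrightarrow> fst ` set r \<union> fst ` set st \<subseteq> L \<Longrightarrow>
      cmod (stack_moment J m r st) \<le> B3" using IH[OF kss'] by blast
    have c4: "\<forall>js\<in>set ((k # js) # kss'). js \<noteq> [] \<and> set js \<subseteq> K"
      and c5: "\<forall>js\<in>set ([k] # kss'). js \<noteq> [] \<and> set js \<subseteq> K" using kss' js k by auto
    obtain B4 where B4: "\<And>r st. map snd r = ks \<Longrightarrow> map snd st = (k # js) # kss' \<Longrightarrow>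
      fst ` set r \<union> fst ` set st \<subseteq> L \<Longrightarrow> cmod (stack_moment J m r st) \<le> B4"
      using IH[OF c4] by blast
    obtain B5 where B5: "\<And>r st. map snd r = ks \<Longrightarrow> map snd st = [k] # kss' \<Longrightarrow>
      fst ` set r \<union> fst ` set st \<subseteq> L \<Longrightarrow> cmod (stack_moment J m r st) \<le> B5"
      using IH[OF c5] by blast
    let ?A = "(Dkj + Dk * Dj) * B3 + B4 + Dj * B5" and ?B = "Dk * B1 + B2"
    show ?thesis
    proof (intro exI[of _ "max 0 (max ?A ?B)"] allI impI)
      fix r st
      assume r: "map snd r = k # ks" "map snd st = kss" "fst ` set r \<union> fst ` set st \<subseteq> (L :: 'n set)"
      obtain n r' where r': "r = (n, k) # r'" "map snd r' = ks" using r(1) by (cases r) auto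
      obtain n' st' where st': "st = (n', js) # st'" "map snd st' = kss'" using r(2) kss by (cases st) auto
      have L: "n \<in> L" "n' \<in> L" "fst ` set r' \<subseteq> L" "fst ` set st' \<subseteq> L" using r r' st' by auto
      consider (zero) "k \<in> J \<and> (n \<noteq> n' \<or> st' \<noteq> [])" | (same) "\<not> (k \<in> J \<and> (n \<noteq> n' \<or> st' \<noteq> []))" "n = n'"
        | (other) "\<not> (k \<in> J \<and> (n \<noteq> n' \<or> st' \<noteq> []))" "n \<noteq> n'" by blast
      then show "cmod (stack_moment J m r st) \<le> max 0 (max ?A ?B)"
      proof cases
        case zero
        then show ?thesis by (simp add: r' st')
      next
        case other
        have "stack_moment J m r st = m n [k] * stack_moment J m r' st + stack_moment J m r' ((n, [k]) # st)"
          unfolding r' st' stack_moment.simps if_not_P[OF other(1)] if_not_P[OF other(2)] ..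
        then have "cmod (stack_moment J m r st) \<le> cmod (m n [k]) * cmod (stack_moment J m r' st) +
            cmod (stack_moment J m r' ((n, [k]) # st))"
          by (simp add: norm_triangle_le norm_mult)
        also have "\<dots> \<le> ?B"
          using L r r' Dk[of n] B1[of r' st] B2[of r' "(n, [k]) # st"]
          by (intro add_mono mult_mono) (auto intro: order_trans[OF norm_ge_zero])
        finally show ?thesis by linarith
      next
        case same
        have "stack_moment J m r st = (m n (k # js) - m n [k] * m n js) * stack_moment J m r' st' +
            stack_moment J m r' ((n, k # js) # st') - m n js * stack_moment J m r' ((n, [k]) # st')"
          unfolding r' st' stack_moment.simps if_not_P[OF same(1)] if_P[OF same(2)] ..
        then have "cmod (stack_moment J m r st) \<le>
            cmod (m n (k # js) - m n [k] * m n js) * cmod (stack_moment J m r' st') +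
            cmod (stack_moment J m r' ((n, k # js) # st')) +
            cmod (m n js) * cmod (stack_moment J m r' ((n, [k]) # st'))"
          using norm_triangle_ineq4[of "(m n (k # js) - m n [k] * m n js) * stack_moment J m r' st' +
              stack_moment J m r' ((n, k # js) # st')" "m n js * stack_moment J m r' ((n, [k]) # st')"]
            norm_triangle_ineq[of "(m n (k # js) - m n [k] * m n js) * stack_moment J m r' st'"
              "stack_moment J m r' ((n, k # js) # st')"]
          by (simp add: norm_mult)
        also have "\<dots> \<le> ?A"
        proof -
          have "cmod (m n (k # js) - m n [k] * m n js) \<le> cmod (m n (k # js)) + cmod (m n [k]) * cmod (m n js)"
            by (metis norm_mult norm_triangle_ineq4)
          also have "\<dots> \<le> Dkj + Dk * Dj"
            using L Dk[of n] Dj[of n] Dkj[of n] order_trans[OF norm_ge_zero, of "m n [k]" Dk]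
            by (intro add_mono mult_mono) auto
          finally have 1: "cmod (m n (k # js) - m n [k] * m n js) \<le> Dkj + Dk * Dj" .
          have 3: "cmod (stack_moment J m r' st') \<le> B3" using B3[of r' st'] L r' st' by simp
          have 4: "cmod (stack_moment J m r' ((n, k # js) # st')) \<le> B4"
            using B4[of r' "(n, k # js) # st'"] L r' st' by simp
          have 5: "cmod (stack_moment J m r' ((n, [k]) # st')) \<le> B5"
            using B5[of r' "(n, [k]) # st'"] L r' st' by simp
          have 6: "cmod (m n js) \<le> Dj" using Dj L by simp
          show ?thesis
            using order_trans[OF norm_ge_zero 1] order_trans[OF norm_ge_zero 6]
            by (intro add_mono mult_mono 1 3 4 5 6) auto
        qed
        finally have "cmod (stack_moment J m r st) \<le> ?A" .
        then show ?thesis by linarith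
      qed
    qed
  qed
qed

lemma pairing_moment_bounded:
  fixes c :: "'n \<Rightarrow> 'k \<Rightarrow> 'k \<Rightarrow> complex"
  assumes bd: "\<And>k l. k \<in> K \<Longrightarrow> l \<in> K \<Longrightarrow> \<exists>D. \<forall>n\<in>L. cmod (c n k l) \<le> D"
    and "set ks \<subseteq> K" "set ls \<subseteq> K"
  shows "\<exists>B. \<forall>r st. map snd r = ks \<longrightarrow> map snd st = ls \<longrightarrow> fst ` set r \<union> fst ` set st \<subseteq> L \<longrightarrow>
    cmod (pairing_moment circ (coloured c) r st) \<le> B"
  using assms(2,3)
proof (induction ks arbitrary: ls)
  case Nil
  show ?case by (rule exI[of _ 1]) simp
next
  case (Cons k ks)
  have IH: "\<exists>B. \<forall>r st. map snd r = ks \<longrightarrow> map snd st = ls' \<longrightarrow> fst ` set r \<union> fst ` set st \<subseteq> L \<longrightarrow>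
    cmod (pairing_moment circ (coloured c) r st) \<le> B" if "set ls' \<subseteq> K" for ls'
    using Cons that by simp
  have k: "k \<in> K" using Cons by simp
  have c1: "set (k # ls) \<subseteq> K" using Cons.prems by auto
  obtain B1 where B1: "\<And>r st. map snd r = ks \<Longrightarrow> map snd st = k # ls \<Longrightarrow> fst ` set r \<union> fst ` set st \<subseteq> L \<Longrightarrow>
    cmod (pairing_moment circ (coloured c) r st) \<le> B1" using IH[OF c1] by blast
  show ?case
  proof (cases ls)
    case Nil
    show ?thesis
    proof (intro exI[of _ B1] allI impI)
      fix r st
      assume r: "map snd r = k # ks" "map snd st = ls" "fst ` set r \<union> fst ` set st \<subseteq> (L :: 'n set)"
      then obtain n r' where r': "r = (n, k) # r'" "map snd r' = ks" by (cases r) auto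
      show "cmod (pairing_moment circ (coloured c) r st) \<le> B1"
        using B1[of r' "[(n, k)]"] r r' Nil by simp
    qed
  next
    case ls: (Cons l ls')
    have l: "l \<in> K" "set ls' \<subseteq> K" using Cons.prems ls by auto
    obtain D where D: "\<And>n. n \<in> L \<Longrightarrow> cmod (c n k l) \<le> D" using bd[OF k l(1)] by auto
    obtain B2 where B2: "\<And>r st. map snd r = ks \<Longrightarrow> map snd st = ls' \<Longrightarrow> fst ` set r \<union> fst ` set st \<subseteq> L \<Longrightarrow>
      cmod (pairing_moment circ (coloured c) r st) \<le> B2" using IH[OF l(2)] by blast
    show ?thesis
    proof (intro exI[of _ "B1 + D * B2"] allI impI)
      fix r st
      assume r: "map snd r = k # ks" "map snd st = ls" "fst ` set r \<union> fst ` set st \<subseteq> (L :: 'n set)"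
      obtain n r' where r': "r = (n, k) # r'" "map snd r' = ks" using r(1) by (cases r) auto
      obtain n' st' where st': "st = (n', l) # st'" "map snd st' = ls'" using r(2) ls by (cases st) auto
      have L: "n \<in> L" "n' \<in> L" "fst ` set r' \<subseteq> L" "fst ` set st' \<subseteq> L" using r r' st' by auto
      have b1: "cmod (pairing_moment circ (coloured c) r' ((n, k) # (n', l) # st')) \<le> B1"
        using B1[of r' "(n, k) # st"] r' st' L ls by simp
      have b2: "cmod (pairing_moment circ (coloured c) r' st') \<le> B2" using B2[of r' st'] r' st' L by simp
      have d: "cmod (coloured c (n, k) (n', l)) \<le> D"
        using D[OF L(1)] order_trans[OF norm_ge_zero D[OF L(1)]] by (auto simp: coloured_def)
      have B0: "0 \<le> B1" "0 \<le> D * B2"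
        using order_trans[OF norm_ge_zero b1] order_trans[OF norm_ge_zero b2] order_trans[OF norm_ge_zero d]
        by auto
      have p: "cmod (coloured c (n, k) (n', l) * pairing_moment circ (coloured c) r' st') \<le> D * B2"
        unfolding norm_mult using b2 d B0 order_trans[OF norm_ge_zero d] by (intro mult_mono) auto
      show "cmod (pairing_moment circ (coloured c) r st) \<le> B1 + D * B2"
        unfolding r' st' pairing_moment.simps
        by (intro norm_triangle_le add_mono) (use b1 p B0 in auto)
    qed
  qed
qed

section \<open>The limit of the summed stack moments\<close>

definition colourings :: "nat \<Rightarrow> nat \<Rightarrow> nat list set" where
  "colourings N d = {ns. set ns \<subseteq> {1..N} \<and> length ns = d}"

lemma finite_colourings: "finite (colourings N d)"
  unfolding colourings_def by (rule finite_lists_length_eq) simp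

lemma colourings_0 [simp]: "colourings N 0 = {[]}"
  by (auto simp: colourings_def)

lemma sum_colourings_Suc:
  "(\<Sum>ns\<in>colourings N (Suc d). f ns) = (\<Sum>n=1..N. \<Sum>ns\<in>colourings N d. f (n # ns))"
proof -
  have "colourings N (Suc d) = (\<lambda>(n, ns). n # ns) ` ({1..N} \<times> colourings N d)"
    by (auto simp: colourings_def length_Suc_conv image_iff)
  moreover have "inj_on (\<lambda>(n, ns). n # ns) ({1..N} \<times> colourings N d)"
    by (auto simp: inj_on_def)
  ultimately have "(\<Sum>ns\<in>colourings N (Suc d). f ns) =
      (\<Sum>p\<in>{1..N} \<times> colourings N d. f (fst p # snd p))"
    by (simp add: sum.reindex case_prod_unfold)
  then show ?thesis by (simp add: sum.cartesian_product case_prod_unfold)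
qed

text \<open>
  Since the weight of a pair vanishes unless its colours agree, the sum over the colour of a letter
  that is removed collapses to the summed weight. The stack is coloured as well, because the colour of a
  pushed letter is summed together with those of the stack.
\<close>

lemma sum_colourings_pairing_moment:
  "(\<Sum>ns\<in>colourings N (length r). \<Sum>ms\<in>colourings N (length st).
      pairing_moment (\<lambda>x. snd x \<in> J) (coloured c) (zip ns r) (zip ms st)) =
   pairing_moment (\<lambda>k. k \<in> J) (\<lambda>k l. \<Sum>n=1..N. c n k l) r st"
proof (induction r arbitrary: st)
  case Nil
  have "(\<Sum>ms\<in>colourings N (length st). pairing_moment (\<lambda>x. snd x \<in> J) (coloured c) [] (zip ms st)) =
      (if st = [] then 1 else 0)"
  proof (cases st)
    case (Cons l st')
    have "pairing_moment (\<lambda>x. snd x \<in> J) (coloured c) [] (zip ms st) = 0"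
      if "ms \<in> colourings N (length st)" for ms
      using that Cons by (cases ms) (auto simp: colourings_def)
    then show ?thesis using Cons by (simp del: pairing_moment.simps)
  qed simp
  then show ?case by simp
next
  case (Cons k r)
  let ?P = "pairing_moment (\<lambda>x. snd x \<in> J) (coloured c)"
  let ?W = "\<lambda>k l. \<Sum>n=1..N. c n k l"
  have push: "(\<Sum>n=1..N. \<Sum>ns\<in>colourings N (length r). \<Sum>ms\<in>colourings N (length st).
      ?P (zip ns r) ((n, k) # zip ms st)) = pairing_moment (\<lambda>k. k \<in> J) ?W r (k # st)"
  proof -
    have "(\<Sum>n=1..N. \<Sum>ns\<in>colourings N (length r). \<Sum>ms\<in>colourings N (length st).
        ?P (zip ns r) ((n, k) # zip ms st)) =
      (\<Sum>ns\<in>colourings N (length r). \<Sum>n=1..N. \<Sum>ms\<in>colourings N (length st).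
        ?P (zip ns r) (zip (n # ms) (k # st)))"
      by (subst sum.swap) simp
    also have "\<dots> = pairing_moment (\<lambda>k. k \<in> J) ?W r (k # st)"
      using Cons.IH[of "k # st"] by (simp add: sum_colourings_Suc)
    finally show ?thesis .
  qed
  show ?case
  proof (cases st)
    case Nil
    then show ?thesis using push by (simp add: sum_colourings_Suc)
  next
    case st: (Cons l st')
    let ?A = "colourings N (length r)" and ?B = "colourings N (length st')"
    have pop: "(\<Sum>n=1..N. \<Sum>ns\<in>?A. \<Sum>n'=1..N. \<Sum>ms\<in>?B.
        coloured c (n, k) (n', l) * ?P (zip ns r) (zip ms st')) =
      ?W k l * pairing_moment (\<lambda>k. k \<in> J) ?W r st'"
    proof -
      have "(\<Sum>n'=1..N. \<Sum>ms\<in>?B. coloured c (n, k) (n', l) * ?P (zip ns r) (zip ms st')) =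
          (\<Sum>n'=1..N. if n = n' then c n k l * (\<Sum>ms\<in>?B. ?P (zip ns r) (zip ms st')) else 0)" for n ns
        by (intro sum.cong refl) (auto simp: coloured_def sum_distrib_left)
      then have "(\<Sum>n=1..N. \<Sum>ns\<in>?A. \<Sum>n'=1..N. \<Sum>ms\<in>?B.
          coloured c (n, k) (n', l) * ?P (zip ns r) (zip ms st')) =
        (\<Sum>n=1..N. \<Sum>ns\<in>?A. c n k l * (\<Sum>ms\<in>?B. ?P (zip ns r) (zip ms st')))"
        by (intro sum.cong refl) simp
      also have "\<dots> = ?W k l * (\<Sum>ns\<in>?A. \<Sum>ms\<in>?B. ?P (zip ns r) (zip ms st'))"
        by (simp flip: sum_distrib_left sum_distrib_right)
      finally show ?thesis using Cons.IH by simp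
    qed
    have "(\<Sum>ns\<in>colourings N (length (k # r)). \<Sum>ms\<in>colourings N (length st).
        ?P (zip ns (k # r)) (zip ms st)) =
      (\<Sum>n=1..N. \<Sum>ns\<in>?A. \<Sum>n'=1..N. \<Sum>ms\<in>?B.
        (if k \<in> J then 0 else ?P (zip ns r) ((n, k) # zip (n' # ms) st)) +
        (if k \<in> J \<and> st' \<noteq> [] then 0 else coloured c (n, k) (n', l) * ?P (zip ns r) (zip ms st')))"
    proof -
      have *: "?P ((n, k) # zip ns r) ((n', l) # zip ms st') =
          (if k \<in> J then 0 else ?P (zip ns r) ((n, k) # zip (n' # ms) st)) +
          (if k \<in> J \<and> st' \<noteq> [] then 0 else coloured c (n, k) (n', l) * ?P (zip ns r) (zip ms st'))"
        if "ms \<in> ?B" for n ns n' ms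
      proof -
        have "zip ms st' = [] \<longleftrightarrow> st' = []" using that by (cases st'; cases ms) (auto simp: colourings_def)
        then show ?thesis using st by simp
      qed
      show ?thesis
        unfolding st list.size add_Suc_right add_0_right sum_colourings_Suc zip_Cons_Cons
        by (intro sum.cong refl) (use * st in simp)
    qed
    also have "\<dots> = (if k \<in> J then 0 else pairing_moment (\<lambda>k. k \<in> J) ?W r (k # st)) +
        (if k \<in> J \<and> st' \<noteq> [] then 0 else ?W k l * pairing_moment (\<lambda>k. k \<in> J) ?W r st')"
    proof -
      have "(\<Sum>n=1..N. \<Sum>ns\<in>?A. \<Sum>n'=1..N. \<Sum>ms\<in>?B. ?P (zip ns r) ((n, k) # zip (n' # ms) st)) =
          pairing_moment (\<lambda>k. k \<in> J) ?W r (k # st)"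
        using push by (simp add: st sum_colourings_Suc)
      moreover have "(\<Sum>n=1..N. \<Sum>ns\<in>?A. \<Sum>n'=1..N. \<Sum>ms\<in>?B.
          (if A then 0 else f n ns n' ms) + (if B then 0 else g n ns n' ms)) =
        (if A then 0 else \<Sum>n=1..N. \<Sum>ns\<in>?A. \<Sum>n'=1..N. \<Sum>ms\<in>?B. f n ns n' ms) +
        (if B then 0 else \<Sum>n=1..N. \<Sum>ns\<in>?A. \<Sum>n'=1..N. \<Sum>ms\<in>?B. g n ns n' ms)"
        for A B and f g :: "nat \<Rightarrow> nat list \<Rightarrow> nat \<Rightarrow> nat list \<Rightarrow> complex"
        by (cases A; cases B) (simp_all add: sum.distrib)
      ultimately show ?thesis by (simp only: pop)
    qed
    finally show ?thesis using st by simp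
  qed
qed

text \<open>
  Every pair consumes two of the letters in the word and on the stack.
\<close>

lemma pairing_moment_scale:
  "a ^ (length r + length st) * pairing_moment circ W r st = pairing_moment circ (\<lambda>k l. a\<^sup>2 * W k l) r st"
proof (induction circ W r st rule: pairing_moment.induct)
  case (3 circ W k r l st)
  define e where "e = length (k # r) + length (l # st)"
  have 1: "a ^ e * pairing_moment circ W r (k # l # st) =
      pairing_moment circ (\<lambda>k l. a\<^sup>2 * W k l) r (k # l # st)" if "\<not> circ k"
    using 3(1)[OF that] by (simp add: e_def)
  have 2: "a ^ e * (W k l * pairing_moment circ W r st) =
      a\<^sup>2 * W k l * pairing_moment circ (\<lambda>k l. a\<^sup>2 * W k l) r st" if "\<not> (circ k \<and> st \<noteq> [])"
    unfolding 3(2)[OF that, symmetric] by (simp add: power2_eq_square e_def)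
  show ?case unfolding e_def[symmetric] pairing_moment.simps distrib_left
    by (rule arg_cong2[of _ _ _ _ "(+)"]) (use 1 2 in auto)
qed auto

lemma pairing_moment_tendsto:
  assumes "\<And>k l. k \<in> K \<Longrightarrow> l \<in> K \<Longrightarrow> (\<lambda>N. W N k l) \<longlonglongrightarrow> C k l" "set r \<subseteq> K" "set st \<subseteq> K"
  shows "(\<lambda>N. pairing_moment circ (W N) r st) \<longlonglongrightarrow> pairing_moment circ C r st"
  using assms(2,3)
proof (induction r arbitrary: st)
  case (Cons k r)
  show ?case
  proof (cases st)
    case (Cons l st')
    have 1: "(\<lambda>N. pairing_moment circ (W N) r (k # l # st')) \<longlonglongrightarrow> pairing_moment circ C r (k # l # st')"
      using Cons.prems Cons by (intro Cons.IH) auto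
    have 2: "(\<lambda>N. pairing_moment circ (W N) r st') \<longlonglongrightarrow> pairing_moment circ C r st'"
      using Cons.prems Cons by (intro Cons.IH) auto
    have 3: "(\<lambda>N. W N k l) \<longlonglongrightarrow> C k l"
      using Cons.prems Cons by (intro assms(1)) auto
    have 4: "(\<lambda>N. if circ k then 0 else pairing_moment circ (W N) r (k # l # st')) \<longlonglongrightarrow>
        (if circ k then 0 else pairing_moment circ C r (k # l # st'))"
      using 1 by simp
    have 5: "(\<lambda>N. if circ k \<and> st' \<noteq> [] then 0 else W N k l * pairing_moment circ (W N) r st') \<longlonglongrightarrow>
        (if circ k \<and> st' \<noteq> [] then 0 else C k l * pairing_moment circ C r st')"
    proof (cases "circ k \<and> st' \<noteq> []")
      case False
      show ?thesis unfolding if_not_P[OF False] by (rule tendsto_mult[OF 3 2])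
    qed simp
    show ?thesis unfolding Cons pairing_moment.simps by (rule tendsto_add[OF 4 5])
  qed (use Cons in auto)
qed simp

lemma tendsto_zero_bound:
  fixes f :: "'a \<Rightarrow> 'b::real_normed_vector"
  assumes "\<forall>\<^sub>F x in F. norm (f x) \<le> g x" "(g \<longlongrightarrow> (0 :: real)) F"
  shows "(f \<longlongrightarrow> 0) F"
  by (rule tendsto_0_le[OF assms(2), of _ 1]) (use assms(1) in \<open>auto elim: eventually_mono\<close>)

text \<open>
  A list with at most \<open>d\<close> distinct entries arises from a list over \<open>d\<close> names and an assignment of
  values to these names.
\<close>

lemma card_few_colours:
  assumes "N \<ge> 1"
  shows "card {ns \<in> colourings N p. card (set ns) \<le> d} \<le> d ^ p * N ^ d"
proof -
  let ?H = "{h. set h \<subseteq> {..<d} \<and> length h = p}" and ?G = "{g. set g \<subseteq> {1..N} \<and> length g = d}"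
  have "{ns \<in> colourings N p. card (set ns) \<le> d} \<subseteq> (\<lambda>(h, g). map ((!) g) h) ` (?H \<times> ?G)"
  proof
    fix ns assume "ns \<in> {ns \<in> colourings N p. card (set ns) \<le> d}"
    then have ns: "set ns \<subseteq> {1..N}" "length ns = p" "card (set ns) \<le> d" by (auto simp: colourings_def)
    obtain g0 where g0: "set g0 = set ns" "distinct g0" using finite_distinct_list[of "set ns"] by auto
    then have l: "length g0 \<le> d" using ns distinct_card[of g0] by simp
    \<comment> \<open>Unused names receive the dummy value 1, which is a colour since \<open>N \<ge> 1\<close>.\<close>
    define g where "g = g0 @ replicate (d - length g0) 1"
    have g: "g \<in> ?G" using g0 ns l assms by (auto simp: g_def)
    have "\<exists>i<d. g ! i = x" if x: "x \<in> set ns" for x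
    proof -
      have "x \<in> set g0" using x g0(1) by simp
      then obtain i where "i < length g0" "g0 ! i = x" by (auto simp: in_set_conv_nth)
      then show ?thesis using l by (intro exI[of _ i]) (auto simp: g_def nth_append)
    qed
    then obtain f where f: "\<And>x. x \<in> set ns \<Longrightarrow> f x < d \<and> g ! f x = x" by metis
    have "map f ns \<in> ?H" using f ns by auto
    moreover have "ns = map ((!) g) (map f ns)" using f by (simp add: map_idI)
    ultimately show "ns \<in> (\<lambda>(h, g). map ((!) g) h) ` (?H \<times> ?G)"
      using g by (intro image_eqI[of _ _ "(map f ns, g)"]) auto
  qed
  then have "card {ns \<in> colourings N p. card (set ns) \<le> d} \<le> card (?H \<times> ?G)"
    by (rule surj_card_le[rotated]) (auto intro!: finite_cartesian_product finite_lists_length_eq)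
  also have "\<dots> = d ^ p * N ^ d" by (simp add: card_cartesian_product card_lists_length_eq)
  finally show ?thesis .
qed

text \<open>
  Every colour has multiplicity at least two and one of them at least three.
\<close>

lemma few_colours:
  assumes "\<And>x. count_list ns x \<noteq> 1" "count_list ns y \<ge> 3"
  shows "2 * card (set ns) < length ns"
proof -
  have y: "y \<in> set ns" using assms(2) by (metis count_list_0_iff not_numeral_le_zero)
  have "(\<Sum>x\<in>set ns. 2) < (\<Sum>x\<in>set ns. count_list ns x)"
  proof (rule sum_strict_mono_ex1)
    show "\<forall>x\<in>set ns. 2 \<le> count_list ns x"
    proof
      fix x assume "x \<in> set ns"
      then have "count_list ns x \<noteq> 0" by (simp add: count_list_0_iff)
      then show "2 \<le> count_list ns x" using assms(1)[of x] by linarith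
    qed
    show "\<exists>x\<in>set ns. 2 < count_list ns x" using y assms(2) by (intro bexI[of _ y]) auto
  qed simp
  then show ?thesis by (simp add: sum_count_set)
qed

lemma few_colours_negligible:
  assumes "2 * d < p"
  shows "(\<lambda>N. (1 / sqrt (real N)) ^ p * (real (d ^ p * N ^ d) * B)) \<longlonglongrightarrow> 0"
proof -
  have lim: "(\<lambda>N. 1 / sqrt (real N) * (real (d ^ p) * \<bar>B\<bar>)) \<longlonglongrightarrow> 0"
  proof -
    have "filterlim (\<lambda>N. sqrt (real N)) at_top sequentially"
      by (rule filterlim_compose[OF sqrt_at_top filterlim_real_sequentially])
    then have "(\<lambda>N. 1 / sqrt (real N)) \<longlonglongrightarrow> 0"
      using tendsto_inverse_0_at_top by (simp add: inverse_eq_divide)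
    from tendsto_mult_left_zero[OF this] show ?thesis .
  qed
  show ?thesis
  proof (rule tendsto_zero_bound[OF _ lim])
    show "\<forall>\<^sub>F N in sequentially. norm ((1 / sqrt (real N)) ^ p * (real (d ^ p * N ^ d) * B))
        \<le> 1 / sqrt (real N) * (real (d ^ p) * \<bar>B\<bar>)"
      using eventually_ge_at_top[of 1]
    proof eventually_elim
      case (elim N)
      define a where "a = 1 / sqrt (real N)"
      have a: "0 < a" "a \<le> 1" using elim by (auto simp: a_def divide_le_eq_1 real_sqrt_ge_one)
      have aN: "a ^ (2 * d) * real N ^ d = 1"
        using elim by (simp add: power_mult a_def power_divide flip: power_mult_distrib)
      have "a ^ p * real N ^ d = a ^ (p - 2 * d) * (a ^ (2 * d) * real N ^ d)"
        using assms by (simp flip: power_add mult.assoc)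
      also have "\<dots> = a ^ (p - 2 * d)" using aN by simp
      also have "\<dots> \<le> a ^ 1" using a assms by (intro power_decreasing) auto
      finally have "a ^ p * real N ^ d \<le> a" by simp
      then have "a ^ p * real N ^ d * (real (d ^ p) * \<bar>B\<bar>) \<le> a * (real (d ^ p) * \<bar>B\<bar>)"
        by (rule mult_right_mono) simp
      moreover have "norm (a ^ p * (real (d ^ p * N ^ d) * B)) = a ^ p * real N ^ d * (real (d ^ p) * \<bar>B\<bar>)"
        using a by (simp add: abs_mult)
      ultimately show ?case by (simp add: a_def)
    qed
  qed
qed

text \<open>
  The stack moments are replaced by pairing moments, for which the sum over colourings is known
  exactly. The two differ only for colourings with fewer than \<open>p/2\<close> colours, by a bounded amount.
\<close>

lemma stack_moment_clt:
  fixes m :: "nat \<Rightarrow> 'k list \<Rightarrow> complex"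
  assumes centred: "\<And>n k. n \<ge> 1 \<Longrightarrow> k \<in> K \<Longrightarrow> m n [k] = 0"
    and bounded: "\<And>ks. ks \<noteq> [] \<Longrightarrow> set ks \<subseteq> K \<Longrightarrow> \<exists>D. \<forall>n\<in>{1..}. cmod (m n ks) \<le> D"
    and cov: "\<And>k l. k \<in> K \<Longrightarrow> l \<in> K \<Longrightarrow> (\<lambda>N. 1 / of_nat N * (\<Sum>n=1..N. m n [k, l])) \<longlonglongrightarrow> C k l"
    and ks: "set ks \<subseteq> K"
  shows "(\<lambda>N. complex_of_real (1 / sqrt (real N)) ^ length ks *
      (\<Sum>ns\<in>colourings N (length ks). stack_moment J m (zip ns ks) [])) \<longlonglongrightarrow>
    pairing_moment (\<lambda>k. k \<in> J) C ks []"
proof -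
  let ?p = "length ks"
  let ?a = "\<lambda>N. complex_of_real (1 / sqrt (real N))"
  define c where "c = (\<lambda>n k l. m n [k, l])"
  let ?S = "\<lambda>ns. stack_moment J m (zip ns ks) []"
  let ?P = "\<lambda>ns. pairing_moment (\<lambda>x. snd x \<in> J) (coloured c) (zip ns ks) []"
  have asq: "(?a N)\<^sup>2 = 1 / of_nat N" for N
    by (simp add: power_divide flip: of_real_power)
  have main: "(\<lambda>N. ?a N ^ ?p * (\<Sum>ns\<in>colourings N ?p. ?P ns)) \<longlonglongrightarrow> pairing_moment (\<lambda>k. k \<in> J) C ks []"
  proof -
    have "(\<lambda>N. pairing_moment (\<lambda>k. k \<in> J) (\<lambda>k l. (?a N)\<^sup>2 * (\<Sum>n=1..N. c n k l)) ks []) \<longlonglongrightarrow>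
        pairing_moment (\<lambda>k. k \<in> J) C ks []"
    proof (rule pairing_moment_tendsto[of K])
      show "(\<lambda>N. (?a N)\<^sup>2 * (\<Sum>n=1..N. c n k l)) \<longlonglongrightarrow> C k l" if "k \<in> K" "l \<in> K" for k l
        unfolding asq c_def using that by (rule cov)
    qed (use ks in auto)
    moreover have "?a N ^ ?p * (\<Sum>ns\<in>colourings N ?p. ?P ns) =
        pairing_moment (\<lambda>k. k \<in> J) (\<lambda>k l. (?a N)\<^sup>2 * (\<Sum>n=1..N. c n k l)) ks []" for N
      using sum_colourings_pairing_moment[where J = J and c = c and N = N and r = ks and st = "[]"]
        pairing_moment_scale[of "?a N" ks "[]" "\<lambda>k. k \<in> J" "\<lambda>k l. \<Sum>n=1..N. c n k l"]
      by simp
    ultimately show ?thesis by simp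
  qed
  obtain B1 where B1: "\<And>r. map snd r = ks \<Longrightarrow> fst ` set r \<subseteq> {1..} \<Longrightarrow> cmod (stack_moment J m r []) \<le> B1"
    using stack_moment_bounded[of K "{1..}" m ks "[]" J] bounded ks by auto
  obtain B2 where B2: "\<And>r. map snd r = ks \<Longrightarrow> fst ` set r \<subseteq> {1..} \<Longrightarrow>
      cmod (pairing_moment (\<lambda>x. snd x \<in> J) (coloured c) r []) \<le> B2"
    using pairing_moment_bounded[of K "{1..}" c ks "[]" "\<lambda>x. snd x \<in> J"] bounded[of "[_, _]"] ks
    by (auto simp: c_def)
  have zip_ns: "map snd (zip ns ks) = ks" "map fst (zip ns ks) = ns" "fst ` set (zip ns ks) \<subseteq> {1..}"
    if "ns \<in> colourings N ?p" for ns N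
    using that by (auto simp: colourings_def dest: set_zip_leftD)
  have centred': "m (fst x) [snd x] = 0" if "ns \<in> colourings N ?p" "x \<in> set (zip ns ks)" for ns N x
    using that ks by (cases x) (auto simp: colourings_def dest: set_zip_leftD set_zip_rightD intro!: centred)
  \<comment> \<open>The largest number of colours that is less than \<open>?p / 2\<close>.\<close>
  define d where "d = (?p - 1) div 2"
  have diff: "?S ns - ?P ns = 0" if ns: "ns \<in> colourings N ?p" "\<not> 2 * card (set ns) < ?p" for ns N
  proof (cases "\<forall>x. count_list ns x \<le> 2")
    case True
    have "stack_moment J m (zip ns ks) (map (\<lambda>(n, k). (n, [k])) []) = ?P ns"
      unfolding c_def
      by (rule stack_moment_eq_pairing_moment)
        (use centred' ns(1) True in \<open>auto simp: zip_ns(2)[OF ns(1)]\<close>)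
    then show ?thesis by simp
  next
    case False
    then obtain y where "count_list ns y \<ge> 3" by (metis not_less_eq_eq numeral_3_eq_3 numeral_2_eq_2)
    moreover have "length ns = ?p" using ns by (simp add: colourings_def)
    ultimately obtain x where x: "count_list ns x = 1" using few_colours[of ns y] ns(2) by metis
    have "?S ns = 0"
      by (rule stack_moment_singleton[of _ _ x]) (use x centred' ns(1) in \<open>auto simp: zip_ns(2)[OF ns(1)]\<close>)
    moreover have "?P ns = 0"
      by (rule pairing_moment_singleton[of _ x]) (use x ns(1) in \<open>auto simp: zip_ns(2)[OF ns(1)]\<close>)
    ultimately show ?thesis by simp
  qed
  have rest: "(\<lambda>N. ?a N ^ ?p * (\<Sum>ns\<in>colourings N ?p. ?S ns - ?P ns)) \<longlonglongrightarrow> 0"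
  proof (cases "?p = 0")
    case True
    then have "(\<Sum>ns\<in>colourings N ?p. ?S ns - ?P ns) = 0" for N
      by (intro sum.neutral ballI diff[of _ N]) auto
    then show ?thesis by simp
  next
    case False
    have "2 * ((p - 1) div 2) < p" if "p \<noteq> 0" for p :: nat using that by linarith
    then have d: "2 * d < ?p" using False unfolding d_def .
    have bd: "cmod (?a N ^ ?p * (\<Sum>ns\<in>colourings N ?p. ?S ns - ?P ns)) \<le>
        (1 / sqrt (real N)) ^ ?p * (real (d ^ ?p * N ^ d) * (\<bar>B1\<bar> + \<bar>B2\<bar>))" if "N \<ge> 1" for N
    proof -
      let ?F = "{ns \<in> colourings N ?p. card (set ns) \<le> d}"
      have "(\<Sum>ns\<in>colourings N ?p. ?S ns - ?P ns) = (\<Sum>ns\<in>?F. ?S ns - ?P ns)"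
      proof (rule sum.mono_neutral_right)
        show "\<forall>ns\<in>colourings N ?p - ?F. ?S ns - ?P ns = 0"
        proof
          fix ns assume "ns \<in> colourings N ?p - ?F"
          then have "ns \<in> colourings N ?p" "\<not> 2 * card (set ns) < ?p" by (auto simp: d_def)
          then show "?S ns - ?P ns = 0" by (rule diff)
        qed
      qed (auto simp: finite_colourings)
      also have "cmod \<dots> \<le> of_nat (card ?F) * (\<bar>B1\<bar> + \<bar>B2\<bar>)"
      proof (rule sum_norm_bound)
        fix ns assume "ns \<in> ?F"
        then have ns: "ns \<in> colourings N ?p" by simp
        have "cmod (?S ns) \<le> B1" "cmod (?P ns) \<le> B2"
          using B1[OF zip_ns(1,3)[OF ns]] B2[OF zip_ns(1,3)[OF ns]] .
        then show "cmod (?S ns - ?P ns) \<le> \<bar>B1\<bar> + \<bar>B2\<bar>"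
          using norm_triangle_ineq4[of "?S ns" "?P ns"] by linarith
      qed
      also have "\<dots> \<le> real (d ^ ?p * N ^ d) * (\<bar>B1\<bar> + \<bar>B2\<bar>)"
        using card_few_colours[OF that, of ?p d] by (intro mult_right_mono) (auto simp only: of_nat_le_iff)
      finally have *: "cmod (\<Sum>ns\<in>colourings N ?p. ?S ns - ?P ns) \<le> real (d ^ ?p * N ^ d) * (\<bar>B1\<bar> + \<bar>B2\<bar>)" .
      have "cmod (?a N ^ ?p) = (1 / sqrt (real N)) ^ ?p"
        by (simp add: norm_power norm_divide)
      then show ?thesis
        unfolding norm_mult using * by (simp only:) (intro mult_left_mono zero_le_power, auto)
    qed
    show ?thesis
      by (rule tendsto_zero_bound[OF _ few_colours_negligible[OF d]])
        (use eventually_ge_at_top[of 1] in eventually_elim, rule bd)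
  qed
  have "?a N ^ ?p * (\<Sum>ns\<in>colourings N ?p. ?S ns) =
      ?a N ^ ?p * (\<Sum>ns\<in>colourings N ?p. ?P ns) + ?a N ^ ?p * (\<Sum>ns\<in>colourings N ?p. ?S ns - ?P ns)" for N
    by (simp add: sum_subtractf algebra_simps)
  then show ?thesis using tendsto_add[OF main rest] by simp
qed

section \<open>Admissible noncrossing partitions and cumulants\<close>

lemma partition_on_same_block:
  "partition_on A \<pi> \<Longrightarrow> U \<in> \<pi> \<Longrightarrow> W \<in> \<pi> \<Longrightarrow> x \<in> U \<Longrightarrow> x \<in> W \<Longrightarrow> U = W"
  unfolding partition_on_def disjoint_def by blast

lemma moebius_sum_lower:
  assumes "finite P" "partial_order_on P {(u, v). u \<in> P \<and> v \<in> P \<and> le u v}" "x \<in> P" "y \<in> P" "le x y"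
  shows "(\<Sum>u\<in>{u \<in> P. le x u \<and> le u y}. moebius P le x u) = (if x = y then 1 else 0)"
proof -
  have r: "le u u" if "u \<in> P" for u
    using assms(2) that by (auto simp: partial_order_on_def preorder_on_def refl_on_def)
  have anti: "u = v" if "u \<in> P" "v \<in> P" "le u v" "le v u" for u v
    using assms(2) that by (auto simp: partial_order_on_def antisym_def)
  show ?thesis
  proof (cases "x = y")
    case True
    then have "{u \<in> P. le x u \<and> le u y} = {x}" using assms r anti by blast
    then show ?thesis using True assms by (simp add: moebius.simps)
  next
    case False
    have "{u \<in> P. le x u \<and> le u y} = insert y {u \<in> P. le x u \<and> le u y \<and> u \<noteq> y}"
      using assms r by auto
    moreover have "moebius P le x y = - (\<Sum>u\<in>{u \<in> P. le x u \<and> le u y \<and> u \<noteq> y}. moebius P le x u)"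
      using assms False by (subst moebius.simps) simp
    ultimately show ?thesis using assms(1) False by simp
  qed
qed

text \<open>
  The recursion defining the Moebius function says that it is inverse to the zeta function on one
  side; this is the other side. With \<open>g u\<close> for the sum over the interval from \<open>u\<close> to \<open>y\<close>, evaluating
  the double sum of \<open>\<mu>(x,u) \<mu>(v,y)\<close> over \<open>x \<le> u \<le> v \<le> y\<close> in both orders gives
  \<open>\<Sum>u. \<mu>(x,u) g u = \<mu>(x,y)\<close>, and by induction all terms with \<open>x < u\<close> are known.
\<close>

lemma moebius_sum_upper:
  assumes fin: "finite P" and po: "partial_order_on P {(u, v). u \<in> P \<and> v \<in> P \<and> le u v}"
    and y: "y \<in> P" and x: "x \<in> P" "le x y"
  shows "(\<Sum>v\<in>{v \<in> P. le x v \<and> le v y}. moebius P le v y) = (if x = y then 1 else 0)"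
  using x
proof (induction "card {v \<in> P. le x v}" arbitrary: x rule: less_induct)
  case (less x)
  note x = less.prems
  have r: "le u u" if "u \<in> P" for u
    using po that by (auto simp: partial_order_on_def preorder_on_def refl_on_def)
  have anti: "u = v" if "u \<in> P" "v \<in> P" "le u v" "le v u" for u v
    using po that by (auto simp: partial_order_on_def antisym_def)
  have tr: "le u w" if "u \<in> P" "v \<in> P" "w \<in> P" "le u v" "le v w" for u v w
    using po that unfolding partial_order_on_def preorder_on_def trans_def by blast
  let ?m = "moebius P le"
  let ?g = "\<lambda>u. \<Sum>v\<in>{v \<in> P. le u v \<and> le v y}. ?m v y"
  let ?I = "{u \<in> P. le x u \<and> le u y}"
  have finI: "finite ?I" using fin by simp
  have mxx: "?m x x = 1" using fin po x by (simp add: moebius.simps r)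
  show ?case
  proof (cases "x = y")
    case True
    then have "?I = {x}" using x anti by blast
    then show ?thesis using True mxx by simp
  next
    case False
    have IH: "?g u = (if u = y then 1 else 0)" if u: "u \<in> ?I" "u \<noteq> x" for u
    proof (rule less.hyps)
      have "{v \<in> P. le u v} \<subset> {v \<in> P. le x v}"
        using u x tr r anti by blast
      then show "card {v \<in> P. le u v} < card {v \<in> P. le x v}"
        using fin by (intro psubset_card_mono) auto
    qed (use u in auto)
    \<comment> \<open>The double sum, summed over \<open>v\<close> first; exchanging the order brings in the recursion.\<close>
    have "(\<Sum>u\<in>?I. ?m x u * ?g u) = (\<Sum>u\<in>?I. \<Sum>v\<in>?I. if le u v then ?m x u * ?m v y else 0)"
    proof (rule sum.cong[OF refl])
      fix u assume u: "u \<in> ?I"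
      have eq: "{v \<in> P. le u v \<and> le v y} = {v \<in> ?I. le u v}" using u x tr by blast
      then show "?m x u * ?g u = (\<Sum>v\<in>?I. if le u v then ?m x u * ?m v y else 0)"
        unfolding eq sum_distrib_left sum.inter_filter[OF finI] by (intro sum.cong) auto
    qed
    also have "\<dots> = (\<Sum>v\<in>?I. \<Sum>u\<in>?I. if le u v then ?m x u * ?m v y else 0)"
      by (rule sum.swap)
    also have "\<dots> = (\<Sum>v\<in>?I. ?m v y * (if x = v then 1 else 0))"
    proof (rule sum.cong[OF refl])
      fix v assume v: "v \<in> ?I"
      have "{u \<in> ?I. le u v} = {u \<in> P. le x u \<and> le u v}" using v y tr by blast
      moreover have "(\<Sum>u\<in>{u \<in> P. le x u \<and> le u v}. ?m x u) = (if x = v then 1 else 0)"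
        using moebius_sum_lower[OF fin po x(1), of v] v by simp
      ultimately show "(\<Sum>u\<in>?I. if le u v then ?m x u * ?m v y else 0) = ?m v y * (if x = v then 1 else 0)"
        by (simp only: sum.inter_filter[OF finI, symmetric] sum_distrib_right[symmetric])
          (simp add: mult.commute)
    qed
    also have "\<dots> = ?m x y"
      using finI x r by (simp add: if_distrib cong: if_cong)
    finally have "(\<Sum>u\<in>?I. ?m x u * ?g u) = ?m x y" .
    moreover have "(\<Sum>u\<in>?I. ?m x u * ?g u) = ?m x x * ?g x + (\<Sum>u\<in>?I - {x}. ?m x u * ?g u)"
      using finI x r by (intro sum.remove) auto
    moreover have "(\<Sum>u\<in>?I - {x}. ?m x u * ?g u) = (\<Sum>u\<in>?I - {x}. ?m x u * (if u = y then 1 else 0))"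
      using IH by (intro sum.cong) auto
    moreover have "\<dots> = ?m x y"
      using finI x y False r by (simp add: if_distrib cong: if_cong)
    ultimately have "?g x = 0" using mxx by simp
    then show ?thesis using False by simp
  qed
qed

text \<open>
  The same lattice as \<open>INC\<close>, on an arbitrary set of positions, so that it can also be used for the
  blocks of a partition.
\<close>

definition inc_partitions :: "(nat \<Rightarrow> colour) \<Rightarrow> nat set \<Rightarrow> nat set set set" where
  "inc_partitions \<chi> A = {\<pi>. partition_on A \<pi> \<and> noncrossing \<pi> \<and>
     (\<forall>U\<in>\<pi>. inner_block \<pi> U \<longrightarrow> (\<forall>k\<in>U. \<chi> k \<noteq> Circle))}"

lemma INC_eq: "INC n \<chi> = inc_partitions \<chi> {1..n}"
  by (simp add: INC_def inc_partitions_def)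

lemma finite_inc_partitions: "finite A \<Longrightarrow> finite (inc_partitions \<chi> A)"
  by (rule finite_subset[of _ "Pow (Pow A)"]) (auto simp: inc_partitions_def partition_on_def)

lemma noncrossingD:
  assumes "noncrossing \<pi>" and "V \<in> \<pi>" "W \<in> \<pi>" "V \<noteq> W" and "a < b" "b < c" "c < d"
    and "a \<in> V" "c \<in> V" "b \<in> W" "d \<in> W"
  shows False
  using assms(1) unfolding noncrossing_def
proof (rule notE)
  show "\<exists>V\<in>\<pi>. \<exists>W\<in>\<pi>. V \<noteq> W \<and>
      (\<exists>a b c d. a < b \<and> b < c \<and> c < d \<and> a \<in> V \<and> c \<in> V \<and> b \<in> W \<and> d \<in> W)"
    by (rule bexI[of _ V], rule bexI[of _ W], rule conjI, fact,
        rule exI[of _ a], rule exI[of _ b], rule exI[of _ c], rule exI[of _ d])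
      (use assms in simp_all)
qed

lemma noncrossingI:
  assumes "\<And>V W a b c d. V \<in> \<pi> \<Longrightarrow> W \<in> \<pi> \<Longrightarrow> V \<noteq> W \<Longrightarrow> a < b \<Longrightarrow> b < c \<Longrightarrow> c < d \<Longrightarrow>
    a \<in> V \<Longrightarrow> c \<in> V \<Longrightarrow> b \<in> W \<Longrightarrow> d \<in> W \<Longrightarrow> False"
  shows "noncrossing \<pi>"
  unfolding noncrossing_def using assms by (intro notI, elim bexE conjE exE)

lemma noncrossing_subset:
  assumes "noncrossing \<pi>" "\<rho> \<subseteq> \<pi>"
  shows "noncrossing \<rho>"
  by (rule noncrossingI, rule noncrossingD[OF assms(1) subsetD[OF assms(2)] subsetD[OF assms(2)]])

lemma inner_block_mono: "inner_block \<rho> U \<Longrightarrow> \<rho> \<subseteq> \<pi> \<Longrightarrow> inner_block \<pi> U"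
  unfolding inner_block_def by blast

text \<open>
  Two blocks of \<open>\<pi>\<close> inside different blocks of \<open>\<sigma>\<close> cannot cross because \<open>\<sigma>\<close> is noncrossing. If a block
  of \<open>\<pi>\<close> is nested in another one that belongs to a different block of \<open>\<sigma>\<close>, then its whole block in \<open>\<sigma>\<close>
  is inner, and so it contains no Circle.
\<close>

lemma inc_partitions_refinement_iff:
  assumes \<sigma>: "\<sigma> \<in> inc_partitions \<chi> A" and ref: "refines A \<pi> \<sigma>"
  shows "\<pi> \<in> inc_partitions \<chi> A \<longleftrightarrow> (\<forall>V\<in>\<sigma>. {U \<in> \<pi>. U \<subseteq> V} \<in> inc_partitions \<chi> V)"
proof
  assume \<pi>: "\<pi> \<in> inc_partitions \<chi> A"
  show "\<forall>V\<in>\<sigma>. {U \<in> \<pi>. U \<subseteq> V} \<in> inc_partitions \<chi> V"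
  proof
    fix V assume "V \<in> \<sigma>"
    then have "partition_on V {U \<in> \<pi>. U \<subseteq> V}" by (rule refines_obtains_subset[OF ref])
    moreover have "{U \<in> \<pi>. U \<subseteq> V} \<subseteq> \<pi>" by blast
    ultimately show "{U \<in> \<pi>. U \<subseteq> V} \<in> inc_partitions \<chi> V"
      using \<pi> noncrossing_subset[of \<pi>] inner_block_mono[of "{U \<in> \<pi>. U \<subseteq> V}" _ \<pi>]
      unfolding inc_partitions_def by blast
  qed
next
  assume R: "\<forall>V\<in>\<sigma>. {U \<in> \<pi>. U \<subseteq> V} \<in> inc_partitions \<chi> V"
  have p\<pi>: "partition_on A \<pi>" and p\<sigma>: "partition_on A \<sigma>" and sub: "\<And>U. U \<in> \<pi> \<Longrightarrow> \<exists>V\<in>\<sigma>. U \<subseteq> V"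
    using ref by (auto simp: refines_def)
  have nc\<sigma>: "noncrossing \<sigma>" using \<sigma> by (simp add: inc_partitions_def)
  have "noncrossing \<pi>"
  proof (rule noncrossingI)
    fix U W a b c d
    assume h: "U \<in> \<pi>" "W \<in> \<pi>" "U \<noteq> W" "a < b" "b < c" "c < d" "a \<in> U" "c \<in> U" "b \<in> W" "d \<in> W"
    obtain V V' where V: "V \<in> \<sigma>" "U \<subseteq> V" "V' \<in> \<sigma>" "W \<subseteq> V'" using sub h by metis
    show False
    proof (cases "V = V'")
      case True
      have "noncrossing {U \<in> \<pi>. U \<subseteq> V}" using R V by (simp add: inc_partitions_def)
      then show False using noncrossingD[of _ U W a b c d] h V True by blast
    next
      case False
      show False using noncrossingD[OF nc\<sigma> V(1,3) False h(4-6)] h V by blast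
    qed
  qed
  moreover have "\<chi> k \<noteq> Circle" if h: "U \<in> \<pi>" "inner_block \<pi> U" "k \<in> U" for U k
  proof -
    obtain W s t where W: "W \<in> \<pi>" "s \<in> W" "t \<in> W" "\<And>v. v \<in> U \<Longrightarrow> s < v \<and> v < t"
      using h(2) by (auto simp: inner_block_def)
    obtain V V' where V: "V \<in> \<sigma>" "U \<subseteq> V" "V' \<in> \<sigma>" "W \<subseteq> V'" using sub h W by metis
    show ?thesis
    proof (cases "V = V'")
      case True
      have "inner_block {U \<in> \<pi>. U \<subseteq> V} U" using W V True by (auto simp: inner_block_def)
      then show ?thesis using R V h by (auto simp: inc_partitions_def)
    next
      case False
      have st: "s \<in> V'" "t \<in> V'" "s < k" "k < t" "k \<in> V" using W V h by auto
      have disj: "v \<noteq> s" "v \<noteq> t" if "v \<in> V" for v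
        using that st False partition_on_same_block[OF p\<sigma> V(1,3)] by auto
      have "s < v \<and> v < t" if v: "v \<in> V" for v
      proof -
        have "\<not> v < s" using noncrossingD[OF nc\<sigma> V(1,3) False, of v s k t] v st by blast
        moreover have "\<not> t < v" using noncrossingD[OF nc\<sigma> V(3,1) False[symmetric], of s k t v] v st by blast
        ultimately show ?thesis using disj[OF v] by linarith
      qed
      then have "inner_block \<sigma> V" using V(3) st by (auto simp: inner_block_def)
      then show ?thesis using \<sigma> V(1) st by (auto simp: inc_partitions_def)
    qed
  qed
  ultimately show "\<pi> \<in> inc_partitions \<chi> A" using p\<pi> by (simp add: inc_partitions_def)
qed

text \<open>
  Expanding the product gives a sum over the families that choose a partition for each block of
  \<open>\<sigma>\<close>; these families correspond to the partitions below \<open>\<sigma>\<close>.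
\<close>

lemma prod_sum_inc_partitions:
  fixes w :: "nat set \<Rightarrow> complex"
  assumes A: "finite A" and \<sigma>: "\<sigma> \<in> inc_partitions \<chi> A"
  shows "(\<Prod>V\<in>\<sigma>. \<Sum>\<pi>\<in>inc_partitions \<chi> V. \<Prod>U\<in>\<pi>. w U) =
    (\<Sum>\<pi>\<in>{\<pi> \<in> inc_partitions \<chi> A. refines A \<pi> \<sigma>}. \<Prod>U\<in>\<pi>. w U)"
proof -
  have p\<sigma>: "partition_on A \<sigma>" using \<sigma> by (simp add: inc_partitions_def)
  have fin\<sigma>: "finite \<sigma>" using A p\<sigma> by (auto simp: partition_on_def intro: finite_UnionD)
  have finV: "finite V" if "V \<in> \<sigma>" for V using that A p\<sigma> by (metis Union_upper finite_subset partition_onD1)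
  have fin: "finite (inc_partitions \<chi> V)" if "V \<in> \<sigma>" for V using that finV finite_inc_partitions by blast
  let ?E = "PiE \<sigma> (inc_partitions \<chi>)"
  have part: "partition_on V (g V)" if "g \<in> ?E" "V \<in> \<sigma>" for g V
    using PiE_mem[OF that] by (simp add: inc_partitions_def)
  have sub: "U \<subseteq> V" "U \<noteq> {}" if "g \<in> ?E" "V \<in> \<sigma>" "U \<in> g V" for g V U
    using part[OF that(1,2)] that(3) by (auto simp: partition_on_def)
  have only: "V = V'" if "V \<in> \<sigma>" "V' \<in> \<sigma>" "U \<subseteq> V" "U \<subseteq> V'" "U \<noteq> {}" for U V V'
    using that partition_on_same_block[OF p\<sigma>] by blast
  have restr: "{U \<in> \<Union>(g ` \<sigma>). U \<subseteq> V} = g V" if g: "g \<in> ?E" and V: "V \<in> \<sigma>" for g V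
  proof (intro equalityI subsetI)
    fix U assume "U \<in> {U \<in> \<Union>(g ` \<sigma>). U \<subseteq> V}"
    then obtain V' where V': "V' \<in> \<sigma>" "U \<in> g V'" "U \<subseteq> V" by blast
    then have "V = V'" using only[OF V V'(1,3)] sub[OF g V'(1,2)] by blast
    then show "U \<in> g V" using V' by simp
  next
    fix U assume "U \<in> g V"
    then show "U \<in> {U \<in> \<Union>(g ` \<sigma>). U \<subseteq> V}" using V sub(1)[OF g V] by blast
  qed
  have union_part: "partition_on A (\<Union>(g ` \<sigma>))" if g: "g \<in> ?E" for g
  proof (rule partition_onI)
    have "\<Union>(\<Union>(g ` \<sigma>)) = (\<Union>V\<in>\<sigma>. \<Union>(g V))" by blast
    also have "\<dots> = \<Union>\<sigma>" using part[OF g] by (auto simp: partition_on_def)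
    finally show "\<Union>(\<Union>(g ` \<sigma>)) = A" using p\<sigma> by (simp add: partition_on_def)
  next
    fix U W assume h: "U \<in> \<Union>(g ` \<sigma>)" "W \<in> \<Union>(g ` \<sigma>)" "U \<noteq> W"
    then obtain V V' where V: "V \<in> \<sigma>" "U \<in> g V" "V' \<in> \<sigma>" "W \<in> g V'" by blast
    show "disjnt U W"
    proof (rule ccontr)
      assume "\<not> disjnt U W"
      then obtain x where x: "x \<in> U" "x \<in> W" by (auto simp: disjnt_def)
      then have "V = V'" using sub[OF g V(1,2)] sub[OF g V(3,4)] partition_on_same_block[OF p\<sigma> V(1,3)] by blast
      then show False using partition_on_same_block[OF part[OF g V(1)] V(2)] V x h(3) by blast
    qed
  next
    show "{} \<notin> \<Union>(g ` \<sigma>)" using sub(2)[OF g] by blast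
  qed
  have union_ref: "refines A (\<Union>(g ` \<sigma>)) \<sigma>" if g: "g \<in> ?E" for g
    unfolding refines_def
  proof (intro conjI ballI union_part[OF g] p\<sigma>)
    fix U assume "U \<in> \<Union>(g ` \<sigma>)"
    then obtain V where "V \<in> \<sigma>" "U \<in> g V" by blast
    then show "\<exists>Y\<in>\<sigma>. U \<subseteq> Y" using sub(1)[OF g] by blast
  qed
  have union_inc: "\<Union>(g ` \<sigma>) \<in> inc_partitions \<chi> A" if g: "g \<in> ?E" for g
    unfolding inc_partitions_refinement_iff[OF \<sigma> union_ref[OF g]]
    using restr[OF g] PiE_mem[OF g] by simp
  have "(\<Prod>V\<in>\<sigma>. \<Sum>\<pi>\<in>inc_partitions \<chi> V. \<Prod>U\<in>\<pi>. w U) = (\<Sum>g\<in>?E. \<Prod>V\<in>\<sigma>. \<Prod>U\<in>g V. w U)"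
    by (rule prod_sum_PiE[OF fin\<sigma> fin])
  also have "\<dots> = (\<Sum>g\<in>?E. \<Prod>U\<in>\<Union>(g ` \<sigma>). w U)"
  proof (rule sum.cong[OF refl])
    fix g assume g: "g \<in> ?E"
    have "finite (g V)" if "V \<in> \<sigma>" for V
      using part[OF g that] finV[OF that] by (auto simp: partition_on_def intro: finite_UnionD)
    moreover have "g V \<inter> g V' = {}" if V: "V \<in> \<sigma>" "V' \<in> \<sigma>" "V \<noteq> V'" for V V'
    proof (rule equals0I)
      fix U assume "U \<in> g V \<inter> g V'"
      then show False using only[OF V(1,2), of U] sub[OF g V(1), of U] sub[OF g V(2), of U] V(3) by blast
    qed
    ultimately show "(\<Prod>V\<in>\<sigma>. \<Prod>U\<in>g V. w U) = (\<Prod>U\<in>\<Union>(g ` \<sigma>). w U)"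
      using fin\<sigma> by (subst prod.UNION_disjoint) auto
  qed
  also have "\<dots> = (\<Sum>\<pi>\<in>{\<pi> \<in> inc_partitions \<chi> A. refines A \<pi> \<sigma>}. \<Prod>U\<in>\<pi>. w U)"
  proof (rule sum.reindex_bij_witness[of _ "\<lambda>\<pi>. \<lambda>V\<in>\<sigma>. {U \<in> \<pi>. U \<subseteq> V}" "\<lambda>g. \<Union>(g ` \<sigma>)"])
    fix g assume g: "g \<in> ?E"
    show "\<Union>(g ` \<sigma>) \<in> {\<pi> \<in> inc_partitions \<chi> A. refines A \<pi> \<sigma>}"
      using union_inc[OF g] union_ref[OF g] by simp
    show "(\<lambda>V\<in>\<sigma>. {U \<in> \<Union>(g ` \<sigma>). U \<subseteq> V}) = g"
    proof
      fix V
      show "(\<lambda>V\<in>\<sigma>. {U \<in> \<Union>(g ` \<sigma>). U \<subseteq> V}) V = g V"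
        using restr[OF g, of V] PiE_arb[OF g, of V] by (cases "V \<in> \<sigma>") simp_all
    qed
  next
    fix \<pi> assume \<pi>: "\<pi> \<in> {\<pi> \<in> inc_partitions \<chi> A. refines A \<pi> \<sigma>}"
    then have ref: "refines A \<pi> \<sigma>" and inc: "\<pi> \<in> inc_partitions \<chi> A" by auto
    show "(\<lambda>V\<in>\<sigma>. {U \<in> \<pi>. U \<subseteq> V}) \<in> ?E"
      using inc inc_partitions_refinement_iff[OF \<sigma> ref] by auto
    show "\<Union>((\<lambda>V\<in>\<sigma>. {U \<in> \<pi>. U \<subseteq> V}) ` \<sigma>) = \<pi>"
      using ref by (fastforce simp: refines_def)
  qed simp
  finally show ?thesis .
qed

lemma one_block_in_INC: "n \<ge> 1 \<Longrightarrow> {{1..n}} \<in> INC n \<chi>"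
  by (auto simp: INC_def noncrossing_def inner_block_def intro: partition_on_space)

lemma partial_order_INC:
  "partial_order_on (INC n \<chi>) {(u, v). u \<in> INC n \<chi> \<and> v \<in> INC n \<chi> \<and> refines {1..n} u v}"
  unfolding partial_order_on_def preorder_on_def
proof (intro conjI)
  show "refl_on (INC n \<chi>) {(u, v). u \<in> INC n \<chi> \<and> v \<in> INC n \<chi> \<and> refines {1..n} u v}"
    by (auto simp: refl_on_def INC_def intro: refines_refl)
  show "trans {(u, v). u \<in> INC n \<chi> \<and> v \<in> INC n \<chi> \<and> refines {1..n} u v}"
    by (auto simp: trans_def intro: refines_trans)
  show "antisym {(u, v). u \<in> INC n \<chi> \<and> v \<in> INC n \<chi> \<and> refines {1..n} u v}"
    unfolding antisym_def using refines_asym by blast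
qed auto

lemma finite_INC: "finite (INC n \<chi>)"
  unfolding INC_eq by (rule finite_inc_partitions) simp

lemma refines_one_block: "\<sigma> \<in> INC n \<chi> \<Longrightarrow> n \<ge> 1 \<Longrightarrow> refines {1..n} \<sigma> {{1..n}}"
  by (auto simp: refines_def INC_def partition_on_def)

text \<open>
  If the moments of all subwords are sums of multiplicative weights over admissible partitions, then
  inserting them into the cumulant and exchanging the sums leaves, for each \<open>\<pi>\<close>, the sum of the
  Moebius function over the interval from \<open>\<pi>\<close> to the top, which is nonzero only at the top.
\<close>

lemma cumulant_of_partition_sums:
  fixes w :: "nat set \<Rightarrow> complex"
  assumes n: "n \<ge> 1"
    and moments: "\<And>V. V \<subseteq> {1..n} \<Longrightarrow>
      \<phi> (prod_list (map x (sorted_list_of_set V))) = (\<Sum>\<pi>\<in>inc_partitions \<chi> V. \<Prod>U\<in>\<pi>. w U)"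
  shows "cumulant \<phi> n \<chi> x = w {1..n}"
proof -
  let ?P = "INC n \<chi>" and ?le = "refines {1..n}"
  let ?m = "\<lambda>\<sigma>. of_int (moebius ?P ?le \<sigma> {{1..n}}) :: complex"
  have "partition_moment \<phi> \<sigma> x = (\<Sum>\<pi>\<in>{\<pi> \<in> ?P. ?le \<pi> \<sigma>}. \<Prod>U\<in>\<pi>. w U)" if \<sigma>: "\<sigma> \<in> ?P" for \<sigma>
  proof -
    have "V \<subseteq> {1..n}" if "V \<in> \<sigma>" for V using that \<sigma> by (auto simp: INC_def partition_on_def)
    then have "partition_moment \<phi> \<sigma> x = (\<Prod>V\<in>\<sigma>. \<Sum>\<pi>\<in>inc_partitions \<chi> V. \<Prod>U\<in>\<pi>. w U)"
      unfolding partition_moment_def using moments by (intro prod.cong) auto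
    then show ?thesis
      using prod_sum_inc_partitions[of "{1..n}" \<sigma> \<chi> w] \<sigma> by (simp add: INC_eq)
  qed
  then have "cumulant \<phi> n \<chi> x = (\<Sum>\<sigma>\<in>?P. ?m \<sigma> * (\<Sum>\<pi>\<in>{\<pi> \<in> ?P. ?le \<pi> \<sigma>}. \<Prod>U\<in>\<pi>. w U))"
    unfolding cumulant_def by simp
  also have "\<dots> = (\<Sum>\<sigma>\<in>?P. \<Sum>\<pi>\<in>?P. if ?le \<pi> \<sigma> then ?m \<sigma> * (\<Prod>U\<in>\<pi>. w U) else 0)"
    unfolding sum_distrib_left sum.inter_filter[OF finite_INC] by (intro sum.cong) auto
  also have "\<dots> = (\<Sum>\<pi>\<in>?P. \<Sum>\<sigma>\<in>?P. if ?le \<pi> \<sigma> then ?m \<sigma> * (\<Prod>U\<in>\<pi>. w U) else 0)"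
    by (rule sum.swap)
  also have "\<dots> = (\<Sum>\<pi>\<in>?P. (if \<pi> = {{1..n}} then 1 else 0) * (\<Prod>U\<in>\<pi>. w U))"
  proof (rule sum.cong[OF refl])
    fix \<pi> assume \<pi>: "\<pi> \<in> ?P"
    have "{\<sigma> \<in> ?P. ?le \<pi> \<sigma>} = {\<sigma> \<in> ?P. ?le \<pi> \<sigma> \<and> ?le \<sigma> {{1..n}}}"
      using refines_one_block n by blast
    then have "(\<Sum>\<sigma>\<in>{\<sigma> \<in> ?P. ?le \<pi> \<sigma>}. ?m \<sigma>) =
        of_int (\<Sum>\<sigma>\<in>{\<sigma> \<in> ?P. ?le \<pi> \<sigma> \<and> ?le \<sigma> {{1..n}}}. moebius ?P ?le \<sigma> {{1..n}})"
      by (simp only: of_int_sum)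
    also have "\<dots> = (if \<pi> = {{1..n}} then 1 else 0)"
      using moebius_sum_upper[OF finite_INC partial_order_INC one_block_in_INC[OF n] \<pi> refines_one_block[OF \<pi> n]]
      by simp
    finally show "(\<Sum>\<sigma>\<in>?P. if ?le \<pi> \<sigma> then ?m \<sigma> * (\<Prod>U\<in>\<pi>. w U) else 0) =
        (if \<pi> = {{1..n}} then 1 else 0) * (\<Prod>U\<in>\<pi>. w U)"
      by (simp only: sum.inter_filter[OF finite_INC, symmetric] sum_distrib_right[symmetric])
  qed
  also have "\<dots> = w {1..n}"
    using one_block_in_INC[OF n] finite_INC by (simp add: if_distrib[of "\<lambda>x. x * _"] cong: if_cong)
  finally show ?thesis .
qed

section \<open>Pairing moments as sums over pair partitions\<close>

text \<open>
  \<open>V\<close> are the positions still to be read and \<open>S\<close> those on the stack, which lie to the right of \<open>V\<close>.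
  Every position on the stack has its partner in \<open>V\<close>.
\<close>

definition open_pairings :: "(nat \<Rightarrow> colour) \<Rightarrow> nat set \<Rightarrow> nat set \<Rightarrow> nat set set set" where
  "open_pairings \<chi> V S =
     {\<pi> \<in> inc_partitions \<chi> (V \<union> S). \<forall>U\<in>\<pi>. card U = 2 \<and> U \<inter> V \<noteq> {}}"

lemma open_pairingsD:
  assumes "\<pi> \<in> open_pairings \<chi> V S"
  shows "partition_on (V \<union> S) \<pi>" "noncrossing \<pi>"
    "\<And>U k. U \<in> \<pi> \<Longrightarrow> inner_block \<pi> U \<Longrightarrow> k \<in> U \<Longrightarrow> \<chi> k \<noteq> Circle"
    "\<And>U. U \<in> \<pi> \<Longrightarrow> card U = 2" "\<And>U. U \<in> \<pi> \<Longrightarrow> U \<inter> V \<noteq> {}"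
  using assms by (auto simp: open_pairings_def inc_partitions_def)

lemma open_pairings_partner:
  assumes "\<pi> \<in> open_pairings \<chi> V S" "q \<in> S" "q \<notin> V"
  obtains b where "b \<in> V" "{b, q} \<in> \<pi>"
proof -
  note D = open_pairingsD[OF assms(1)]
  have "q \<in> \<Union>\<pi>" using D(1) assms(2) by (auto simp: partition_on_def)
  then obtain U where U: "U \<in> \<pi>" "q \<in> U" by blast
  then obtain b where b: "b \<in> U" "b \<in> V" using D(5) by blast
  have "card U = 2" using D(4) U by blast
  then have "U = {b, q}" using b U assms(3) by (auto simp: card_2_iff)
  then show thesis using that b U by simp
qed

context
  fixes \<chi> :: "nat \<Rightarrow> colour" and V S :: "nat set" and m :: nat
  assumes V: "\<And>a. a \<in> V \<Longrightarrow> a < m" and S: "\<And>q. q \<in> S \<Longrightarrow> m < q"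
begin

lemma open_pairings_push_empty:
  assumes "S = {}"
  shows "open_pairings \<chi> (insert m V) S = open_pairings \<chi> V {m}"
proof -
  have meets: "U \<inter> V \<noteq> {}" if "card U = 2" "U \<subseteq> insert m V" for U
    using that by (auto simp: card_2_iff)
  have eq: "insert m V \<union> {} = V \<union> {m}" by simp
  show ?thesis
    unfolding assms open_pairings_def eq
  proof (intro Collect_cong conj_cong refl ball_cong)
    fix \<pi> U assume "\<pi> \<in> inc_partitions \<chi> (V \<union> {m})" "U \<in> \<pi>" "card U = 2"
    then have "U \<subseteq> insert m V" by (auto simp: inc_partitions_def partition_on_def)
    with meets[OF \<open>card U = 2\<close>] show "(U \<inter> insert m V \<noteq> {}) = (U \<inter> V \<noteq> {})" by blast
  qed
qed

context
  fixes p :: nat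
  assumes p: "p \<in> S" and p_min: "\<And>q. q \<in> S \<Longrightarrow> p \<le> q"
begin

text \<open>
  Let \<open>m\<close> be the largest position not yet read and \<open>p\<close> the top of the stack. If \<open>m\<close> is not paired with
  \<open>p\<close>, it is paired with nothing on the stack: a partner beyond \<open>p\<close> would cross the pair of \<open>p\<close>. So
  \<open>m\<close> joins the stack.
\<close>

lemma open_pairings_push:
  "{\<pi> \<in> open_pairings \<chi> (insert m V) S. {m, p} \<notin> \<pi>} = open_pairings \<chi> V (insert m S)"
proof (intro equalityI subsetI)
  fix \<pi> assume \<pi>: "\<pi> \<in> open_pairings \<chi> V (insert m S)"
  have "{m, p} \<inter> V = {}" using V S p by fastforce
  then show "\<pi> \<in> {\<pi> \<in> open_pairings \<chi> (insert m V) S. {m, p} \<notin> \<pi>}"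
    using \<pi> open_pairingsD(5)[OF \<pi>] unfolding open_pairings_def by auto
next
  fix \<pi> assume "\<pi> \<in> {\<pi> \<in> open_pairings \<chi> (insert m V) S. {m, p} \<notin> \<pi>}"
  then have \<pi>: "\<pi> \<in> open_pairings \<chi> (insert m V) S" and mp: "{m, p} \<notin> \<pi>" by auto
  note D = open_pairingsD[OF \<pi>]
  have "U \<inter> V \<noteq> {}" if U: "U \<in> \<pi>" for U
  proof
    assume UV: "U \<inter> V = {}"
    have m: "m \<in> U" using D(5)[OF U] UV by blast
    obtain q where q: "U = {m, q}" "q \<noteq> m" using D(4)[OF U] m by (auto simp: card_2_iff)
    have "q \<in> insert m V \<union> S" using U D(1) q by (auto simp: partition_on_def)
    then have qS: "q \<in> S" using q UV by auto
    have "p \<noteq> q" using mp U q by auto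
    then have pq: "p < q" using p_min[OF qS] by simp
    have "p \<notin> insert m V" using V S p by fastforce
    from open_pairings_partner[OF \<pi> p this]
    obtain b where b: "b \<in> insert m V" "{b, p} \<in> \<pi>" .
    have "b \<noteq> m" using b mp by auto
    then have "b < m" using b V by auto
    moreover have "{b, p} \<noteq> U" using b \<open>b \<noteq> m\<close> m mp S[OF p] by auto
    ultimately show False
      using noncrossingD[OF D(2) b(2) U, of b m p q] pq S[OF p] q by auto
  qed
  then show "\<pi> \<in> open_pairings \<chi> V (insert m S)"
    using \<pi> unfolding open_pairings_def by auto
qed

text \<open>
  The pair of \<open>p\<close> would enclose the pair of \<open>m\<close> or cross it.
\<close>

lemma open_pairings_push_circle:
  assumes "\<chi> m = Circle"
  shows "open_pairings \<chi> V (insert m S) = {}"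
proof (rule equals0I)
  fix \<pi> assume \<pi>: "\<pi> \<in> open_pairings \<chi> V (insert m S)"
  note D = open_pairingsD[OF \<pi>]
  have "m \<notin> V" "p \<notin> V" using V S p by fastforce+
  obtain a where a: "a \<in> V" "{a, m} \<in> \<pi>"
    by (rule open_pairings_partner[OF \<pi> insertI1 \<open>m \<notin> V\<close>])
  obtain b where b: "b \<in> V" "{b, p} \<in> \<pi>"
    by (rule open_pairings_partner[OF \<pi> insertI2[OF p] \<open>p \<notin> V\<close>])
  have ne: "{a, m} \<noteq> {b, p}" using V[OF b(1)] S[OF p] by (auto simp: doubleton_eq_iff)
  then have "a \<noteq> b" using partition_on_same_block[OF D(1) a(2) b(2), of a] by auto
  moreover have "\<not> a < b"
    using noncrossingD[OF D(2) a(2) b(2) ne, of a b m p] V[OF b(1)] S[OF p] by auto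
  ultimately have "b < a" by simp
  then have "inner_block \<pi> {a, m}"
    unfolding inner_block_def using b V[OF a(1)] V[OF b(1)] S[OF p]
    by (intro bexI[of _ "{b, p}"] bexI[of _ b] bexI[of _ p]) auto
  then show False using D(3)[OF a(2), of m] assms by simp
qed

text \<open>
  Any further position on the stack would belong to a pair enclosing \<open>m\<close> and \<open>p\<close>.
\<close>

lemma open_pairings_pop_circle:
  assumes "\<chi> m = Circle" "S \<noteq> {p}"
  shows "{\<pi> \<in> open_pairings \<chi> (insert m V) S. {m, p} \<in> \<pi>} = {}"
proof (rule equals0I)
  fix \<pi> assume "\<pi> \<in> {\<pi> \<in> open_pairings \<chi> (insert m V) S. {m, p} \<in> \<pi>}"
  then have \<pi>: "\<pi> \<in> open_pairings \<chi> (insert m V) S" and mp: "{m, p} \<in> \<pi>" by auto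
  note D = open_pairingsD[OF \<pi>]
  obtain q where q: "q \<in> S" "q \<noteq> p" using assms(2) p by blast
  then have pq: "p < q" using p_min[of q] by simp
  have "q \<notin> insert m V" using V S q by fastforce
  from open_pairings_partner[OF \<pi> q(1) this]
  obtain b where b: "b \<in> insert m V" "{b, q} \<in> \<pi>" .
  have "{b, q} \<noteq> {m, p}" using q S[OF q(1)] by (auto simp: doubleton_eq_iff)
  then have "b \<noteq> m" using partition_on_same_block[OF D(1) b(2) mp, of m] by auto
  then have "b < m" using b V by auto
  then have "inner_block \<pi> {m, p}"
    unfolding inner_block_def using b S[OF p] pq
    by (intro bexI[of _ "{b, q}"] bexI[of _ b] bexI[of _ q]) auto
  then show False using D(3)[OF mp, of m] assms by simp
qed

text \<open>
  Nothing lies between \<open>m\<close> and \<open>p\<close>, so their pair crosses and encloses nothing and can be added or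
  removed freely. It is inner exactly when the stack has a further element; the two assumptions keep
  Circles out of it in that case.
\<close>

lemma open_pairings_pop:
  assumes "\<chi> m = Circle \<Longrightarrow> S = {p}" and "\<And>q. q \<in> S \<Longrightarrow> p < q \<Longrightarrow> \<chi> p \<noteq> Circle"
  shows "{\<pi> \<in> open_pairings \<chi> (insert m V) S. {m, p} \<in> \<pi>} = insert {m, p} ` open_pairings \<chi> V (S - {p})"
proof (intro equalityI subsetI)
  fix \<pi> assume "\<pi> \<in> {\<pi> \<in> open_pairings \<chi> (insert m V) S. {m, p} \<in> \<pi>}"
  then have \<pi>: "\<pi> \<in> open_pairings \<chi> (insert m V) S" and mp: "{m, p} \<in> \<pi>" by auto
  note D = open_pairingsD[OF \<pi>]
  let ?\<rho> = "\<pi> - {{m, p}}"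
  have other: "U \<inter> {m, p} = {}" if "U \<in> ?\<rho>" for U
    using that partition_on_same_block[OF D(1) _ mp] by blast
  have "\<Union>?\<rho> = V \<union> (S - {p})"
  proof -
    have "A = B - M" if "B = A \<union> M" "A \<inter> M = {}" for A B M :: "nat set" using that by blast
    moreover have "\<Union>\<pi> = \<Union>?\<rho> \<union> {m, p}" using mp by blast
    moreover have "\<Union>?\<rho> \<inter> {m, p} = {}" using other by blast
    ultimately have "\<Union>?\<rho> = \<Union>\<pi> - {m, p}" by blast
    also have "\<dots> = (insert m V \<union> S) - {m, p}" using D(1) by (simp add: partition_on_def)
    also have "\<dots> = V \<union> (S - {p})"
    proof -
      have "m \<notin> V" "p \<notin> V" "m \<notin> S" using V S p by fastforce+
      then show ?thesis by auto
    qed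
    finally show ?thesis .
  qed
  moreover have "disjoint ?\<rho>" "{} \<notin> ?\<rho>"
    using D(1) by (auto simp: partition_on_def intro: pairwise_subset)
  ultimately have "partition_on (V \<union> (S - {p})) ?\<rho>" by (simp add: partition_on_def)
  moreover have "noncrossing ?\<rho>" by (rule noncrossing_subset[OF D(2)]) blast
  moreover have "\<chi> k \<noteq> Circle" if "U \<in> ?\<rho>" "inner_block ?\<rho> U" "k \<in> U" for U k
    using D(3)[of U k] that inner_block_mono[of ?\<rho> U \<pi>] by blast
  moreover have "card U = 2 \<and> U \<inter> V \<noteq> {}" if "U \<in> ?\<rho>" for U
    using D(4,5)[of U] other[OF that] that by blast
  ultimately have "?\<rho> \<in> open_pairings \<chi> V (S - {p})"
    unfolding open_pairings_def inc_partitions_def by blast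
  moreover have "\<pi> = insert {m, p} ?\<rho>" using mp by blast
  ultimately show "\<pi> \<in> insert {m, p} ` open_pairings \<chi> V (S - {p})" by blast
next
  fix \<pi> assume "\<pi> \<in> insert {m, p} ` open_pairings \<chi> V (S - {p})"
  then obtain \<rho> where \<rho>: "\<rho> \<in> open_pairings \<chi> V (S - {p})" and \<pi>: "\<pi> = insert {m, p} \<rho>" by blast
  note D = open_pairingsD[OF \<rho>]
  have mp: "m < p" using S[OF p] .
  have sub: "U \<subseteq> V \<union> (S - {p})" if "U \<in> \<rho>" for U using that D(1) by (auto simp: partition_on_def)
  have gap: "k < m \<or> p < k" if "U \<in> \<rho>" "k \<in> U" for U k
  proof -
    have "k \<in> V \<or> k \<in> S \<and> k \<noteq> p" using sub[OF that(1)] that(2) by blast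
    then show ?thesis using V[of k] p_min[of k] by force
  qed
  have "partition_on (insert m V \<union> S) \<pi>"
  proof -
    have "\<Union>\<pi> = insert m V \<union> S" using D(1) p by (auto simp: partition_on_def \<pi>)
    moreover have "disjnt U {m, p}" if "U \<in> \<rho>" for U
      using gap[OF that, of m] gap[OF that, of p] mp by (auto simp: disjnt_def)
    then have "disjoint \<pi>"
      using D(1) unfolding \<pi> by (auto simp: partition_on_def pairwise_insert disjnt_sym)
    ultimately show ?thesis
      using D(1) unfolding \<pi> by (simp add: partition_on_def)
  qed
  moreover have "noncrossing \<pi>"
  proof (rule noncrossingI)
    fix U W a b c d
    assume h: "U \<in> \<pi>" "W \<in> \<pi>" "U \<noteq> W" "a < b" "b < c" "c < d" "a \<in> U" "c \<in> U" "b \<in> W" "d \<in> W"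
    consider "U \<in> \<rho>" "W \<in> \<rho>" | "U = {m, p}" "W \<in> \<rho>" | "U \<in> \<rho>" "W = {m, p}"
      using h(1-3) unfolding \<pi> by (elim insertE) auto
    then show False
    proof cases
      case 1
      then show False using noncrossingD[OF D(2) 1 h(3-10)] by simp
    next
      case 2
      have "a \<in> {m, p}" "c \<in> {m, p}" "a < c" using 2(1) h(4,5,7,8) by auto
      then have "a = m" "c = p" using mp by auto
      then show False using gap[OF 2(2) h(9)] h by simp
    next
      case 3
      have "b \<in> {m, p}" "d \<in> {m, p}" "b < d" using 3(2) h(5,6,9,10) by auto
      then have "b = m" "d = p" using mp by auto
      then show False using gap[OF 3(1) h(8)] h by simp
    qed
  qed
  moreover have "\<chi> k \<noteq> Circle" if h: "U \<in> \<pi>" "inner_block \<pi> U" "k \<in> U" for U k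
  proof -
    obtain W s t where W: "W \<in> \<pi>" "s \<in> W" "t \<in> W" "\<And>v. v \<in> U \<Longrightarrow> s < v \<and> v < t"
      using h(2) by (auto simp: inner_block_def)
    show ?thesis
    proof (cases "U = {m, p}")
      case True
      have t: "p < t" "s < m" using W(4) True by auto
      then have "W \<in> \<rho>" using W \<pi> mp by auto
      then have "t \<in> S" "t \<noteq> p" using sub[of W] W(3) t V[of t] mp by auto
      then have "S \<noteq> {p}" "\<chi> p \<noteq> Circle" using assms(2)[of t] t by auto
      then show ?thesis using assms(1) True h(3) by auto
    next
      case False
      then have U: "U \<in> \<rho>" using h \<pi> by simp
      have "W \<noteq> {m, p}"
      proof
        assume "W = {m, p}"
        then have "m \<le> s" "t \<le> p" using W(2,3) mp by auto
        then show False using gap[OF U h(3)] W(4)[OF h(3)] by linarith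
      qed
      then have "W \<in> \<rho>" using W \<pi> by simp
      then have "inner_block \<rho> U" using W by (auto simp: inner_block_def)
      then show ?thesis using D(3)[OF U] h(3) by simp
    qed
  qed
  moreover have "card U = 2 \<and> U \<inter> insert m V \<noteq> {}" if "U \<in> \<pi>" for U
    using that D(4,5)[of U] mp \<pi> by (auto simp: card_2_iff)
  ultimately show "\<pi> \<in> {\<pi> \<in> open_pairings \<chi> (insert m V) S. {m, p} \<in> \<pi>}"
    unfolding open_pairings_def inc_partitions_def using \<pi> by blast
qed

end

end

definition pair_weight :: "('k \<Rightarrow> 'k \<Rightarrow> complex) \<Rightarrow> (nat \<Rightarrow> 'k) \<Rightarrow> nat set \<Rightarrow> complex" where
  "pair_weight C \<beta> U = (if card U = 2 then C (\<beta> (Min U)) (\<beta> (Max U)) else 0)"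

lemma finite_open_pairings: "finite V \<Longrightarrow> finite S \<Longrightarrow> finite (open_pairings \<chi> V S)"
  unfolding open_pairings_def using finite_inc_partitions[of "V \<union> S"] by simp

text \<open>
  The largest unread position is either pushed or paired with the top of the stack, just as in the
  recursion for pairing moments. The last assumption is an invariant: a letter in \<open>J\<close> enters
  only the empty stack, so it can only sit at its bottom.
\<close>

lemma pairing_moment_eq_sum_open_pairings:
  assumes "finite V" "sorted_wrt (<) st" "\<And>a q. a \<in> V \<Longrightarrow> q \<in> set st \<Longrightarrow> a < q"
    and "\<And>p q. p \<in> set st \<Longrightarrow> q \<in> set st \<Longrightarrow> p < q \<Longrightarrow> \<beta> p \<notin> J"
  shows "pairing_moment (\<lambda>k. k \<in> J) C (rev (map \<beta> (sorted_list_of_set V))) (map \<beta> st) =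
    (\<Sum>\<pi>\<in>open_pairings (face_colour J \<circ> \<beta>) V (set st). \<Prod>U\<in>\<pi>. pair_weight C \<beta> U)"
  using assms
proof (induction V arbitrary: st rule: finite_linorder_max_induct)
  case empty
  show ?case
  proof (cases st)
    case Nil
    have eq: "open_pairings (face_colour J \<circ> \<beta>) {} {} = {{}}"
      by (auto simp: open_pairings_def inc_partitions_def partition_on_empty noncrossing_def)
    show ?thesis unfolding Nil list.set eq by simp
  next
    case (Cons p st')
    have eq: "open_pairings (face_colour J \<circ> \<beta>) {} (set st) = {}"
      using Cons by (auto simp: open_pairings_def inc_partitions_def partition_on_def)
    show ?thesis unfolding eq using Cons by simp
  qed
next
  case (insert m V)
  let ?\<chi> = "face_colour J \<circ> \<beta>"
  let ?w = "\<lambda>\<pi>. \<Prod>U\<in>\<pi>. pair_weight C \<beta> U"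
  let ?r = "rev (map \<beta> (sorted_list_of_set V))"
  let ?P = "pairing_moment (\<lambda>k. k \<in> J) C"
  have Vm: "\<And>a. a \<in> V \<Longrightarrow> a < m" using insert.hyps by blast
  have Sm: "\<And>q. q \<in> set st \<Longrightarrow> m < q" using insert.prems by blast
  have circ: "?\<chi> k = Circle \<longleftrightarrow> \<beta> k \<in> J" for k by (simp add: face_colour_def)
  have "m \<notin> V" using Vm by blast
  then have "sorted_list_of_set (insert m V) = sorted_list_of_set V @ [m]"
    by (intro sorted_list_of_set_unique[THEN iffD1])
      (use insert.hyps(1) Vm in \<open>auto simp: sorted_wrt_append strict_sorted_list_of_set\<close>)
  then have r: "rev (map \<beta> (sorted_list_of_set (insert m V))) = \<beta> m # ?r" by simp
  have push: "?P ?r (map \<beta> (m # st)) = (\<Sum>\<pi>\<in>open_pairings ?\<chi> V (insert m (set st)). ?w \<pi>)"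
    if "st \<noteq> [] \<Longrightarrow> \<beta> m \<notin> J"
  proof -
    have "?P ?r (map \<beta> (m # st)) = (\<Sum>\<pi>\<in>open_pairings ?\<chi> V (set (m # st)). ?w \<pi>)"
    proof (rule insert.IH)
      show "sorted_wrt (<) (m # st)" using insert.prems(1) Sm by simp
      show "a < q" if "a \<in> V" "q \<in> set (m # st)" for a q
        using that Vm insert.prems(2) by auto
      show "\<beta> p \<notin> J" if "p \<in> set (m # st)" "q \<in> set (m # st)" "p < q" for p q
        using that \<open>st \<noteq> [] \<Longrightarrow> \<beta> m \<notin> J\<close> insert.prems(3)[of p q] Sm by (cases st) fastforce+
    qed
    then show ?thesis by simp
  qed
  show ?case
  proof (cases st)
    case Nil
    have eq: "open_pairings ?\<chi> (insert m V) {} = open_pairings ?\<chi> V {m}"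
      by (rule open_pairings_push_empty) (use Vm in auto)
    show ?thesis unfolding r Nil list.set eq using push Nil by simp
  next
    case (Cons p st')
    have p: "p \<in> set st" "\<And>q. q \<in> set st \<Longrightarrow> p \<le> q" and p': "p \<notin> set st'"
      using insert.prems(1) Cons by auto
    have S': "set st - {p} = set st'" using Cons p' by auto
    have S1: "set st = {p} \<longleftrightarrow> st' = []" using Cons p' by (cases st') auto
    note ctx = Vm Sm p
    let ?O = "open_pairings ?\<chi> (insert m V) (set st)"
    have finO: "finite ?O" using insert.hyps by (simp add: finite_open_pairings)
    have split: "(\<Sum>\<pi>\<in>?O. ?w \<pi>) = (\<Sum>\<pi>\<in>{\<pi> \<in> ?O. {m, p} \<notin> \<pi>}. ?w \<pi>) + (\<Sum>\<pi>\<in>{\<pi> \<in> ?O. {m, p} \<in> \<pi>}. ?w \<pi>)"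
    proof -
      have "?O = {\<pi> \<in> ?O. {m, p} \<notin> \<pi>} \<union> {\<pi> \<in> ?O. {m, p} \<in> \<pi>}" by blast
      then show ?thesis using finO by (subst sum.union_disjoint[symmetric]) auto
    qed
    have 1: "(\<Sum>\<pi>\<in>{\<pi> \<in> ?O. {m, p} \<notin> \<pi>}. ?w \<pi>) = (if \<beta> m \<in> J then 0 else ?P ?r (\<beta> m # map \<beta> st))"
    proof (cases "\<beta> m \<in> J")
      case True
      have eqp: "{\<pi> \<in> ?O. {m, p} \<notin> \<pi>} = open_pairings ?\<chi> V (insert m (set st))"
        by (rule open_pairings_push[OF ctx])
      from True have eq: "open_pairings ?\<chi> V (insert m (set st)) = {}"
        by (intro open_pairings_push_circle[OF ctx] circ[THEN iffD2])
      show ?thesis unfolding eqp eq using True by simp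
    next
      case False
      have eqp: "{\<pi> \<in> ?O. {m, p} \<notin> \<pi>} = open_pairings ?\<chi> V (insert m (set st))"
        by (rule open_pairings_push[OF ctx])
      show ?thesis unfolding eqp using push[OF False] False by simp
    qed
    have 2: "(\<Sum>\<pi>\<in>{\<pi> \<in> ?O. {m, p} \<in> \<pi>}. ?w \<pi>) =
        (if \<beta> m \<in> J \<and> st' \<noteq> [] then 0 else C (\<beta> m) (\<beta> p) * ?P ?r (map \<beta> st'))"
    proof (cases "\<beta> m \<in> J \<and> st' \<noteq> []")
      case True
      then have "{\<pi> \<in> ?O. {m, p} \<in> \<pi>} = {}"
        using S1 by (intro open_pairings_pop_circle[OF ctx] circ[THEN iffD2]) auto
      then show ?thesis using True by (simp only: sum.empty) simp
    next
      case False
      have pop: "{\<pi> \<in> ?O. {m, p} \<in> \<pi>} = insert {m, p} ` open_pairings ?\<chi> V (set st')"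
        unfolding S'[symmetric]
      proof (rule open_pairings_pop[OF ctx])
        show "set st = {p}" if "?\<chi> m = Circle" using that False circ S1 by blast
        show "?\<chi> p \<noteq> Circle" if "q \<in> set st" "p < q" for q
          using insert.prems(3)[OF p(1) that] circ by blast
      qed
      have mp: "m < p" using Sm p by blast
      have notin: "{m, p} \<notin> \<rho>" if "\<rho> \<in> open_pairings ?\<chi> V (set st')" for \<rho>
      proof
        assume "{m, p} \<in> \<rho>"
        then have "m \<in> V \<union> set st'" using open_pairingsD(1)[OF that] by (auto simp: partition_on_def)
        then show False using Vm Sm Cons by auto
      qed
      have "inj_on (insert {m, p}) (open_pairings ?\<chi> V (set st'))"
        using notin by (auto simp: inj_on_def insert_ident)
      then have "(\<Sum>\<pi>\<in>{\<pi> \<in> ?O. {m, p} \<in> \<pi>}. ?w \<pi>) =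
          (\<Sum>\<rho>\<in>open_pairings ?\<chi> V (set st'). ?w (insert {m, p} \<rho>))"
        unfolding pop by (simp add: sum.reindex)
      also have "\<dots> = (\<Sum>\<rho>\<in>open_pairings ?\<chi> V (set st'). C (\<beta> m) (\<beta> p) * ?w \<rho>)"
      proof (rule sum.cong[OF refl])
        fix \<rho> assume \<rho>: "\<rho> \<in> open_pairings ?\<chi> V (set st')"
        have "finite \<rho>"
          using open_pairingsD(1)[OF \<rho>] insert.hyps
          by (auto simp: partition_on_def intro: finite_UnionD)
        moreover have "pair_weight C \<beta> {m, p} = C (\<beta> m) (\<beta> p)"
          using mp by (simp add: pair_weight_def)
        ultimately show "?w (insert {m, p} \<rho>) = C (\<beta> m) (\<beta> p) * ?w \<rho>" using notin[OF \<rho>] by simp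
      qed
      also have "\<dots> = C (\<beta> m) (\<beta> p) * ?P ?r (map \<beta> st')"
        unfolding sum_distrib_left[symmetric]
      proof (rule arg_cong[where f = "(*) _"], rule insert.IH[symmetric])
        show "sorted_wrt (<) st'" using insert.prems(1) Cons by simp
        show "a < q" if "a \<in> V" "q \<in> set st'" for a q using insert.prems(2)[of a q] that Cons by simp
        show "\<beta> p \<notin> J" if "p \<in> set st'" "q \<in> set st'" "p < q" for p q
          using insert.prems(3)[of p q] that Cons by simp
      qed
      finally show ?thesis using False by auto
    qed
    have "?P (\<beta> m # ?r) (map \<beta> st) =
        (if \<beta> m \<in> J then 0 else ?P ?r (\<beta> m # map \<beta> st)) +
        (if \<beta> m \<in> J \<and> st' \<noteq> [] then 0 else C (\<beta> m) (\<beta> p) * ?P ?r (map \<beta> st'))"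
      using Cons by simp
    then show ?thesis unfolding r split 1 2 .
  qed
qed

text \<open>
  With empty stack, the open pairings are the admissible pair partitions, and all other admissible
  partitions have weight zero.
\<close>

lemma pairing_moment_eq_sum_inc_partitions:
  assumes "finite V"
  shows "pairing_moment (\<lambda>k. k \<in> J) C (rev (map \<beta> (sorted_list_of_set V))) [] =
    (\<Sum>\<pi>\<in>inc_partitions (face_colour J \<circ> \<beta>) V. \<Prod>U\<in>\<pi>. pair_weight C \<beta> U)"
proof -
  let ?\<chi> = "face_colour J \<circ> \<beta>"
  have "pairing_moment (\<lambda>k. k \<in> J) C (rev (map \<beta> (sorted_list_of_set V))) [] =
      (\<Sum>\<pi>\<in>open_pairings ?\<chi> V {}. \<Prod>U\<in>\<pi>. pair_weight C \<beta> U)"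
    using pairing_moment_eq_sum_open_pairings[OF assms, of "[]" \<beta> J C] by simp
  also have "\<dots> = (\<Sum>\<pi>\<in>inc_partitions ?\<chi> V. \<Prod>U\<in>\<pi>. pair_weight C \<beta> U)"
  proof (rule sum.mono_neutral_left)
    show "finite (inc_partitions ?\<chi> V)" using assms by (rule finite_inc_partitions)
    show "open_pairings ?\<chi> V {} \<subseteq> inc_partitions ?\<chi> V" by (auto simp: open_pairings_def)
    show "\<forall>\<pi>\<in>inc_partitions ?\<chi> V - open_pairings ?\<chi> V {}. (\<Prod>U\<in>\<pi>. pair_weight C \<beta> U) = 0"
    proof
      fix \<pi> assume h: "\<pi> \<in> inc_partitions ?\<chi> V - open_pairings ?\<chi> V {}"
      then have part: "partition_on V \<pi>" by (simp add: inc_partitions_def)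
      have "\<exists>U\<in>\<pi>. card U \<noteq> 2"
      proof (rule ccontr)
        assume "\<not> (\<exists>U\<in>\<pi>. card U \<noteq> 2)"
        moreover have "U \<inter> V \<noteq> {}" if U: "U \<in> \<pi>" for U
        proof -
          have "U \<subseteq> V" "U \<noteq> {}" using part U by (auto simp: partition_on_def)
          then show ?thesis by blast
        qed
        ultimately have "\<pi> \<in> open_pairings ?\<chi> V {}"
          using h by (simp add: open_pairings_def)
        then show False using h by blast
      qed
      moreover have "finite \<pi>" using part assms by (auto simp: partition_on_def intro: finite_UnionD)
      ultimately show "(\<Prod>U\<in>\<pi>. pair_weight C \<beta> U) = 0"
        by (auto simp: pair_weight_def intro!: prod_zero)
    qed
  qed
  finally show ?thesis .
qed

section \<open>The free-Boolean central limit distribution\<close>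

lemma lookup_nc_scale: "Poly_Mapping.lookup (nc_scale c P) w = c * Poly_Mapping.lookup P w"
  by (simp add: nc_scale_def Poly_Mapping.map.rep_eq when_def)

lemma nc_scale_single: "nc_scale c (Poly_Mapping.single w a) = Poly_Mapping.single w (c * a)"
  by (rule poly_mapping_eqI) (simp add: lookup_nc_scale lookup_single when_def)

lemma keys_nc_scale: "Poly_Mapping.keys (nc_scale c P) \<subseteq> Poly_Mapping.keys P"
  by (auto simp: in_keys_iff lookup_nc_scale)

lemma single_Nil: "Poly_Mapping.single [] (1 :: complex) = 1"
  by (metis single_one zero_list_def)

lemma prod_list_nc_var: "prod_list (map nc_var ws) = Poly_Mapping.single ws 1"
proof (induction ws)
  case Nil
  show ?case by (simp add: single_Nil)
next
  case (Cons k ws)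
  then show ?case by (simp add: nc_var_def mult_single plus_list_def)
qed

lemma nc_polys_single: "w \<in> lists K \<Longrightarrow> Poly_Mapping.single w c \<in> nc_polys K"
  by (auto simp: nc_polys_def)

lemma nc_polys_add: "P \<in> nc_polys K \<Longrightarrow> Q \<in> nc_polys K \<Longrightarrow> P + Q \<in> nc_polys K"
  using keys_add[of P Q] by (auto simp: nc_polys_def)

lemma nc_polys_scale: "P \<in> nc_polys K \<Longrightarrow> nc_scale c P \<in> nc_polys K"
  using keys_nc_scale[of c P] by (auto simp: nc_polys_def)

text \<open>
  The monomials form a basis of the noncommutative polynomials.
\<close>

lemma linear_on_nc_polys_expand:
  assumes \<Gamma>: "linear_on nc_scale (*) (nc_polys K) \<Gamma>" and P: "P \<in> nc_polys K"
  shows "\<Gamma> P = (\<Sum>w\<in>Poly_Mapping.keys P. Poly_Mapping.lookup P w * \<Gamma> (Poly_Mapping.single w 1))"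
proof -
  have fin: "(\<Sum>w\<in>A. Poly_Mapping.single w (c w)) \<in> nc_polys K \<and>
      \<Gamma> (\<Sum>w\<in>A. Poly_Mapping.single w (c w)) = (\<Sum>w\<in>A. c w * \<Gamma> (Poly_Mapping.single w 1))"
    if "finite A" "A \<subseteq> lists K" for A c
    using that
  proof (induction rule: finite_induct)
    case empty
    have "(0 :: 'a nc_poly) \<in> nc_polys K" by (simp add: nc_polys_def)
    then show ?case using linear_on_zero[OF \<Gamma>] by simp
  next
    case (insert w A)
    have w: "Poly_Mapping.single w (c w) = nc_scale (c w) (Poly_Mapping.single w 1)"
      by (simp add: nc_scale_single)
    have "\<Gamma> (Poly_Mapping.single w (c w)) = c w * \<Gamma> (Poly_Mapping.single w 1)"
      unfolding w using insert.prems by (intro linear_onD(2)[OF \<Gamma>] nc_polys_single) simp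
    then show ?case
      using insert nc_polys_single[of w K "c w"]
      by (simp add: linear_onD(1)[OF \<Gamma>] nc_polys_add)
  qed
  have "P = (\<Sum>w\<in>Poly_Mapping.keys P. Poly_Mapping.single w (Poly_Mapping.lookup P w))"
    by (rule poly_mapping_eqI)
      (simp add: lookup_sum lookup_single when_def in_keys_iff)
  with fin[of "Poly_Mapping.keys P" "Poly_Mapping.lookup P"] P show ?thesis
    by (simp add: nc_polys_def)
qed

text \<open>
  The moment of the whole word enters its cumulant with coefficient one, through the one-block
  partition; every other partition involves proper subwords only.
\<close>

lemma cumulant_determines_top_moment:
  assumes n: "n \<ge> 1" and eq: "cumulant \<phi> n \<chi> x = cumulant \<psi> n \<chi> x"
    and lower: "\<And>V. V \<subset> {1..n} \<Longrightarrow>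
      \<phi> (prod_list (map x (sorted_list_of_set V))) = \<psi> (prod_list (map x (sorted_list_of_set V)))"
  shows "\<phi> (prod_list (map x (sorted_list_of_set {1..n}))) = \<psi> (prod_list (map x (sorted_list_of_set {1..n})))"
proof -
  let ?P = "INC n \<chi>"
  let ?m = "\<lambda>\<sigma>. of_int (moebius ?P (refines {1..n}) \<sigma> {{1..n}}) :: complex"
  have one: "{{1..n}} \<in> ?P" by (rule one_block_in_INC[OF n])
  have split: "cumulant \<theta> n \<chi> x = \<theta> (prod_list (map x (sorted_list_of_set {1..n}))) +
      (\<Sum>\<sigma>\<in>?P - {{{1..n}}}. ?m \<sigma> * partition_moment \<theta> \<sigma> x)" for \<theta>
  proof -
    have "?m {{1..n}} = 1"
      using one refines_one_block[OF one n] finite_INC partial_order_INC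
      by (subst moebius.simps) (simp only: simp_thms if_True of_int_1)
    then have "?m {{1..n}} * partition_moment \<theta> {{1..n}} x = \<theta> (prod_list (map x (sorted_list_of_set {1..n})))"
      by (simp add: partition_moment_def)
    then show ?thesis
      unfolding cumulant_def by (subst sum.remove[OF finite_INC one]) simp
  qed
  have "partition_moment \<phi> \<sigma> x = partition_moment \<psi> \<sigma> x" if \<sigma>: "\<sigma> \<in> ?P - {{{1..n}}}" for \<sigma>
    unfolding partition_moment_def
  proof (rule prod.cong[OF refl])
    fix V assume V: "V \<in> \<sigma>"
    have part: "partition_on {1..n} \<sigma>" using \<sigma> by (auto simp: INC_def)
    have "V \<subseteq> {1..n}" using part V by (auto simp: partition_on_def)
    moreover have "V \<noteq> {1..n}"
    proof
      assume eqV: "V = {1..n}"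
      have "W = V" if W: "W \<in> \<sigma>" for W
      proof -
        have "W \<subseteq> V" "W \<noteq> {}" using part W eqV by (auto simp: partition_on_def)
        then obtain a where "a \<in> W" "a \<in> V" by blast
        then show ?thesis using partition_on_same_block[OF part W V] by blast
      qed
      then have "\<sigma> = {{1..n}}" using V eqV by blast
      then show False using \<sigma> by simp
    qed
    ultimately show "\<phi> (prod_list (map x (sorted_list_of_set V))) = \<psi> (prod_list (map x (sorted_list_of_set V)))"
      by (intro lower) blast
  qed
  then have "(\<Sum>\<sigma>\<in>?P - {{{1..n}}}. ?m \<sigma> * partition_moment \<phi> \<sigma> x) =
      (\<Sum>\<sigma>\<in>?P - {{{1..n}}}. ?m \<sigma> * partition_moment \<psi> \<sigma> x)" by simp
  then show ?thesis using eq unfolding split by simp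
qed

text \<open>
  Outside the polynomials in the variables of \<open>I \<union> J\<close> the value is \<open>undefined\<close>, as for
  \<open>free_boolean_clt\<close>.
\<close>

definition pairing_functional :: "'k set \<Rightarrow> 'k set \<Rightarrow> ('k \<Rightarrow> 'k \<Rightarrow> complex) \<Rightarrow> 'k nc_poly \<Rightarrow> complex" where
  "pairing_functional I J C = restrict
     (\<lambda>P. \<Sum>w\<in>Poly_Mapping.keys P. Poly_Mapping.lookup P w * pairing_moment (\<lambda>k. k \<in> J) C (rev w) [])
     (nc_polys (I \<union> J))"

lemma pairing_functional_single:
  "w \<in> lists (I \<union> J) \<Longrightarrow> pairing_functional I J C (Poly_Mapping.single w 1) = pairing_moment (\<lambda>k. k \<in> J) C (rev w) []"
  by (simp add: pairing_functional_def nc_polys_single)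

lemma linear_pairing_functional: "linear_on nc_scale (*) (nc_polys (I \<union> J)) (pairing_functional I J C)"
proof -
  let ?K = "I \<union> J" and ?g = "\<lambda>w. pairing_moment (\<lambda>k. k \<in> J) C (rev w) []"
  have on: "pairing_functional I J C P = (\<Sum>w\<in>A. Poly_Mapping.lookup P w * ?g w)"
    if "P \<in> nc_polys ?K" "finite A" "Poly_Mapping.keys P \<subseteq> A" for P A
    unfolding pairing_functional_def using that
    by (simp, intro sum.mono_neutral_left) (auto simp: in_keys_iff)
  show ?thesis
    unfolding linear_on_def
  proof (intro conjI ballI allI)
    fix P Q assume PQ: "P \<in> nc_polys ?K" "Q \<in> nc_polys ?K"
    let ?A = "Poly_Mapping.keys P \<union> Poly_Mapping.keys Q"
    have "finite ?A" "Poly_Mapping.keys (P + Q) \<subseteq> ?A" using keys_add[of P Q] by auto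
    with PQ show "pairing_functional I J C (P + Q) = pairing_functional I J C P + pairing_functional I J C Q"
      using on[of P ?A] on[of Q ?A] on[of "P + Q" ?A] nc_polys_add[OF PQ]
      by (simp add: lookup_add distrib_right sum.distrib)
  next
    fix c P assume P: "P \<in> nc_polys ?K"
    show "pairing_functional I J C (nc_scale c P) = c * pairing_functional I J C P"
      using on[of P "Poly_Mapping.keys P"] on[of "nc_scale c P" "Poly_Mapping.keys P"]
        nc_polys_scale[OF P] P keys_nc_scale[of c P]
      by (simp add: lookup_nc_scale sum_distrib_left mult.assoc)
  qed
qed

lemma cumulant_pairing_functional:
  assumes n: "n \<ge> 1" and \<beta>: "\<beta> ` {1..n} \<subseteq> I \<union> J"
  shows "cumulant (pairing_functional I J C) n (face_colour J \<circ> \<beta>) (nc_var \<circ> \<beta>) = pair_weight C \<beta> {1..n}"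
proof (rule cumulant_of_partition_sums[OF n])
  fix V assume V: "V \<subseteq> {1..n}"
  then have fin: "finite V" by (rule finite_subset) simp
  have "\<beta> i \<in> I \<union> J" if "i \<in> V" for i using that V \<beta> by blast
  then have "map \<beta> (sorted_list_of_set V) \<in> lists (I \<union> J)"
    using fin by (simp add: in_lists_conv_set)
  then show "pairing_functional I J C (prod_list (map (nc_var \<circ> \<beta>) (sorted_list_of_set V))) =
      (\<Sum>\<pi>\<in>inc_partitions (face_colour J \<circ> \<beta>) V. \<Prod>U\<in>\<pi>. pair_weight C \<beta> U)"
    unfolding map_map[symmetric] prod_list_nc_var pairing_moment_eq_sum_inc_partitions[OF fin, symmetric]
    by (rule pairing_functional_single)
qed

lemma word_as_positions:
  "map (\<lambda>i. w ! (i - 1)) (sorted_list_of_set {1..length w}) = w"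
proof -
  have "sorted_list_of_set {1..length w} = map Suc [0..<length w]"
    by (simp add: map_Suc_upt flip: atLeastLessThanSuc_atLeastAtMost)
  then show ?thesis by (simp add: comp_def map_nth)
qed

text \<open>
  Induction on the length: the cumulants of both functionals agree, hence so do the moments, once
  those of the shorter words do.
\<close>

lemma clt_distribution_word:
  assumes lin: "linear_on nc_scale (*) (nc_polys (I \<union> J)) \<Gamma>" and one: "\<Gamma> 1 = 1"
    and clt: "has_free_boolean_clt_distribution \<Gamma> I J nc_var"
    and cov: "\<And>k l. k \<in> I \<union> J \<Longrightarrow> l \<in> I \<union> J \<Longrightarrow> \<Gamma> (nc_var k * nc_var l) = C k l"
    and w: "w \<in> lists (I \<union> J)"
  shows "\<Gamma> (Poly_Mapping.single w 1) = pairing_functional I J C (Poly_Mapping.single w 1)"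
  using w
proof (induction "length w" arbitrary: w rule: less_induct)
  case less
  let ?n = "length w" and ?\<beta> = "\<lambda>i. w ! (i - 1)" and ?\<Phi> = "pairing_functional I J C"
  have \<beta>: "?\<beta> ` {1..?n} \<subseteq> I \<union> J" using less.prems by (force simp: in_lists_conv_set)
  consider "?n = 0" | "?n = 2" | "?n \<ge> 1" "?n \<noteq> 2" by linarith
  then show ?case
  proof cases
    case 1
    then have "w = []" by simp
    then show ?thesis
      using one pairing_functional_single[of "[]" I J C] by (simp add: single_Nil)
  next
    case 2
    then obtain k l where kl: "w = [k, l]" by (auto simp: numeral_2_eq_2 length_Suc_conv)
    have "nc_var k * nc_var l = Poly_Mapping.single w 1"
      using prod_list_nc_var[of w] by (simp add: kl)
    moreover have "k \<in> I \<union> J" "l \<in> I \<union> J" using less.prems kl by auto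
    ultimately show ?thesis
      using cov[of k l] pairing_functional_single[OF less.prems] by (simp add: kl)
  next
    case 3
    have cum: "cumulant \<Gamma> ?n (face_colour J \<circ> ?\<beta>) (nc_var \<circ> ?\<beta>) =
        cumulant ?\<Phi> ?n (face_colour J \<circ> ?\<beta>) (nc_var \<circ> ?\<beta>)"
      using clt 3 \<beta> cumulant_pairing_functional[OF 3(1) \<beta>]
      unfolding has_free_boolean_clt_distribution_def by (simp add: pair_weight_def)
    have "\<Gamma> (prod_list (map (nc_var \<circ> ?\<beta>) (sorted_list_of_set {1..?n}))) =
        ?\<Phi> (prod_list (map (nc_var \<circ> ?\<beta>) (sorted_list_of_set {1..?n})))"
    proof (rule cumulant_determines_top_moment[OF 3(1) cum])
      fix V assume V: "V \<subset> {1..?n}"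
      then have fin: "finite V" by (meson finite_atLeastAtMost finite_subset psubset_imp_subset)
      have "card V < ?n" using psubset_card_mono[OF _ V] by simp
      then have "length (map ?\<beta> (sorted_list_of_set V)) < ?n" by simp
      moreover have "?\<beta> i \<in> I \<union> J" if "i \<in> V" for i using that V \<beta> by blast
      then have "map ?\<beta> (sorted_list_of_set V) \<in> lists (I \<union> J)"
        using fin by (simp add: in_lists_conv_set)
      ultimately show "\<Gamma> (prod_list (map (nc_var \<circ> ?\<beta>) (sorted_list_of_set V))) =
          ?\<Phi> (prod_list (map (nc_var \<circ> ?\<beta>) (sorted_list_of_set V)))"
        unfolding map_map[symmetric] prod_list_nc_var by (rule less.hyps)
    qed
    then show ?thesis
      unfolding map_map[symmetric] prod_list_nc_var word_as_positions .
  qed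
qed

lemma free_boolean_clt_eq_pairing_functional: "free_boolean_clt I J C = pairing_functional I J C"
  unfolding free_boolean_clt_def
proof (rule the_equality, intro conjI ballI)
  show "pairing_functional I J C \<in> extensional (nc_polys (I \<union> J))"
    by (simp add: pairing_functional_def)
  show "linear_on nc_scale (*) (nc_polys (I \<union> J)) (pairing_functional I J C)"
    by (rule linear_pairing_functional)
  show "pairing_functional I J C 1 = 1"
    using pairing_functional_single[of "[]" I J C] by (simp add: single_Nil)
  show "has_free_boolean_clt_distribution (pairing_functional I J C) I J nc_var"
    unfolding has_free_boolean_clt_distribution_def
    by (simp add: cumulant_pairing_functional pair_weight_def)
  show "pairing_functional I J C (nc_var k * nc_var l) = C k l" if "k \<in> I \<union> J" "l \<in> I \<union> J" for k l
    using prod_list_nc_var[of "[k, l]"] pairing_functional_single[of "[k, l]" I J C] that by simp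
next
  fix \<Gamma> assume \<Gamma>: "\<Gamma> \<in> extensional (nc_polys (I \<union> J)) \<and>
        linear_on nc_scale (*) (nc_polys (I \<union> J)) \<Gamma> \<and> \<Gamma> 1 = 1 \<and>
        has_free_boolean_clt_distribution \<Gamma> I J nc_var \<and>
        (\<forall>k\<in>I \<union> J. \<forall>l\<in>I \<union> J. \<Gamma> (nc_var k * nc_var l) = C k l)"
  show "\<Gamma> = pairing_functional I J C"
  proof (rule extensionalityI)
    show "\<Gamma> \<in> extensional (nc_polys (I \<union> J))" using \<Gamma> by blast
    show "pairing_functional I J C \<in> extensional (nc_polys (I \<union> J))"
      by (simp add: pairing_functional_def)
    fix P assume P: "P \<in> nc_polys (I \<union> J)"
    have lin: "linear_on nc_scale (*) (nc_polys (I \<union> J)) \<Gamma>" using \<Gamma> by blast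
    have "\<Gamma> (Poly_Mapping.single w 1) = pairing_functional I J C (Poly_Mapping.single w 1)"
      if "w \<in> Poly_Mapping.keys P" for w
      using \<Gamma> that P by (intro clt_distribution_word[OF lin]) (auto simp: nc_polys_def)
    then show "\<Gamma> P = pairing_functional I J C P"
      unfolding linear_on_nc_polys_expand[OF lin P] linear_on_nc_polys_expand[OF linear_pairing_functional P]
      by simp
  qed
qed

section \<open>The central limit theorem\<close>

text \<open>
  Applied to words of a single colour, the formula for vacuum expectations shows that the
  coordinates of the representing vectors are the moments of the variables of that colour.
\<close>

lemma mixed_moments_eq_stack_moment:
  fixes \<phi> :: "'a::ring_1 \<Rightarrow> complex"
  assumes "free_boolean_independent_families TYPE('v::ab_group_add) scale \<phi> L I J z"
  shows "\<exists>m. (\<forall>n\<in>L. \<forall>ks\<in>lists (I \<union> J). m n ks = \<phi> (prod_list (map (z n) ks))) \<and>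
    (\<forall>r. set r \<subseteq> L \<times> (I \<union> J) \<longrightarrow>
      \<phi> (prod_list (map (\<lambda>(n, k). z n k) (rev r))) = stack_moment J m r [])"
proof -
  let ?B = "\<lambda>n. generated_unital_algebra scale (z n ` I)" and ?C = "\<lambda>n. generated_algebra scale (z n ` J)"
  obtain s :: "complex \<Rightarrow> 'v \<Rightarrow> 'v" and X X0 \<xi> lh rh where
    fam: "vector_space_family s L X X0 \<xi>" and
    hom: "\<And>n. n \<in> L \<Longrightarrow> operator_homomorphism scale (?B n) s (X n) (lh n)"
      "\<And>n. n \<in> L \<Longrightarrow> operator_homomorphism scale (?C n) s (X n) (rh n)" and
    mom: "\<And>as. (\<forall>(c, n, a)\<in>set as. n \<in> L \<and> a \<in> (case c of Bullet \<Rightarrow> ?B n | Circle \<Rightarrow> ?C n)) \<Longrightarrow>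
           \<phi> (prod_list (map (\<lambda>(c, n, a). a) as)) =
           vector_state (fun_scale (fun_scale (*)))
             (vector_space_family.free_space0 s L X0) (vector_space_family.free_xi s X0)
             (foldr (\<circ>) (map (vector_space_family.face_operator s L X X0 \<xi> lh rh) as) id)"
    using assms unfolding free_boolean_independent_families_def free_boolean_independent_def by blast
  interpret vector_space_family s L X X0 \<xi> by (rule fam)
  define T where "T n k = (if k \<in> J then rh n (z n k) else lh n (z n k))" for n k
  have gen: "z n k \<in> ?B n" if "k \<in> I" for n k
    using that unfolding generated_unital_algebra_def by (intro hull_inc) simp
  have gen': "z n k \<in> ?C n" if "k \<in> J" for n k
    using that unfolding generated_algebra_def by (intro hull_inc) simp
  have T: "linear_operator_on s (X n) (T n k)" if "n \<in> L" "k \<in> I \<union> J" for n k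
    using hom[OF that(1)] gen[of k n] gen'[of k n] that(2)
    by (auto simp: T_def operator_homomorphism_def)
  have words: "\<phi> (prod_list (map (\<lambda>(n, k). z n k) (rev r))) = stack_moment J (word_moment T) r []"
    if r: "set r \<subseteq> L \<times> (I \<union> J)" for r
  proof -
    define f where "f = (\<lambda>(n, k). (face_colour J k, n, z n k))"
    have "\<phi> (prod_list (map (\<lambda>(c, n, a). a) (map f (rev r)))) =
        vector_state free_scale free_space0 free_xi (foldr (\<circ>) (map (face_operator lh rh) (map f (rev r))) id)"
    proof (rule mom)
      show "\<forall>(c, n, a)\<in>set (map f (rev r)). n \<in> L \<and> a \<in> (case c of Bullet \<Rightarrow> ?B n | Circle \<Rightarrow> ?C n)"
        using r gen gen' by (auto simp: f_def face_colour_def)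
    qed
    moreover have "map (face_operator lh rh) (map f (rev r)) = map (letter_operator J T) (rev r)"
      by (auto simp: f_def letter_operator_def T_def face_colour_def)
    moreover have "map (\<lambda>(c, n, a). a) (map f (rev r)) = map (\<lambda>(n, k). z n k) (rev r)"
      by (auto simp: f_def)
    ultimately have "\<phi> (prod_list (map (\<lambda>(n, k). z n k) (rev r))) =
        vector_state free_scale free_space0 free_xi (foldr (\<circ>) (map (letter_operator J T) (rev r)) id)"
      by (simp only:)
    also have "\<dots> = stack_moment J (word_moment T) r []"
      by (rule vector_state_word[where K = "I \<union> J" and T = T and J = J, OF T r])
    finally show ?thesis .
  qed
  \<comment> \<open>Both sides are the vacuum expectation of the word \<open>ks\<close> in the single colour \<open>n\<close>.\<close>
  have "word_moment T n ks = \<phi> (prod_list (map (z n) ks))" if "n \<in> L" "ks \<in> lists (I \<union> J)" for n ks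
  proof -
    have "word_moment T n [] = 1" using that by (simp add: word_moment_def word_vector_def xi_coeff_xi)
    then have "stack_moment J (word_moment T) (map (Pair n) (rev ks)) [] = word_moment T n ks"
      by (simp add: stack_moment_single_colour)
    moreover have "set (map (Pair n) (rev ks)) \<subseteq> L \<times> (I \<union> J)" using that by auto
    ultimately show ?thesis
      using words[of "map (Pair n) (rev ks)"] by (simp add: rev_map comp_def)
  qed
  with words show ?thesis by blast
qed

lemma (in nc_probability_space) prod_list_scaled_sums:
  "prod_list (map (\<lambda>k. scale a (\<Sum>n=1..N. z n k)) (rev ks)) =
   scale (a ^ length ks) (\<Sum>ns\<in>colourings N (length ks). prod_list (map (\<lambda>(n, k). z n k) (rev (zip ns ks))))"
proof (induction ks)
  case Nil
  show ?case by simp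
next
  case (Cons k ks)
  let ?X = "\<lambda>ns. prod_list (map (\<lambda>(n, k). z n k) (rev (zip ns ks)))"
  have "prod_list (map (\<lambda>k. scale a (\<Sum>n=1..N. z n k)) (rev (k # ks))) =
      scale (a ^ length ks) (\<Sum>ns\<in>colourings N (length ks). ?X ns) * scale a (\<Sum>n=1..N. z n k)"
    using Cons by simp
  also have "\<dots> = scale (a ^ length (k # ks)) ((\<Sum>ns\<in>colourings N (length ks). ?X ns) * (\<Sum>n=1..N. z n k))"
    by (simp add: scale_mult_left scale_mult_right mult.commute)
  also have "(\<Sum>ns\<in>colourings N (length ks). ?X ns) * (\<Sum>n=1..N. z n k) =
      (\<Sum>n=1..N. \<Sum>ns\<in>colourings N (length ks). ?X ns * z n k)"
    unfolding sum_product by (rule sum.swap)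
  also have "\<dots> = (\<Sum>ns\<in>colourings N (length (k # ks)).
      prod_list (map (\<lambda>(n, k). z n k) (rev (zip ns (k # ks)))))"
    by (simp add: sum_colourings_Suc)
  finally show ?case .
qed

theorem theorem8p4:
  fixes scale :: "complex \<Rightarrow> 'a::ring_1 \<Rightarrow> 'a"
    and \<phi> :: "'a \<Rightarrow> complex"
    and I J :: "'k set"
    and z :: "nat \<Rightarrow> 'k \<Rightarrow> 'a"
    and C :: "'k \<Rightarrow> 'k \<Rightarrow> complex"
  assumes "nc_probability_space scale \<phi>"
    and "I \<inter> J = {}"
    and "free_boolean_independent_families TYPE('v::ab_group_add) scale \<phi> {1..} I J z"
    and "\<And>n k. n \<ge> 1 \<Longrightarrow> k \<in> I \<union> J \<Longrightarrow> \<phi> (z n k) = 0"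
    and "\<And>ks. ks \<noteq> [] \<Longrightarrow> ks \<in> lists (I \<union> J) \<Longrightarrow>
           bdd_above ((\<lambda>n. cmod (\<phi> (prod_list (map (z n) ks)))) ` {1..})"
    and "\<And>k l. k \<in> I \<union> J \<Longrightarrow> l \<in> I \<union> J \<Longrightarrow>
           (\<lambda>N. 1 / of_nat N * (\<Sum>n=1..N. \<phi> (z n k * z n l))) \<longlonglongrightarrow> C k l"
  shows "\<forall>P\<in>nc_polys (I \<union> J).
           (\<lambda>N. distribution scale \<phi>
                  (\<lambda>k. scale (complex_of_real (1 / sqrt (real N))) (\<Sum>n=1..N. z n k)) P)
             \<longlonglongrightarrow> free_boolean_clt I J C P"
proof
  interpret nc_probability_space scale \<phi> by (rule assms(1))
  interpret \<phi>: Vector_Spaces.linear scale "(*)" \<phi> by (rule linear_\<phi>)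
  let ?K = "I \<union> J" and ?a = "\<lambda>N. complex_of_real (1 / sqrt (real N))"
  let ?S = "\<lambda>N k. scale (?a N) (\<Sum>n=1..N. z n k)"
  obtain m where
    m: "\<And>n ks. n \<ge> 1 \<Longrightarrow> ks \<in> lists ?K \<Longrightarrow> m n ks = \<phi> (prod_list (map (z n) ks))" and
    words: "\<And>r. set r \<subseteq> {1..} \<times> ?K \<Longrightarrow>
      \<phi> (prod_list (map (\<lambda>(n, k). z n k) (rev r))) = stack_moment J m r []"
    using mixed_moments_eq_stack_moment[OF assms(3)] by auto
  have word_limit: "(\<lambda>N. \<phi> (prod_list (map (?S N) w))) \<longlonglongrightarrow> pairing_moment (\<lambda>k. k \<in> J) C (rev w) []"
    if w: "w \<in> lists ?K" for w
  proof -
    define ks where "ks = rev w"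
    have ks: "set ks \<subseteq> ?K" "rev ks = w" using w by (auto simp: ks_def)
    have "\<phi> (prod_list (map (?S N) w)) =
        ?a N ^ length ks * (\<Sum>ns\<in>colourings N (length ks). stack_moment J m (zip ns ks) [])" for N
    proof -
      have "\<phi> (prod_list (map (\<lambda>(n, k). z n k) (rev (zip ns ks)))) = stack_moment J m (zip ns ks) []"
        if ns: "ns \<in> colourings N (length ks)" for ns
        using ns ks(1) by (intro words) (auto simp: colourings_def dest: set_zip_leftD set_zip_rightD)
      then show ?thesis
        unfolding ks(2)[symmetric] prod_list_scaled_sums \<phi>.scale \<phi>.sum by simp
    qed
    moreover have "(\<lambda>N. ?a N ^ length ks *
        (\<Sum>ns\<in>colourings N (length ks). stack_moment J m (zip ns ks) [])) \<longlonglongrightarrow>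
      pairing_moment (\<lambda>k. k \<in> J) C ks []"
    proof (rule stack_moment_clt[OF _ _ _ ks(1)])
      show "m n [k] = 0" if "n \<ge> 1" "k \<in> ?K" for n k
        using m[of n "[k]"] assms(4)[OF that] that by simp
      show "\<exists>D. \<forall>n\<in>{1..}. cmod (m n js) \<le> D" if "js \<noteq> []" "set js \<subseteq> ?K" for js
      proof -
        have "js \<in> lists ?K" using that by auto
        then show ?thesis using assms(5)[of js] m[of _ js] that by (auto simp: bdd_above_def)
      qed
      show "(\<lambda>N. 1 / of_nat N * (\<Sum>n=1..N. m n [k, l])) \<longlonglongrightarrow> C k l" if "k \<in> ?K" "l \<in> ?K" for k l
      proof -
        have "(\<Sum>n=1..N. m n [k, l]) = (\<Sum>n=1..N. \<phi> (z n k * z n l))" for N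
          using that by (intro sum.cong refl) (simp add: m)
        then show ?thesis using assms(6)[OF that] by simp
      qed
    qed
    ultimately show ?thesis by (simp add: ks_def)
  qed
  fix P assume P: "P \<in> nc_polys ?K"
  have "(\<lambda>N. distribution scale \<phi> (?S N) P) =
      (\<lambda>N. \<Sum>w\<in>Poly_Mapping.keys P. Poly_Mapping.lookup P w * \<phi> (prod_list (map (?S N) w)))"
    by (simp add: distribution_def nc_eval_def \<phi>.sum \<phi>.scale)
  moreover have "\<dots> \<longlonglongrightarrow> (\<Sum>w\<in>Poly_Mapping.keys P.
      Poly_Mapping.lookup P w * pairing_moment (\<lambda>k. k \<in> J) C (rev w) [])"
    using P by (intro tendsto_sum tendsto_mult tendsto_const word_limit) (auto simp: nc_polys_def)
  moreover have "free_boolean_clt I J C P = (\<Sum>w\<in>Poly_Mapping.keys P.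
      Poly_Mapping.lookup P w * pairing_moment (\<lambda>k. k \<in> J) C (rev w) [])"
    using P by (simp add: free_boolean_clt_eq_pairing_functional pairing_functional_def)
  ultimately show "(\<lambda>N. distribution scale \<phi> (?S N) P) \<longlonglongrightarrow> free_boolean_clt I J C P" by simp
qed

end
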